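(* Let $k(c):=\lambda+\theta+\lambda\Phi'(c)$. Assume that either $k(c)>0$ for all $c\in[0,1]$, or $k(c)<0$ for all $c\in[0,1]$. Then for all $(x,c)\in\mathbb{R}\times[0,1]$ the value function $$V(x,c):=\inf_{\tau\in\mathcal T,\ \nu\in\mathcal S^c_\tau}\mathsf E\Big[\int_\tau^\infty e^{-\lambda t}X^x_t\,d\nu_t+\int_\tau^\infty e^{-\lambda t}\lambda X^x_t\Phi(c+\nu_t)\,dt-e^{-\lambda\tau}P_0\Big]$$ can be equivalently rewritten as $$V(x,c)=\inf_{\tau\in\mathcal T}\mathsf E\Big[e^{-\lambda\tau}\big(U(X^x_\tau,c)-P_0\big)\Big],$$ with the convention that on $\{\tau=\infty\}$ one sets $e^{-\lambda\tau}(U(X^x_\tau,c)-P_0):=\liminf_{t\uparrow\infty}e^{-\lambda t}(U(X^x_t,c)-P_0)$, which equals $0$ almost surely.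
   Context: Let $(\Omega,\mathcal A,\mathsf P)$ be a complete probability space carrying a one-dimensional standard Brownian motion $B$, with $(\mathcal F_t)_{t\ge0}$ the filtration generated by $B$ augmented by $\mathsf P$-null sets, and $\mathcal T$ the set of all $(\mathcal F_t)$-stopping times with values in $[0,\infty]$. Let $\theta,\mu,\sigma,\lambda,P_0>0$ be constants. For $x\in\mathbb R$, $X^x$ is the Ornstein-Uhlenbeck process, i.e. the unique strong solution of $dX^x_t=\theta(\mu-X^x_t)dt+\sigma dB_t$, $X^x_0=x$. $\Phi:\mathbb R\to\mathbb R$ is $C^2$, and on $[0,1]$ it is decreasing and strictly convex, with $\Phi(1)=0$ (hence $\Phi\ge0$ on $[0,1]$). For $c\in[0,1]$ and $\tau\in\mathcal T$, $\mathcal S^c_\tau$ is the set of processes $\nu:\Omega\times[0,\infty)\to[0,\infty)$ that are nondecreasing, left-continuous, $(\mathcal F_t)$-adapted, with $c+\nu_t\le1$ for all $t\ge0$ and $\nu_\tau=0$, $\mathsf P$-a.s. Integrals $\int_\tau^\infty\cdots d\nu_t$ are over $[\tau,\infty)$, thus including a possible jump $\nu_{\tau+}-\nu_\tau$ at time $\tau$. On $\{\tau=+\infty\}$ one sets $\int_\tau^\infty:=0$ and $e^{-\lambda\tau}:=0$. The function $U$ is the value function of the control problem with entry time zero: $$U(x,c):=\inf_{\nu\in\mathcal S^c_0}\mathsf E\Big[\int_0^\infty e^{-\lambda t}X^x_t\,d\nu_t+\int_0^\infty e^{-\lambda t}\lambda X^x_t\Phi(c+\nu_t)\,dt\Big].$$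 *)

theory Defs
  imports "HOL-Probability.Probability"
begin

text \<open>
  Conventions. A real-valued process is a function \<open>real \<Rightarrow> 'a \<Rightarrow> real\<close> of which only the times
  \<open>t \<ge> 0\<close> matter. Random times in \<open>[0,\<infinity>]\<close> are \<open>ennreal\<close>-valued, and filtrations are indexed by
  \<^typ>\<open>ennreal\<close> so that \<^const>\<open>stopping_time\<close> applies; its condition at the index \<open>\<infinity>\<close> is void.
\<close>

definition brownian_motion :: "'a measure \<Rightarrow> (real \<Rightarrow> 'a \<Rightarrow> real) \<Rightarrow> bool" where
  "brownian_motion M B \<longleftrightarrow>
     (\<forall>t\<ge>0. B t \<in> borel_measurable M) \<and>
     (AE \<omega> in M. B 0 \<omega> = 0) \<and>
     (AE \<omega> in M. continuous_on {0..} (\<lambda>t. B t \<omega>)) \<and>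
     (\<forall>s t. 0 \<le> s \<and> s < t \<longrightarrow>
        distributed M lborel (\<lambda>\<omega>. B t \<omega> - B s \<omega>) (normal_density 0 (sqrt (t - s)))) \<and>
     (\<forall>(t :: nat \<Rightarrow> real) n. 0 \<le> t 0 \<and> incseq t \<longrightarrow>
        prob_space.indep_vars M (\<lambda>_. borel) (\<lambda>i \<omega>. B (t (Suc i)) \<omega> - B (t i) \<omega>) {..<n})"

definition brownian_filtration :: "'a measure \<Rightarrow> (real \<Rightarrow> 'a \<Rightarrow> real) \<Rightarrow> ennreal \<Rightarrow> 'a measure" where
  "brownian_filtration M B t =
     sigma (space M)
       ({B s -` A \<inter> space M | s A. 0 \<le> s \<and> ennreal s \<le> t \<and> A \<in> sets borel} \<union> null_sets M)"

definition adapted :: "(ennreal \<Rightarrow> 'a measure) \<Rightarrow> (real \<Rightarrow> 'a \<Rightarrow> real) \<Rightarrow> bool" where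
  "adapted F Y \<longleftrightarrow> (\<forall>t\<ge>0. Y t \<in> borel_measurable (F (ennreal t)))"

text \<open>
  Strong solution of \<open>dY = \<theta> (\<mu> - Y) dt + \<sigma> dB\<close>, \<open>Y\<^sub>0 = x\<close>, in integral form. The integrand of the
  stochastic integral is the constant \<open>\<sigma>\<close>, so that integral is \<open>\<sigma> (B\<^sub>t - B\<^sub>0)\<close>.
\<close>
definition OU_strong_solution ::
  "'a measure \<Rightarrow> (real \<Rightarrow> 'a \<Rightarrow> real) \<Rightarrow> real \<Rightarrow> real \<Rightarrow> real \<Rightarrow> real \<Rightarrow> (real \<Rightarrow> 'a \<Rightarrow> real) \<Rightarrow> bool" where
  "OU_strong_solution M B \<theta> \<mu> \<sigma> x Y \<longleftrightarrow>
     adapted (brownian_filtration M B) Y \<and>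
     (AE \<omega> in M. continuous_on {0..} (\<lambda>t. Y t \<omega>)) \<and>
     (AE \<omega> in M. \<forall>t\<ge>0.
        Y t \<omega> = x + (LBINT s:{0..t}. \<theta> * (\<mu> - Y s \<omega>)) + \<sigma> * (B t \<omega> - B 0 \<omega>))"

definition C2 :: "(real \<Rightarrow> real) \<Rightarrow> bool" where
  "C2 f \<longleftrightarrow> (\<forall>x. f field_differentiable at x) \<and> (\<forall>x. deriv f field_differentiable at x) \<and>
     continuous_on UNIV (deriv (deriv f))"

definition strictly_convex_on :: "real set \<Rightarrow> (real \<Rightarrow> real) \<Rightarrow> bool" where
  "strictly_convex_on S f \<longleftrightarrow> convex S \<and>
     (\<forall>x\<in>S. \<forall>y\<in>S. \<forall>u. x \<noteq> y \<and> 0 < u \<and> u < 1 \<longrightarrow>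
        f (u * x + (1 - u) * y) < u * f x + (1 - u) * f y)"

text \<open>The set \<open>\<S>\<^sup>c\<^sub>\<tau>\<close>. The condition \<open>\<nu>\<^sub>\<tau> = 0\<close> is imposed where \<open>\<tau>\<close> is finite.\<close>
definition controls ::
  "'a measure \<Rightarrow> (real \<Rightarrow> 'a \<Rightarrow> real) \<Rightarrow> real \<Rightarrow> ('a \<Rightarrow> ennreal) \<Rightarrow> (real \<Rightarrow> 'a \<Rightarrow> real) set" where
  "controls M B c \<tau> =
     {\<nu>. adapted (brownian_filtration M B) \<nu> \<and>
         (\<forall>\<omega>\<in>space M. \<forall>t\<ge>0. 0 \<le> \<nu> t \<omega>) \<and>
         (AE \<omega> in M.
            mono_on {0..} (\<lambda>t. \<nu> t \<omega>) \<and>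
            (\<forall>t>0. continuous (at_left t) (\<lambda>s. \<nu> s \<omega>)) \<and>
            (\<forall>t\<ge>0. c + \<nu> t \<omega> \<le> 1) \<and>
            (\<tau> \<omega> < \<infinity> \<longrightarrow> \<nu> (enn2real (\<tau> \<omega>)) \<omega> = 0))}"

text \<open>
  Lebesgue-Stieltjes measure \<open>dg\<close> on \<open>[0,\<infinity>)\<close> of a nondecreasing, left-continuous \<open>g\<close> on \<open>[0,\<infinity>)\<close>:
  \<^const>\<open>interval_measure\<close> wants a right-continuous distribution function on all of \<open>\<real>\<close>, so \<open>g\<close> is
  replaced by its right limits and extended by \<open>g 0\<close> to the left of \<open>0\<close>. Thus \<open>{t}\<close> has mass
  \<open>g(t+) - g(t)\<close> for every \<open>t \<ge> 0\<close>, and integrals over \<open>{t..}\<close> include the jump at \<open>t\<close>.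
\<close>
definition stieltjes_measure :: "(real \<Rightarrow> real) \<Rightarrow> real measure" where
  "stieltjes_measure g = interval_measure (\<lambda>t. if t < 0 then g 0 else Lim (at_right t) g)"

definition control_cost ::
  "real \<Rightarrow> (real \<Rightarrow> real) \<Rightarrow> (real \<Rightarrow> 'a \<Rightarrow> real) \<Rightarrow> real \<Rightarrow> ('a \<Rightarrow> ennreal) \<Rightarrow> (real \<Rightarrow> 'a \<Rightarrow> real) \<Rightarrow> 'a \<Rightarrow> real" where
  "control_cost lam \<Phi> Y c \<tau> \<nu> \<omega> =
     (if \<tau> \<omega> = \<infinity> then 0
      else (LINT t:{enn2real (\<tau> \<omega>)..}|stieltjes_measure (\<lambda>s. \<nu> s \<omega>). exp (- lam * t) * Y t \<omega>)
         + (LBINT t:{enn2real (\<tau> \<omega>)..}. exp (- lam * t) * lam * Y t \<omega> * \<Phi> (c + \<nu> t \<omega>)))"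

definition discount :: "real \<Rightarrow> ennreal \<Rightarrow> real" where
  "discount lam t = (if t = \<infinity> then 0 else exp (- lam * enn2real t))"

definition U_value ::
  "'a measure \<Rightarrow> (real \<Rightarrow> 'a \<Rightarrow> real) \<Rightarrow> real \<Rightarrow> (real \<Rightarrow> real) \<Rightarrow> (real \<Rightarrow> real \<Rightarrow> 'a \<Rightarrow> real)
     \<Rightarrow> real \<Rightarrow> real \<Rightarrow> real" where
  "U_value M B lam \<Phi> X x c =
     (INF \<nu> \<in> controls M B c (\<lambda>_. 0). \<integral>\<omega>. control_cost lam \<Phi> (X x) c (\<lambda>_. 0) \<nu> \<omega> \<partial>M)"

definition V_value ::
  "'a measure \<Rightarrow> (real \<Rightarrow> 'a \<Rightarrow> real) \<Rightarrow> real \<Rightarrow> real \<Rightarrow> (real \<Rightarrow> real) \<Rightarrow> (real \<Rightarrow> real \<Rightarrow> 'a \<Rightarrow> real)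
     \<Rightarrow> real \<Rightarrow> real \<Rightarrow> real" where
  "V_value M B lam P0 \<Phi> X x c =
     (INF (\<tau>, \<nu>) \<in> {(\<tau>, \<nu>). stopping_time (brownian_filtration M B) \<tau> \<and> \<nu> \<in> controls M B c \<tau>}.
        \<integral>\<omega>. control_cost lam \<Phi> (X x) c \<tau> \<nu> \<omega> - discount lam (\<tau> \<omega>) * P0 \<partial>M)"

definition payoff_at_infinity ::
  "real \<Rightarrow> real \<Rightarrow> (real \<Rightarrow> real) \<Rightarrow> (real \<Rightarrow> 'a \<Rightarrow> real) \<Rightarrow> 'a \<Rightarrow> ereal" where
  "payoff_at_infinity lam P0 u Y \<omega> =
     Liminf at_top (\<lambda>t. ereal (exp (- lam * t) * (u (Y t \<omega>) - P0)))"

text \<open>The random variable \<open>e\<^bsup>-\<lambda>\<tau>\<^esup> (u(Y\<^sub>\<tau>) - P\<^sub>0)\<close> with its convention on \<open>{\<tau> = \<infinity>}\<close>.\<close>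
definition stopped_payoff ::
  "real \<Rightarrow> real \<Rightarrow> (real \<Rightarrow> real) \<Rightarrow> (real \<Rightarrow> 'a \<Rightarrow> real) \<Rightarrow> ('a \<Rightarrow> ennreal) \<Rightarrow> 'a \<Rightarrow> real" where
  "stopped_payoff lam P0 u Y \<tau> \<omega> =
     (if \<tau> \<omega> = \<infinity> then real_of_ereal (payoff_at_infinity lam P0 u Y \<omega>)
      else exp (- lam * enn2real (\<tau> \<omega>)) * (u (Y (enn2real (\<tau> \<omega>)) \<omega>) - P0))"

end

theory Submission
  imports Defs
begin

text \<open>
  A control adapted to the augmented Brownian filtration agrees almost surely with a functional of
  the Brownian path, so both value functions are infima over functionals on path space. At a dyadic
  time \<open>s\<close> the Wiener measure is the image of its own square under splicing a second path onto the
  first one at \<open>s\<close> (the simple Markov property). Integrating out the second path turns the cost of a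
  control after \<open>s\<close> into \<open>e\<^bsup>-\<lambda>s\<^esup>\<close> times the cost, started from \<open>X\<^sub>s\<close>, of a control with entry time
  zero; this is at least \<open>U(X\<^sub>s, c)\<close>. Conversely \<open>U\<close> is Lipschitz in \<open>x\<close>, so a countable choice of
  near-optimal controls on a grid of initial values can be restarted at \<open>s\<close>. A general entry time is
  the limit from above of dyadic ones: delaying a control to the next dyadic time moves its early
  increase into one jump, which changes the cost little because \<open>X\<close> is continuous, and a chaining
  bound for Brownian paths provides the integrable majorant for both passages to the limit.
\<close>

text \<open>The obstacle is that \<open>U_value\<close> is an infimum over controls on the given
  probability space, whereas conditioning a control on the past at the entry time produces a random
  family of controls. Functionals of the path remove it: with the past frozen, the continuation of a
  functional is again a functional, so its cost can be compared with U for every past, and no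
  regular conditional probabilities occur. The price is that admissibility has to hold on every path
  and not only on almost every one, hence the raw filtration in \<open>paths\<close> and the
  reconstruction by \<open>level_sup\<close>. Dyadic entry times take countably many values, which
  turns a strong Markov argument into countably many uses of the Markov property at a fixed time;
  moreover a dyadic time is a grid point, at which independent increments can be cut into two
  blocks. All estimates grant the path a growth rate of half the discount rate; the other half makes
  the time integrals finite and drives the payoff to 0 at infinity.\<close>

section \<open>Stieltjes measures of control paths\<close>

text \<open>Paths live on all of the line and vanish up to time 0, so that monotonicity and
  left-continuity need no one-sided case at 0; this agrees with the extension to the left inside
  \<open>stieltjes_measure\<close>. The bound \<open>p\<close> is the room 1 - c above the initial
  level.\<close>

definition cpath :: "real \<Rightarrow> (real \<Rightarrow> real) \<Rightarrow> bool" where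
  "cpath p g \<longleftrightarrow> mono g \<and> (\<forall>u\<le>0. g u = 0) \<and> (\<forall>u. g u \<le> p) \<and> (\<forall>u. continuous (at_left u) g)"

lemma cpath_range:
  assumes "cpath p g" shows "0 \<le> g u" "g u \<le> p"
proof -
  have "g (min u 0) \<le> g u" using assms monoD[of g "min u 0" u] by (simp add: cpath_def)
  moreover have "g (min u 0) = 0" using assms by (auto simp: cpath_def)
  ultimately show "0 \<le> g u" by simp
qed (use assms in \<open>auto simp: cpath_def\<close>)

text \<open>For a nondecreasing path the infimum is the right limit; written this way it is defined
  before any convergence is shown, and \<open>stieltjes_rlim\<close> identifies it with the
  \<open>Lim\<close> in \<open>stieltjes_measure\<close>.\<close>

definition rlim :: "(real \<Rightarrow> real) \<Rightarrow> real \<Rightarrow> real" where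
  "rlim g t = Inf (g ` {t<..})"

context
  fixes p g assumes g: "cpath p g"
begin

lemma cpath_mono: "x \<le> y \<Longrightarrow> g x \<le> g y"
  using g by (auto simp: cpath_def dest: monoD)

lemma cpath_bdd: "bdd_below (g ` A)"
  using cpath_range(1)[OF g] by (auto intro!: bdd_belowI[of _ 0])

lemma rlim_le: "t < u \<Longrightarrow> rlim g t \<le> g u"
  unfolding rlim_def by (intro cINF_lower cpath_bdd) auto

lemma rlim_ge: "g t \<le> rlim g t"
  unfolding rlim_def by (intro cINF_greatest) (auto intro: cpath_mono)

lemma rlim_mono: "x \<le> y \<Longrightarrow> rlim g x \<le> rlim g y"
  unfolding rlim_def by (intro cINF_superset_mono cpath_bdd) auto

lemma rlim_bound: "rlim g t \<le> p"
  using rlim_le[of t "t+1"] cpath_range[OF g, of "t+1"] by simp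

lemma rlim_nonneg: "0 \<le> rlim g t"
  using rlim_ge[of t] cpath_range[OF g, of t] by simp

lemma rlim_zero: "g s = 0 \<Longrightarrow> t < s \<Longrightarrow> rlim g t = 0"
  using rlim_le[of t s] rlim_nonneg[of t] by simp

lemma rlim_less:
  assumes "rlim g t < a" shows "\<exists>u>t. g u < a"
  using assms unfolding rlim_def by (subst (asm) cINF_less_iff) (auto intro: cpath_bdd)

lemma tendsto_rlim: "(g \<longlongrightarrow> rlim g t) (at_right t)"
proof (rule order_tendstoI)
  fix a assume "a < rlim g t"
  then show "\<forall>\<^sub>F x in at_right t. a < g x"
    unfolding eventually_at_right_field by (intro exI[of _ "t + 1"]) (auto dest: rlim_le)
next
  fix a assume "rlim g t < a"
  then obtain u where u: "u > t" "g u < a" using rlim_less by blast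
  then show "\<forall>\<^sub>F x in at_right t. g x < a"
    unfolding eventually_at_right_field
    using cpath_mono[OF less_imp_le] le_less_trans by blast
qed

lemma rlim_right_cont: "continuous (at_right t) (rlim g)"
  unfolding continuous_within
proof (rule order_tendstoI)
  fix a assume "a < rlim g t"
  then show "\<forall>\<^sub>F x in at_right t. a < rlim g x"
    unfolding eventually_at_right_field
    by (intro exI[of _ "t + 1"]) (auto intro: order_less_le_trans[OF _ rlim_mono])
next
  fix a assume "rlim g t < a"
  then obtain u where u: "u > t" "g u < a" using rlim_less by blast
  then show "\<forall>\<^sub>F x in at_right t. rlim g x < a"
    unfolding eventually_at_right_field
    using rlim_le le_less_trans by blast
qed

lemma stieltjes_rlim: "stieltjes_measure g = interval_measure (rlim g)"
proof -
  have "(if t < 0 then g 0 else Lim (at_right t) g) = rlim g t" for t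
    using rlim_zero[of 0 t] g tendsto_Lim[OF _ tendsto_rlim[of t]]
    by (simp add: cpath_def trivial_limit_at_right_real)
  then show ?thesis unfolding stieltjes_measure_def by (simp only:)
qed

lemma emeasure_stieltjes_Ioc: "a \<le> b \<Longrightarrow> emeasure (stieltjes_measure g) {a<..b} = rlim g b - rlim g a"
  unfolding stieltjes_rlim by (intro emeasure_interval_measure_Ioc rlim_mono rlim_right_cont)

text \<open>No mass lies to the left of 0. Half-lines are an intersection-stable generator, so this
  formula is what later identifies shifted and delayed measures.\<close>

lemma emeasure_stieltjes_atMost: "emeasure (stieltjes_measure g) {..b} = rlim g b"
proof -
  \<comment> \<open>The left endpoints lie below 0, where \<open>rlim g\<close> vanishes, and also
    below \<open>b\<close>, as \<open>emeasure_stieltjes_Ioc\<close> requires.\<close>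
  have "(\<lambda>n. emeasure (stieltjes_measure g) {- 1 - \<bar>b\<bar> - real n<..b}) \<longlonglongrightarrow>
    emeasure (stieltjes_measure g) (\<Union>n. {- 1 - \<bar>b\<bar> - real n<..b})"
    by (intro Lim_emeasure_incseq) (auto simp: incseq_def stieltjes_measure_def)
  also have "(\<Union>n. {- 1 - \<bar>b\<bar> - real n<..b}) = {..b}"
  proof (intro set_eqI iffI)
    fix x assume "x \<in> {..b}"
    moreover obtain n :: nat where "\<bar>x\<bar> < real n" using reals_Archimedean2 by blast
    ultimately show "x \<in> (\<Union>n. {- 1 - \<bar>b\<bar> - real n<..b})" by (auto intro!: exI[of _ n])
  qed auto
  also have "(\<lambda>n. emeasure (stieltjes_measure g) {- 1 - \<bar>b\<bar> - real n<..b}) = (\<lambda>n. ennreal (rlim g b))"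
  proof
    fix n :: nat
    show "emeasure (stieltjes_measure g) {- 1 - \<bar>b\<bar> - real n<..b} = rlim g b"
      using emeasure_stieltjes_Ioc[of "- 1 - \<bar>b\<bar> - real n" b] rlim_zero[of 0 "- 1 - \<bar>b\<bar> - real n"] g
      by (simp add: cpath_def)
  qed
  finally show ?thesis by (simp only: LIMSEQ_const_iff)
qed

lemma emeasure_stieltjes_UNIV: "emeasure (stieltjes_measure g) UNIV \<le> p"
proof -
  have "(\<lambda>n. emeasure (stieltjes_measure g) {..real n}) \<longlonglongrightarrow>
    emeasure (stieltjes_measure g) (\<Union>n. {..real n})"
    by (intro Lim_emeasure_incseq) (auto simp: incseq_def stieltjes_measure_def)
  also have "(\<Union>n. {..real n}) = UNIV" using real_arch_simple by auto
  finally show ?thesis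
    by (rule LIMSEQ_le_const2) (auto simp: emeasure_stieltjes_atMost rlim_bound intro!: ennreal_leI)
qed

text \<open>The point \<open>s\<close> itself may carry an atom of mass g(s+), so only the mass
  strictly before \<open>s\<close> vanishes, and the exhaustion has to stop short of
  \<open>s\<close>.\<close>

lemma stieltjes_lessThan: assumes "g s = 0" shows "emeasure (stieltjes_measure g) {..<s} = 0"
proof -
  have "(\<lambda>n. emeasure (stieltjes_measure g) {..s - 1 / Suc n}) \<longlonglongrightarrow>
    emeasure (stieltjes_measure g) (\<Union>n. {..s - 1 / Suc n})"
    by (intro Lim_emeasure_incseq) (auto simp: incseq_def frac_le stieltjes_measure_def intro: order_trans diff_left_mono)
  also have "(\<Union>n. {..s - 1 / Suc n}) = {..<s}"
  proof (intro set_eqI iffI)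
    fix x assume "x \<in> {..<s}"
    then obtain n where "1 / Suc n < s - x" using nat_approx_posE[of "s - x"] by auto
    then show "x \<in> (\<Union>n. {..s - 1 / Suc n})" by (auto intro!: exI[of _ n])
  next
    fix x assume "x \<in> (\<Union>n. {..s - 1 / Suc n})"
    then obtain n where "x \<le> s - 1 / Suc n" by auto
    moreover have "1 / Suc n > (0::real)" by simp
    ultimately show "x \<in> {..<s}" by (auto intro: le_less_trans)
  qed
  finally show ?thesis by (simp add: emeasure_stieltjes_atMost rlim_zero[OF assms] LIMSEQ_const_iff)
qed

lemma AE_stieltjes: assumes "g s = 0" shows "AE t in stieltjes_measure g. s \<le> t"
  by (rule AE_I'[of "{..<s}"]) (use stieltjes_lessThan[OF assms] in \<open>auto simp: null_sets_def stieltjes_measure_def\<close>)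

end

lemma sets_stieltjes [simp, measurable_cong]: "sets (stieltjes_measure g) = sets borel"
  by (simp add: stieltjes_measure_def)

lemma space_stieltjes [simp]: "space (stieltjes_measure g) = UNIV"
  by (simp add: stieltjes_measure_def)

lemma subprob_stieltjes:
  assumes "cpath p g" "p \<le> 1" shows "subprob_space (stieltjes_measure g)"
proof (rule subprob_spaceI)
  have "ennreal p \<le> 1" using assms(2) by simp
  then show "emeasure (stieltjes_measure g) (space (stieltjes_measure g)) \<le> 1"
    using emeasure_stieltjes_UNIV[OF assms(1)] by (metis order_trans space_stieltjes)
qed simp

lemma stieltjes_eqI:
  assumes g: "cpath p g" and N: "sets N = sets borel" "\<And>b. emeasure N {..b} = ennreal (rlim g b)"
  shows "stieltjes_measure g = N"
proof (rule measure_eqI_generator_eq[where E="range (\<lambda>b. {..b})" and \<Omega>=UNIV and A="\<lambda>i::nat. {..real i}"])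
  have "sets borel = sigma_sets UNIV (range (\<lambda>b. {..b::real}))" by (subst borel_eq_atMost) simp
  then show "sets (stieltjes_measure g) = sigma_sets UNIV (range (\<lambda>b. {..b}))"
    "sets N = sigma_sets UNIV (range (\<lambda>b. {..b}))" using N by simp_all
  show "(\<Union>i::nat. {..real i}) = UNIV" using real_arch_simple by auto
qed (auto simp: Int_stable_def emeasure_stieltjes_atMost[OF g] N)

text \<open>Controls are unconstrained at negative times; this lets them be exchanged for a
  \<open>cpath\<close> with the same values on the half-line.\<close>

lemma stieltjes_cong:
  assumes "\<And>t. t \<ge> 0 \<Longrightarrow> f t = g t" shows "stieltjes_measure f = stieltjes_measure g"
proof -
  have "Lim (at_right t) f = Lim (at_right t) g" if "0 \<le> t" for t
  proof -
    have "\<forall>\<^sub>F x in at_right t. f x = g x"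
      using that assms by (auto simp: eventually_at_filter)
    then show ?thesis unfolding t2_space_class.Lim_def by (simp cong: tendsto_cong)
  qed
  then show ?thesis using assms unfolding stieltjes_measure_def by (intro arg_cong[where f=interval_measure] ext) auto
qed

section \<open>Shifted and delayed control paths\<close>

lemma cpath_shift:
  assumes g: "cpath p g" and "g s = 0" shows "cpath p (\<lambda>u. g (s + u))"
  unfolding cpath_def
proof (intro conjI allI impI)
  show "mono (\<lambda>u. g (s + u))" using cpath_mono[OF g] by (auto simp: mono_def)
  show "g (s + u) = 0" if "u \<le> 0" for u
    using cpath_mono[OF g, of "s+u" s] cpath_range[OF g, of "s+u"] that assms by auto
  show "g (s + u) \<le> p" for u using cpath_range[OF g] by auto
  show "continuous (at_left u) (\<lambda>u. g (s + u))" for u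
  proof -
    have "(g \<longlongrightarrow> g (s + u)) (at_left (s + u))" using g by (auto simp: cpath_def continuous_within)
    moreover have "filterlim ((+) s) (at_left (s + u)) (at_left u)"
      unfolding filterlim_at by (auto intro!: tendsto_eq_intros simp: eventually_at_filter)
    ultimately show ?thesis unfolding continuous_within by (rule filterlim_compose)
  qed
qed

lemma rlim_shift: "rlim (\<lambda>u. g (s + u)) t = rlim g (s + t)"
proof -
  have "{s + t<..} = (+) s ` {t<..}"
  proof (intro set_eqI iffI)
    fix x assume "x \<in> {s + t<..}"
    then show "x \<in> (+) s ` {t<..}" by (intro image_eqI[of _ _ "x - s"]) auto
  qed auto
  then have "(\<lambda>u. g (s + u)) ` {t<..} = g ` {s + t<..}" by (simp add: image_image)
  then show ?thesis by (simp add: rlim_def)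
qed

lemma stieltjes_shift:
  assumes g: "cpath p g" and "g s = 0"
  shows "stieltjes_measure (\<lambda>u. g (s + u)) = distr (stieltjes_measure g) borel (\<lambda>x. x - s)"
proof (rule stieltjes_eqI[OF cpath_shift[OF assms]])
  fix b :: real
  have "(\<lambda>x. x - s) -` {..b} = {..s+b}" by auto
  then show "emeasure (distr (stieltjes_measure g) borel (\<lambda>x. x - s)) {..b} = ennreal (rlim (\<lambda>u. g (s + u)) b)"
    by (simp add: emeasure_distr rlim_shift emeasure_stieltjes_atMost[OF g])
qed simp

text \<open>The increase before \<open>r\<close> becomes part of the jump at \<open>r\<close>, see \<open>stieltjes_delay\<close>.\<close>
definition delay :: "real \<Rightarrow> (real \<Rightarrow> real) \<Rightarrow> real \<Rightarrow> real" where
  "delay r g t = (if r < t then g t else 0)"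

lemma cpath_delay:
  assumes g: "cpath p g" and r: "0 \<le> r" shows "cpath p (delay r g)"
  unfolding cpath_def
proof (intro conjI allI impI)
  show "mono (delay r g)" using cpath_mono[OF g] cpath_range(1)[OF g] by (auto simp: mono_def delay_def)
  show "delay r g u = 0" if "u \<le> 0" for u using that r by (auto simp: delay_def)
  show "delay r g u \<le> p" for u using cpath_range[OF g, of u] by (simp add: delay_def)
  show "continuous (at_left u) (delay r g)" for u
  proof (cases "r < u")
    case True
    have "\<forall>\<^sub>F x in at_left u. delay r g x = g x"
      using eventually_at_left_real[OF True] by eventually_elim (auto simp: delay_def)
    moreover have "(g \<longlongrightarrow> g u) (at_left u)" using g by (auto simp: cpath_def continuous_within)
    ultimately show ?thesis using True unfolding continuous_within
      by (subst tendsto_cong) (auto simp: delay_def)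
  next
    case False
    have "\<forall>\<^sub>F x in at_left u. delay r g x = 0"
      using False by (auto simp: delay_def eventually_at_filter)
    then show ?thesis using False unfolding continuous_within
      by (subst tendsto_cong) (auto simp: delay_def)
  qed
qed

lemma rlim_delay:
  assumes g: "cpath p g" and r: "0 \<le> r"
  shows "rlim (delay r g) t = (if t < r then 0 else rlim g t)"
proof -
  have "rlim g t = rlim (delay r g) t" if "r \<le> t"
    unfolding rlim_def using that by (intro arg_cong[where f=Inf] image_cong) (auto simp: delay_def)
  then show ?thesis using rlim_zero[OF cpath_delay[OF assms], of r t] by (auto simp: delay_def)
qed

text \<open>As a push-forward of one fixed measure, the delay moves from the integrator into the
  integrand. Convergence as the delay shrinks then becomes dominated convergence.\<close>

lemma stieltjes_delay:
  assumes g: "cpath p g" and r: "0 \<le> r"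
  shows "stieltjes_measure (delay r g) = distr (stieltjes_measure g) borel (max r)"
proof (rule stieltjes_eqI[OF cpath_delay[OF assms]])
  fix b :: real
  have "max r -` {..b} = (if r \<le> b then {..b} else {})" by auto
  then show "emeasure (distr (stieltjes_measure g) borel (max r)) {..b} = ennreal (rlim (delay r g) b)"
    by (simp add: emeasure_distr rlim_delay[OF assms] emeasure_stieltjes_atMost[OF g])
qed simp

text \<open>The time is replaced by the largest grid point strictly below it (ceiling minus one).
  Strictness matters because left-continuity speaks of the filter \<open>at_left\<close>
  only.\<close>

lemma measurable_left_cont:
  fixes f :: "real \<Rightarrow> 'a \<Rightarrow> real"
  assumes f [measurable]: "\<And>t. f t \<in> borel_measurable N"
    and c: "\<And>x t. x \<in> space N \<Longrightarrow> continuous (at_left t) (\<lambda>t. f t x)"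
  shows "(\<lambda>(t, x). f t x) \<in> borel_measurable (borel \<Otimes>\<^sub>M N)"
proof (rule borel_measurable_LIMSEQ_real)
  let ?d = "\<lambda>i z. real_of_int (\<lceil>2^i * z\<rceil> - 1) / 2^i :: real"
  fix z :: "real \<times> 'a" assume z: "z \<in> space (borel \<Otimes>\<^sub>M N)"
  have d: "?d i t < t" "t - (1/2)^i \<le> ?d i t" for i t
    using ceiling_correct[of "2^i * t"] by (auto simp: field_simps power_one_over)
  have "(\<lambda>i. ?d i t) \<longlonglongrightarrow> t" for t
    by (rule tendsto_sandwich[of "\<lambda>i. t - (1/2)^i" _ _ "\<lambda>_. t"])
       (use d in \<open>auto intro!: always_eventually less_imp_le tendsto_eq_intros LIMSEQ_realpow_zero\<close>)
  then have "filterlim (\<lambda>i. ?d i t) (at_left t) sequentially" for t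
    unfolding filterlim_at using d(1) by (auto intro!: always_eventually simp: less_imp_neq)
  moreover have "((\<lambda>t. f t (snd z)) \<longlongrightarrow> f (fst z) (snd z)) (at_left (fst z))"
    using c[of "snd z"] z by (auto simp: continuous_within space_pair_measure)
  ultimately show "(\<lambda>i. (\<lambda>z. f (?d i (fst z)) (snd z)) z) \<longlonglongrightarrow> (\<lambda>(t, x). f t x) z"
    using filterlim_compose by (fastforce simp: case_prod_beta)
next
  fix i :: nat
  show "(\<lambda>z :: real \<times> 'a. f (real_of_int (\<lceil>2^i * fst z\<rceil> - 1) / 2^i) (snd z)) \<in> borel_measurable (borel \<Otimes>\<^sub>M N)"
    by (rule measurable_compose_countable[where f="\<lambda>k z. f (real_of_int (k - 1) / 2^i) (snd z)"
          and g="\<lambda>z. \<lceil>2^i * fst z\<rceil>"]) measurable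
qed

lemma measurable_rlim:
  assumes [measurable]: "\<And>t. f t \<in> borel_measurable N" and c: "\<And>x. x \<in> space N \<Longrightarrow> cpath p (\<lambda>t. f t x)"
  shows "(\<lambda>x. rlim (\<lambda>t. f t x) t) \<in> borel_measurable N"
proof (rule borel_measurable_LIMSEQ_real)
  fix x assume "x \<in> space N"
  have "filterlim (\<lambda>i. t + 1 / Suc i) (at_right t) sequentially"
    unfolding filterlim_at using tendsto_add[OF tendsto_const[of t] LIMSEQ_Suc[OF lim_1_over_n]]
    by (auto intro!: always_eventually)
  from filterlim_compose[OF tendsto_rlim[OF c[OF \<open>x \<in> space N\<close>]] this]
  show "(\<lambda>i. f (t + 1 / Suc i) x) \<longlonglongrightarrow> rlim (\<lambda>t. f t x) t" .
qed measurable

text \<open>Measurability needs to be checked only on half-lines, where the mass is a right limit of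
  measurable functions. The bound \<open>p \<le> 1\<close> places the measures in the
  sub-probability algebra, whose integrals depend measurably on the parameter.\<close>

lemma stieltjes_kernel:
  assumes [measurable]: "\<And>t. f t \<in> borel_measurable N" and c: "\<And>x. x \<in> space N \<Longrightarrow> cpath p (\<lambda>t. f t x)"
    and p: "p \<le> 1"
  shows "(\<lambda>x. stieltjes_measure (\<lambda>t. f t x)) \<in> measurable N (subprob_algebra borel)"
proof (rule measurable_subprob_algebra_generated[where G="range (\<lambda>b. {..b::real})" and \<Omega>=UNIV])
  show "sets borel = sigma_sets UNIV (range (\<lambda>b. {..b::real}))"
    by (subst borel_eq_atMost) simp
  show "Int_stable (range (\<lambda>b. {..b::real}))"
    unfolding Int_stable_def by (force simp only: Int_atMost image_iff)
  have e: "(\<lambda>x. emeasure (stieltjes_measure (\<lambda>t. f t x)) {..b}) \<in> borel_measurable N" for b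
    by (subst measurable_cong[OF emeasure_stieltjes_atMost[OF c]])
       (auto intro!: measurable_compose[OF _ measurable_ennreal] measurable_rlim[of f] c)
  then show "(\<lambda>x. emeasure (stieltjes_measure (\<lambda>t. f t x)) A) \<in> borel_measurable N"
    if "A \<in> range (\<lambda>b. {..b})" for A using that by auto
  show "(\<lambda>x. emeasure (stieltjes_measure (\<lambda>t. f t x)) UNIV) \<in> borel_measurable N"
  proof (rule borel_measurable_LIMSEQ_order)
    show "(\<lambda>x. emeasure (stieltjes_measure (\<lambda>t. f t x)) {..real n}) \<in> borel_measurable N" for n by (rule e)
    show "(\<lambda>n. emeasure (stieltjes_measure (\<lambda>t. f t x)) {..real n}) \<longlonglongrightarrow> emeasure (stieltjes_measure (\<lambda>t. f t x)) UNIV" for x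
    proof -
      have "(\<Union>n. {..real n}) = UNIV" using real_arch_simple by auto
      then show ?thesis
        using Lim_emeasure_incseq[of "\<lambda>n. {..real n}" "stieltjes_measure (\<lambda>t. f t x)"]
        by (simp add: incseq_def subset_eq)
    qed
  qed
qed (use c p in \<open>auto intro!: subprob_stieltjes\<close>)

text \<open>Both the measure and the integrand depend on \<open>x\<close>. Pushing the kernel
  forward along \<open>y \<mapsto> (x, y)\<close> puts the second dependence into the measure as
  well, leaving one fixed integrand on the product space.\<close>

lemma measurable_stieltjes_integral:
  assumes "\<And>t. f t \<in> borel_measurable N" "\<And>x. x \<in> space N \<Longrightarrow> cpath p (\<lambda>t. f t x)" "p \<le> 1"
    and h [measurable]: "(\<lambda>(t, x). h t x) \<in> borel_measurable (borel \<Otimes>\<^sub>M N)"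
  shows "(\<lambda>x. LINT t|stieltjes_measure (\<lambda>t. f t x). h t x :: real) \<in> borel_measurable N"
proof -
  note stieltjes_kernel[OF assms(1-3), measurable]
  note measurable_distr2[measurable]
  have "(\<lambda>x. integral\<^sup>L (distr (stieltjes_measure (\<lambda>t. f t x)) (N \<Otimes>\<^sub>M borel) (\<lambda>y. (x, y))) (\<lambda>(x, t). h t x)) \<in> borel_measurable N"
    by measurable
  then show ?thesis
    by (rule measurable_cong[THEN iffD1, rotated]) (subst integral_distr; simp)
qed

section \<open>Path space and the Ornstein-Uhlenbeck functional\<close>

text \<open>Paths are extended by 0 to negative times, so that continuity is two-sided everywhere.\<close>
definition pathC :: "(real \<Rightarrow> real) set" where
  "pathC = {b. continuous_on UNIV b \<and> (\<forall>t\<le>0. b t = 0)}"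

text \<open>\<open>paths {..u}\<close> is the canonical past up to \<open>u\<close>. No null sets
  are added: its events are to depend on the path up to \<open>u\<close> for every single path, see
  \<open>paths_set_agree\<close>.\<close>

definition paths :: "real set \<Rightarrow> (real \<Rightarrow> real) measure" where
  "paths T = sigma pathC {(\<lambda>b. b q) -` A \<inter> pathC | q A. q \<in> T \<and> A \<in> sets borel}"

abbreviation "PP \<equiv> paths UNIV"

lemma paths_gen: "{(\<lambda>b. b q) -` A \<inter> pathC | q A. q \<in> T \<and> A \<in> sets borel} \<subseteq> Pow pathC"
  by auto

lemma space_paths [simp]: "space (paths T) = pathC"
  unfolding paths_def by (rule space_measure_of[OF paths_gen])

lemma sets_paths: "sets (paths T) = sigma_sets pathC {(\<lambda>b. b q) -` A \<inter> pathC | q A. q \<in> T \<and> A \<in> sets borel}"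
  unfolding paths_def by (rule sets_measure_of[OF paths_gen])

lemma measurable_path_eval: "q \<in> T \<Longrightarrow> (\<lambda>b. b q) \<in> borel_measurable (paths T)"
  by (rule measurableI) (auto simp: sets_paths)

lemma measurable_pathsI:
  assumes "\<And>x. x \<in> space N \<Longrightarrow> f x \<in> pathC" "\<And>q. q \<in> T \<Longrightarrow> (\<lambda>x. f x q) \<in> borel_measurable N"
  shows "f \<in> N \<rightarrow>\<^sub>M paths T"
  unfolding paths_def
proof (rule measurable_measure_of[OF paths_gen])
  fix Y assume "Y \<in> {(\<lambda>b. b q) -` A \<inter> pathC | q A. q \<in> T \<and> A \<in> sets borel}"
  then obtain q A where "Y = (\<lambda>b. b q) -` A \<inter> pathC" "q \<in> T" "A \<in> sets borel" by auto
  moreover from this have "f -` Y \<inter> space N = (\<lambda>x. f x q) -` A \<inter> space N" using assms(1) by auto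
  ultimately show "f -` Y \<inter> space N \<in> sets N" using assms(2)[of q] by (auto intro: measurable_sets)
qed (use assms in auto)

lemma sets_paths_mono: "S \<subseteq> T \<Longrightarrow> sets (paths S) \<subseteq> sets (paths T)"
  unfolding sets_paths by (intro sigma_sets_mono') auto

lemma measurable_paths_mono: "S \<subseteq> T \<Longrightarrow> f \<in> paths S \<rightarrow>\<^sub>M N \<Longrightarrow> f \<in> paths T \<rightarrow>\<^sub>M N"
  using sets_paths_mono[of S T] by (auto simp: measurable_def)

text \<open>Coordinate events in \<open>T\<close> cannot separate paths that agree on
  \<open>T\<close>, and complements and countable unions inherit this. It is adaptedness in
  pointwise form: whatever is known at \<open>s\<close> has the same value on \<open>a\<close> and
  on every continuation of \<open>a\<close>.\<close>

lemma paths_set_agree: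
  assumes "H \<in> sets (paths T)" "b \<in> pathC" "b' \<in> pathC" "\<And>q. q \<in> T \<Longrightarrow> b q = b' q"
  shows "b \<in> H \<longleftrightarrow> b' \<in> H"
proof -
  from assms(1) have "H \<in> sigma_sets pathC {(\<lambda>b. b q) -` A \<inter> pathC | q A. q \<in> T \<and> A \<in> sets borel}"
    by (simp add: sets_paths)
  then show ?thesis by induction (use assms in auto)
qed

lemma paths_fun_agree:
  fixes h :: "(real \<Rightarrow> real) \<Rightarrow> real"
  assumes "h \<in> borel_measurable (paths T)" "b \<in> pathC" "b' \<in> pathC" "\<And>q. q \<in> T \<Longrightarrow> b q = b' q"
  shows "h b = h b'"
proof -
  have "h -` {h b} \<inter> space (paths T) \<in> sets (paths T)" by (rule measurable_sets[OF assms(1)]) auto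
  from paths_set_agree[OF this assms(2-4)] show ?thesis using assms by auto
qed

lemma pathC_cont: "b \<in> pathC \<Longrightarrow> isCont b t"
  by (auto simp: pathC_def continuous_on_eq_continuous_at)

lemma pathC_compose: "b \<in> pathC \<Longrightarrow> continuous_on S f \<Longrightarrow> continuous_on S (\<lambda>t. b (f t))"
  unfolding pathC_def by (auto intro: continuous_on_compose2[of UNIV b])

lemma pathC_continuous_on: "b \<in> pathC \<Longrightarrow> continuous_on S b"
  by (auto simp: pathC_def intro: continuous_on_subset)

lemma pathC_neg: "b \<in> pathC \<Longrightarrow> t \<le> 0 \<Longrightarrow> b t = 0"
  by (auto simp: pathC_def)

lemma zero_pathC [simp]: "(\<lambda>_. 0) \<in> pathC"
  by (auto simp: pathC_def)

section \<open>Splicing of paths and admissible functionals\<close>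

definition conc :: "real \<Rightarrow> (real \<Rightarrow> real) \<Rightarrow> (real \<Rightarrow> real) \<Rightarrow> real \<Rightarrow> real" where
  "conc s a b t = (if t \<le> s then a t else a s + b (t - s))"

definition shift :: "real \<Rightarrow> (real \<Rightarrow> real) \<Rightarrow> real \<Rightarrow> real" where
  "shift s b u = (if u \<le> 0 then 0 else b (s + u) - b s)"

lemma conc_pathC:
  assumes "a \<in> pathC" "b \<in> pathC" "0 \<le> s" shows "conc s a b \<in> pathC"
proof -
  have "conc s a b = (\<lambda>t. a (min t s) + b (t - s))"
    using pathC_neg[OF assms(2)] by (auto simp: conc_def fun_eq_iff min_def)
  moreover have "continuous_on UNIV (\<lambda>t. a (min t s) + b (t - s))"
    by (intro continuous_on_add pathC_compose[OF assms(1)] pathC_compose[OF assms(2)]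
        continuous_on_min continuous_on_diff continuous_on_id continuous_on_const)
  ultimately show ?thesis using assms by (auto simp: pathC_def)
qed

lemma shift_pathC:
  assumes "b \<in> pathC" shows "shift s b \<in> pathC"
proof -
  have "shift s b = (\<lambda>u. b (s + max u 0) - b s)"
    by (auto simp: shift_def fun_eq_iff max_def)
  moreover have "continuous_on UNIV (\<lambda>u. b (s + max u 0) - b s)"
    by (intro continuous_on_diff pathC_compose[OF assms(1)]
        continuous_on_max continuous_on_add continuous_on_id continuous_on_const)
  ultimately show ?thesis by (auto simp: pathC_def)
qed

lemma shift_conc: "b \<in> pathC \<Longrightarrow> shift s (conc s a b) = b"
  using pathC_neg[of b] by (auto simp: shift_def conc_def fun_eq_iff)

lemma measurable_conc:
  assumes "0 \<le> s" shows "(\<lambda>(a, b). conc s a b) \<in> PP \<Otimes>\<^sub>M PP \<rightarrow>\<^sub>M PP"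
proof (rule measurable_pathsI)
  fix q
  have [measurable]: "(\<lambda>x. fst x t) \<in> borel_measurable (PP \<Otimes>\<^sub>M PP)" "(\<lambda>x. snd x t) \<in> borel_measurable (PP \<Otimes>\<^sub>M PP)" for t
    by (rule measurable_compose[OF measurable_fst measurable_path_eval[OF UNIV_I]]
        measurable_compose[OF measurable_snd measurable_path_eval[OF UNIV_I]])+
  have "(\<lambda>x. if q \<le> s then fst x q else fst x s + snd x (q - s)) \<in> borel_measurable (PP \<Otimes>\<^sub>M PP)"
    by (cases "q \<le> s") (simp_all only: if_True if_False, measurable)
  then show "(\<lambda>x. (case x of (a, b) \<Rightarrow> conc s a b) q) \<in> borel_measurable (PP \<Otimes>\<^sub>M PP)"
    by (simp add: conc_def case_prod_beta)
qed (use assms in \<open>auto simp: space_pair_measure intro: conc_pathC\<close>)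

lemma measurable_conc_adapted:
  assumes "a \<in> pathC" "0 \<le> s" shows "conc s a \<in> paths {..u} \<rightarrow>\<^sub>M paths {..s+u}"
proof (rule measurable_pathsI)
  fix q assume q: "q \<in> {..s+u}"
  have "(\<lambda>b. a s + b (q - s)) \<in> borel_measurable (paths {..u})"
    using q by (intro borel_measurable_add measurable_path_eval) auto
  then show "(\<lambda>b. conc s a b q) \<in> borel_measurable (paths {..u})"
    unfolding conc_def by (cases "q \<le> s") (simp_all only: if_True if_False borel_measurable_const)
qed (use assms in \<open>auto intro: conc_pathC\<close>)

lemma measurable_shift_adapted:
  assumes "0 \<le> u" shows "shift s \<in> paths {..s+u} \<rightarrow>\<^sub>M paths {..u}"
proof (rule measurable_pathsI)
  fix q assume q: "q \<in> {..u}"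
  have "(\<lambda>b. b (s + q) - b s) \<in> borel_measurable (paths {..s+u})"
    using q assms by (intro borel_measurable_diff measurable_path_eval) auto
  then show "(\<lambda>b. shift s b q) \<in> borel_measurable (paths {..s+u})"
    unfolding shift_def by (cases "q \<le> 0") (simp_all only: if_True if_False borel_measurable_const)
qed (auto intro: shift_pathC)

text \<open>A control on path space, without exceptional paths: it has to remain meaningful when the
  past is frozen to one particular path, which is a null event in general.\<close>

definition adm :: "real \<Rightarrow> (real \<Rightarrow> (real \<Rightarrow> real) \<Rightarrow> real) \<Rightarrow> bool" where
  "adm p K \<longleftrightarrow> (\<forall>u. K u \<in> borel_measurable (paths {..u})) \<and> (\<forall>b\<in>pathC. cpath p (\<lambda>u. K u b))"

lemma adm_adapted: "adm p K \<Longrightarrow> K u \<in> borel_measurable (paths {..u})"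
  unfolding adm_def by blast

lemma adm_cpath: "adm p K \<Longrightarrow> b \<in> pathC \<Longrightarrow> cpath p (\<lambda>u. K u b)"
  unfolding adm_def by blast

lemma adm_measurable: "adm p K \<Longrightarrow> K u \<in> borel_measurable PP"
  by (rule measurable_paths_mono[OF subset_UNIV adm_adapted])

text \<open>Seen from time \<open>s\<close>, with the past \<open>a\<close> frozen, a control that
  has not acted yet is a control with entry time zero. It starts at 0 for every continuation since
  its value at \<open>s\<close> is decided by \<open>a\<close>.\<close>

lemma adm_conc:
  assumes K: "adm p K" and a: "a \<in> pathC" and s: "0 \<le> s" "K s a = 0"
  shows "adm p (\<lambda>u b. K (s + u) (conc s a b))"
  unfolding adm_def
proof (intro conjI allI ballI)
  show "(\<lambda>b. K (s + u) (conc s a b)) \<in> borel_measurable (paths {..u})" for u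
  proof (rule measurable_compose[OF measurable_conc_adapted[OF a s(1)]])
    show "K (s + u) \<in> borel_measurable (paths {..s + u})" using K by (rule adm_adapted)
  qed
  fix b assume b: "b \<in> pathC"
  have c: "conc s a b \<in> pathC" using conc_pathC[OF a b s(1)] .
  have "K s (conc s a b) = K s a"
  proof (rule paths_fun_agree[OF _ c a])
    show "K s \<in> borel_measurable (paths {..s})" using K by (rule adm_adapted)
  qed (simp add: conc_def)
  then have "K s (conc s a b) = 0" using s(2) by simp
  moreover have "cpath p (\<lambda>u. K u (conc s a b))" using K c by (rule adm_cpath)
  ultimately show "cpath p (\<lambda>u. K (s + u) (conc s a b))" by (intro cpath_shift[of p "\<lambda>u. K u (conc s a b)" s])
qed

text \<open>Variation of constants, with the stochastic integral of \<sigma> exp(-\<theta>(t-s))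
  removed by integration by parts. The result makes sense for each continuous path
  separately.\<close>

definition ou :: "real \<Rightarrow> real \<Rightarrow> real \<Rightarrow> real \<Rightarrow> (real \<Rightarrow> real) \<Rightarrow> real \<Rightarrow> real" where
  "ou \<theta> \<mu> \<sigma> x b t = exp (- \<theta> * t) * x + \<mu> * (1 - exp (- \<theta> * t)) + \<sigma> * b t
     - \<sigma> * \<theta> * exp (- \<theta> * t) * (LBINT s:{0..t}. exp (\<theta> * s) * b s)"

lemma set_lborel_integral_continuous:
  fixes f :: "real \<Rightarrow> real"
  assumes "continuous_on {a..b} f"
  shows "(LBINT s:{a..b}. f s) = integral {a..b} f"
  by (intro set_borel_integral_eq_integral borel_integrable_atLeastAtMost' assms)

lemma isCont_path_integral:
  assumes b: "b \<in> pathC"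
  shows "isCont (\<lambda>t. LBINT s:{0..t}. exp (\<theta> * s) * b s) t"
proof -
  \<comment> \<open>Since \<open>b\<close> vanishes before 0, the lower limit 0 can be replaced by
    any negative number; the choice makes \<open>t\<close> an interior point of the interval, also
    when \<open>t \<le> 0\<close>.\<close>
  define N where "N = \<bar>t\<bar> + 1"
  have eq: "(LBINT s:{0..u}. exp (\<theta> * s) * b s) = integral {- N..u} (\<lambda>s. exp (\<theta> * s) * b s)" for u
  proof -
    have "(LBINT s:{0..u}. exp (\<theta> * s) * b s) = (LBINT s:{-N..u}. exp (\<theta> * s) * b s)"
      unfolding set_lebesgue_integral_def
      by (intro Bochner_Integration.integral_cong) (auto simp: indicator_def N_def pathC_neg[OF b])
    also have "\<dots> = integral {- N..u} (\<lambda>s. exp (\<theta> * s) * b s)"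
      by (intro set_lborel_integral_continuous continuous_intros pathC_continuous_on[OF b])
    finally show ?thesis .
  qed
  have "continuous_on {- N..N} (\<lambda>s. exp (\<theta> * s) * b s)"
    by (intro continuous_intros pathC_continuous_on[OF b])
  then have "continuous_on {- N..N} (\<lambda>u. integral {- N..u} (\<lambda>s. exp (\<theta> * s) * b s))"
    by (intro indefinite_integral_continuous_1 integrable_continuous_interval)
  then have "isCont (\<lambda>u. integral {- N..u} (\<lambda>s. exp (\<theta> * s) * b s)) t"
    by (rule continuous_on_interior) (auto simp: N_def)
  then show ?thesis unfolding eq .
qed

lemma isCont_ou: "b \<in> pathC \<Longrightarrow> isCont (ou \<theta> \<mu> \<sigma> x b) t"
  unfolding ou_def[abs_def]
  by (intro continuous_intros isCont_path_integral pathC_cont)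

lemma measurable_ou_adapted: "(\<lambda>b. ou \<theta> \<mu> \<sigma> x b t) \<in> borel_measurable (paths {..t})"
proof -
  \<comment> \<open>Stopping the path at \<open>t\<close> makes the integrand measurable for the
    past at every \<open>s\<close>, without changing it on the range of integration.\<close>
  define ev :: "real \<Rightarrow> (real \<Rightarrow> real) \<Rightarrow> real" where "ev s b = b (min s t)" for s b
  have [measurable]: "(\<lambda>(s, b). ev s b) \<in> borel_measurable (borel \<Otimes>\<^sub>M paths {..t})"
    unfolding ev_def
  proof (rule measurable_left_cont[where f="\<lambda>s b. b (min s t)"])
    fix b s assume "b \<in> space (paths {..t})"
    then have b: "b \<in> pathC" by simp
    have "isCont (\<lambda>s. b (min s t)) s"
      by (rule isCont_o2[where f="\<lambda>s. min s t" and g=b, OF _ pathC_cont[OF b]]) (intro continuous_intros)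
    then show "continuous (at_left s) (\<lambda>s. b (min s t))" by (rule continuous_at_imp_continuous_within)
  qed (rule measurable_path_eval, simp)
  have [measurable]: "(\<lambda>b. b t) \<in> borel_measurable (paths {..t})" by (rule measurable_path_eval) simp
  have "(\<lambda>b. exp (- \<theta> * t) * x + \<mu> * (1 - exp (- \<theta> * t)) + \<sigma> * b t
     - \<sigma> * \<theta> * exp (- \<theta> * t) * (LINT s|lborel. indicator {0..t} s * (exp (\<theta> * s) * ev s b))) \<in> borel_measurable (paths {..t})"
    by measurable
  also have "(\<lambda>b. exp (- \<theta> * t) * x + \<mu> * (1 - exp (- \<theta> * t)) + \<sigma> * b t
     - \<sigma> * \<theta> * exp (- \<theta> * t) * (LINT s|lborel. indicator {0..t} s * (exp (\<theta> * s) * ev s b))) = (\<lambda>b. ou \<theta> \<mu> \<sigma> x b t)"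
    unfolding ou_def set_lebesgue_integral_def
    by (intro ext arg_cong2[where f="(-)"] arg_cong2[where f="(*)"] refl Bochner_Integration.integral_cong)
       (auto simp: indicator_def min_def ev_def)
  finally show ?thesis .
qed

text \<open>The source of every Lipschitz bound in the initial value: the slope is deterministic and
  at most 1 for nonnegative times when \<theta> is positive.\<close>

lemma ou_affine: "ou \<theta> \<mu> \<sigma> x b t = ou \<theta> \<mu> \<sigma> 0 b t + exp (- \<theta> * t) * x"
  by (simp add: ou_def)

lemma measurable_ou_joint [measurable]:
  "(\<lambda>(t, b). ou \<theta> \<mu> \<sigma> x b t) \<in> borel_measurable (borel \<Otimes>\<^sub>M PP)"
proof (rule measurable_left_cont[where f="\<lambda>t b. ou \<theta> \<mu> \<sigma> x b t"])
  show "(\<lambda>b. ou \<theta> \<mu> \<sigma> x b t) \<in> borel_measurable PP" for t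
    by (rule measurable_paths_mono[OF subset_UNIV measurable_ou_adapted])
  show "continuous (at_left t) (ou \<theta> \<mu> \<sigma> x b)" if "b \<in> space PP" for t b
    by (rule continuous_at_imp_continuous_within, rule isCont_ou) (use that in simp)
qed

lemma ou_conc_le:
  assumes "a \<in> pathC" "t \<le> s"
  shows "ou \<theta> \<mu> \<sigma> x (conc s a b) t = ou \<theta> \<mu> \<sigma> x a t"
proof -
  have "(LBINT r:{0..t}. exp (\<theta> * r) * conc s a b r) = (LBINT r:{0..t}. exp (\<theta> * r) * a r)"
    using assms by (intro set_lebesgue_integral_cong) (auto simp: conc_def)
  then show ?thesis using assms by (simp add: ou_def conc_def)
qed

text \<open>The flow property. The level \<open>a s\<close> added by \<open>conc\<close> also enters
  the integral over the second piece, and what is left after cancellation is \<sigma>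
  \<open>a s\<close> times exp(-\<theta>u), which is its share in the restarted initial
  value.\<close>

lemma ou_conc_ge:
  assumes a: "a \<in> pathC" and b: "b \<in> pathC" and s: "0 \<le> s" "0 \<le> u" and th: "\<theta> \<noteq> 0"
  shows "ou \<theta> \<mu> \<sigma> x (conc s a b) (s + u) = ou \<theta> \<mu> \<sigma> (ou \<theta> \<mu> \<sigma> x a s) b u"
proof -
  let ?f = "\<lambda>r. exp (\<theta> * r) * conc s a b r"
  have c: "continuous_on S ?f" for S
    by (intro continuous_intros pathC_continuous_on conc_pathC[OF a b s(1)])
  have cb: "continuous_on S b" "continuous_on S a" for S using a b by (auto intro: pathC_continuous_on)
  have "(LBINT r:{0..s+u}. ?f r) = integral {0..s+u} ?f" by (intro set_lborel_integral_continuous c)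
  also have "\<dots> = integral {0..s} ?f + integral {s..s+u} ?f"
    using s by (intro Henstock_Kurzweil_Integration.integral_combine[symmetric] integrable_continuous_interval c) auto
  also have "integral {0..s} ?f = integral {0..s} (\<lambda>r. exp (\<theta> * r) * a r)"
    by (intro Henstock_Kurzweil_Integration.integral_cong) (auto simp: conc_def)
  also have "\<dots> = (LBINT r:{0..s}. exp (\<theta> * r) * a r)"
    by (intro set_lborel_integral_continuous[symmetric] continuous_intros cb)
  also have "integral {s..s+u} ?f = integral {0..u} (\<lambda>r. exp (\<theta> * s) * a s * exp (\<theta> * r) + exp (\<theta> * s) * (exp (\<theta> * r) * b r))"
  proof -
    have "integral {s..s+u} ?f = integral {0..u} (\<lambda>r. ?f (r + s))"
      using integral_shift_real_ivl[of s s "s + u" ?f] by simp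
    also have "\<dots> = integral {0..u} (\<lambda>r. exp (\<theta> * s) * a s * exp (\<theta> * r) + exp (\<theta> * s) * (exp (\<theta> * r) * b r))"
      by (intro Henstock_Kurzweil_Integration.integral_cong)
         (auto simp: conc_def pathC_neg[OF b] algebra_simps exp_add[symmetric])
    finally show ?thesis .
  qed
  also have "\<dots> = exp (\<theta> * s) * a s * integral {0..u} (\<lambda>r. exp (\<theta> * r)) + exp (\<theta> * s) * integral {0..u} (\<lambda>r. exp (\<theta> * r) * b r)"
    by (subst integral_add) (auto intro!: integrable_continuous_interval continuous_intros cb)
  also have "integral {0..u} (\<lambda>r. exp (\<theta> * r) * b r) = (LBINT r:{0..u}. exp (\<theta> * r) * b r)"
    by (intro set_lborel_integral_continuous[symmetric] continuous_intros cb)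
  also have "integral {0..u} (\<lambda>r. exp (\<theta> * r)) = (exp (\<theta> * u) - 1) / \<theta>"
  proof -
    have "((\<lambda>r. exp (\<theta> * r)) has_integral (exp (\<theta> * u) / \<theta> - exp (\<theta> * 0) / \<theta>)) {0..u}"
      using th s by (intro fundamental_theorem_of_calculus)
        (auto intro!: derivative_eq_intros simp flip: has_real_derivative_iff_has_vector_derivative)
    then show ?thesis by (simp add: integral_unique diff_divide_distrib)
  qed
  finally have e: "(LBINT r:{0..s+u}. ?f r) = (LBINT r:{0..s}. exp (\<theta> * r) * a r) +
     (exp (\<theta> * s) * a s * ((exp (\<theta> * u) - 1) / \<theta>) + exp (\<theta> * s) * (LBINT r:{0..u}. exp (\<theta> * r) * b r))" .
  have ca: "conc s a b (s + u) = a s + b u" using s pathC_neg[OF b, of 0] by (cases "u = 0") (auto simp: conc_def)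
  have E: "exp (\<theta> * (s + u)) = exp (\<theta> * s) * exp (\<theta> * u)" by (simp add: algebra_simps exp_add)
  define p q where "p = exp (\<theta> * s)" and "q = exp (\<theta> * u)"
  have "p \<noteq> 0" "q \<noteq> 0" by (auto simp: p_def q_def)
  show ?thesis
    unfolding ou_def e ca mult_minus_left exp_minus E
    unfolding p_def[symmetric] q_def[symmetric]
    using th \<open>p \<noteq> 0\<close> \<open>q \<noteq> 0\<close> by (simp add: field_simps)
qed

lemma ou_unique:
  assumes b: "b \<in> pathC" and y: "continuous_on {0..} y"
    and eq: "\<And>t. t \<ge> 0 \<Longrightarrow> y t = x + (LBINT s:{0..t}. \<theta> * (\<mu> - y s)) + \<sigma> * b t"
    and t: "0 \<le> t"
  shows "y t = ou \<theta> \<mu> \<sigma> x b t"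
proof -
  have cy: "continuous_on {0..t} y" using y by (rule continuous_on_subset) auto
  have cb: "continuous_on {0..t} b" using b by (rule pathC_continuous_on)
  \<comment> \<open>Subtracting the noise leaves the differentiable part of \<open>y\<close>, so the
    integral equation becomes an ordinary differential equation.\<close>
  define w where "w s = y s - \<sigma> * b s" for s
  define I where "I s = integral {0..s} (\<lambda>r. exp (\<theta> * r) * b r)" for s
  have w: "w s = x + integral {0..s} (\<lambda>r. \<theta> * (\<mu> - y r))" if "s \<in> {0..t}" for s
    using eq[of s] that unfolding w_def
    by (subst set_lborel_integral_continuous[symmetric]) (auto intro!: continuous_intros continuous_on_subset[OF cy])
  have dw: "(w has_real_derivative \<theta> * (\<mu> - y s)) (at s within {0..t})" if "s \<in> {0..t}" for s
  proof -
    have "((\<lambda>s. x + integral {0..s} (\<lambda>r. \<theta> * (\<mu> - y r))) has_real_derivative 0 + \<theta> * (\<mu> - y s)) (at s within {0..t})"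
      by (intro DERIV_add DERIV_const integral_has_real_derivative[OF _ that] continuous_intros cy)
    then show ?thesis using that w
      by (subst has_field_derivative_cong_eventually[where g="\<lambda>s. x + integral {0..s} (\<lambda>r. \<theta> * (\<mu> - y r))"])
         (auto simp: eventually_at_filter)
  qed
  have dI: "(I has_real_derivative exp (\<theta> * s) * b s) (at s within {0..t})" if "s \<in> {0..t}" for s
    unfolding I_def[abs_def] by (intro integral_has_real_derivative[OF _ that] continuous_intros cb)
  \<comment> \<open>The integrating factor exp(\<theta>s) turns the equation into a conserved
    quantity; the term with \<open>I\<close> compensates the noise contained in
    \<open>y\<close>.\<close>
  define F where "F s = exp (\<theta> * s) * (w s - \<mu>) + \<theta> * \<sigma> * I s" for s
  have "(F has_real_derivative 0) (at s within {0..t})" if "s \<in> {0..t}" for s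
    unfolding F_def[abs_def]
    by (rule derivative_eq_intros dw[OF that] dI[OF that] refl)+ (simp add: w_def algebra_simps)
  then have "F t = F 0"
    using t has_field_derivative_zero_constant[of "{0..t}" F] by (metis atLeastAtMost_iff convex_real_interval(5) order_refl)
  moreover have "w 0 = x" using w[of 0] t by simp
  ultimately have "exp (\<theta> * t) * (w t - \<mu>) + \<theta> * \<sigma> * I t = x - \<mu>" by (simp add: F_def I_def)
  moreover have "I t = (LBINT s:{0..t}. exp (\<theta> * s) * b s)"
    unfolding I_def by (intro set_lborel_integral_continuous[symmetric] continuous_intros cb)
  ultimately have *: "exp (\<theta> * t) * (w t - \<mu>) + \<theta> * \<sigma> * (LBINT s:{0..t}. exp (\<theta> * s) * b s) = x - \<mu>" by simp
  define p where "p = exp (\<theta> * t)"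
  have "p \<noteq> 0" by (auto simp: p_def)
  define L where "L = (LBINT s:{0..t}. exp (\<theta> * s) * b s)"
  from *[folded p_def L_def] have "(w t - \<mu>) * p = x - \<mu> - \<theta> * \<sigma> * L" by (simp add: mult.commute)
  then have "w t - \<mu> = (x - \<mu> - \<theta> * \<sigma> * L) / p"
    using \<open>p \<noteq> 0\<close> by (simp add: nonzero_eq_divide_eq)
  then have "y t = \<mu> + (x - \<mu> - \<theta> * \<sigma> * L) / p + \<sigma> * b t"
    by (simp add: w_def)
  then show ?thesis
    unfolding ou_def mult_minus_left exp_minus
    unfolding p_def[symmetric] L_def[symmetric] by (simp add: divide_inverse algebra_simps)
qed

text \<open>The kernel \<theta> exp(-\<theta>(t-s)) has mass at most 1 on [0,t], so the integral
  term obeys the same bound as \<sigma> \<open>b t\<close>. This is where the factor 2 comes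
  from.\<close>

lemma ou_bound:
  assumes b: "b \<in> pathC" and bd: "\<And>t. t \<ge> 0 \<Longrightarrow> \<bar>b t\<bar> \<le> R * exp (r * t)" and "0 \<le> R" "0 \<le> r"
    and th: "\<theta> > 0" "\<mu> > 0" "\<sigma> > 0" and t: "0 \<le> t"
  shows "\<bar>ou \<theta> \<mu> \<sigma> x b t\<bar> \<le> (\<bar>x\<bar> + \<mu> + 2 * \<sigma> * R) * exp (r * t)"
proof -
  define E where "E = exp (r * t)"
  have E1: "1 \<le> E" using assms by (simp add: E_def)
  have cb: "continuous_on {0..t} b" using b by (rule pathC_continuous_on)
  let ?I = "integral {0..t} (\<lambda>s. exp (\<theta> * s) * b s)"
  have "\<bar>?I\<bar> \<le> integral {0..t} (\<lambda>s. R * E * exp (\<theta> * s))"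
    unfolding real_norm_def[symmetric]
  proof (rule integral_norm_bound_integral)
    fix s assume s: "s \<in> {0..t}"
    have "\<bar>b s\<bar> \<le> R * E"
      by (rule order_trans[OF bd]) (use s assms in \<open>auto simp: E_def intro!: mult_left_mono\<close>)
    then show "norm (exp (\<theta> * s) * b s) \<le> R * E * exp (\<theta> * s)"
      by (simp add: abs_mult mult.commute)
  qed (auto intro!: integrable_continuous_interval continuous_intros cb)
  also have "((\<lambda>s. R * E * exp (\<theta> * s)) has_integral (R * E * exp (\<theta> * t) / \<theta> - R * E * exp (\<theta> * 0) / \<theta>)) {0..t}"
    using th t by (intro fundamental_theorem_of_calculus)
      (auto intro!: derivative_eq_intros simp flip: has_real_derivative_iff_has_vector_derivative)
  from integral_unique[OF this] have "integral {0..t} (\<lambda>s. R * E * exp (\<theta> * s)) = R * E * (exp (\<theta> * t) - 1) / \<theta>"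
    by (simp add: right_diff_distrib diff_divide_distrib)
  also have "\<dots> \<le> R * E * exp (\<theta> * t) / \<theta>"
    using assms E1 by (intro divide_right_mono mult_left_mono) auto
  finally have "exp (- \<theta> * t) * \<theta> * \<bar>?I\<bar> \<le> exp (- \<theta> * t) * \<theta> * (R * E * exp (\<theta> * t) / \<theta>)"
    using th by (intro mult_left_mono) auto
  also have "\<dots> = R * E" using th by (simp add: exp_minus field_simps)
  finally have "\<bar>\<sigma> * \<theta> * exp (- \<theta> * t) * ?I\<bar> \<le> \<sigma> * (R * E)"
    using th by (simp add: abs_mult mult.assoc mult.left_commute)
  moreover have "\<bar>exp (- \<theta> * t) * x\<bar> \<le> 1 * \<bar>x\<bar>"
    unfolding abs_mult using th t by (intro mult_right_mono) auto
  moreover have "\<bar>\<mu> * (1 - exp (- \<theta> * t))\<bar> \<le> \<mu> * 1"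
    unfolding abs_mult using th t by (intro mult_mono) auto
  moreover have "\<bar>\<sigma> * b t\<bar> \<le> \<sigma> * (R * E)"
    unfolding abs_mult using bd[OF t] th by (auto simp: E_def intro!: mult_left_mono)
  moreover have "(LBINT s:{0..t}. exp (\<theta> * s) * b s) = ?I"
    by (intro set_lborel_integral_continuous continuous_intros cb)
  moreover have "\<bar>p + q + v - w\<bar> \<le> P + Q + V + W" if "\<bar>p\<bar> \<le> P" "\<bar>q\<bar> \<le> Q" "\<bar>v\<bar> \<le> V" "\<bar>w\<bar> \<le> W" for p q v w P Q V W :: real
    using that by linarith
  note this[of "exp (- \<theta> * t) * x" _ "\<mu> * (1 - exp (- \<theta> * t))" _ "\<sigma> * b t" _ "\<sigma> * \<theta> * exp (- \<theta> * t) * ?I"]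
  ultimately have "\<bar>ou \<theta> \<mu> \<sigma> x b t\<bar> \<le> 1 * \<bar>x\<bar> + \<mu> * 1 + \<sigma> * (R * E) + \<sigma> * (R * E)"
    unfolding ou_def by (simp only:)
  also have "\<dots> = (\<bar>x\<bar> + \<mu>) * 1 + 2 * \<sigma> * R * E" by simp
  also have "\<dots> \<le> (\<bar>x\<bar> + \<mu>) * E + 2 * \<sigma> * R * E"
    using E1 th by (intro add_right_mono mult_left_mono) auto
  also have "\<dots> = (\<bar>x\<bar> + \<mu> + 2 * \<sigma> * R) * E" by (simp only: distrib_right)
  finally show ?thesis by (simp only: E_def)
qed

section \<open>The cost along a path\<close>

definition pcost ::
  "real \<Rightarrow> (real \<Rightarrow> real) \<Rightarrow> real \<Rightarrow> real \<Rightarrow> (real \<Rightarrow> real) \<Rightarrow> (real \<Rightarrow> real) \<Rightarrow> real" where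
  "pcost lam \<Phi> c s y g =
     (LINT t:{s..}|stieltjes_measure g. exp (- lam * t) * y t)
     + (LBINT t:{s..}. exp (- lam * t) * lam * y t * \<Phi> (c + g t))"

lemma control_cost_pcost:
  "\<tau> w \<noteq> \<infinity> \<Longrightarrow> control_cost lam \<Phi> Y c \<tau> \<nu> w = pcost lam \<Phi> c (enn2real (\<tau> w)) (\<lambda>t. Y t w) (\<lambda>t. \<nu> t w)"
  by (simp add: control_cost_def pcost_def)

lemma exp_tail_integral:
  fixes r s :: real assumes "0 < r"
  shows "set_integrable lborel {s..} (\<lambda>t. exp (- r * t))" "(LBINT t:{s..}. exp (- r * t)) = exp (- r * s) / r"
proof -
  have "has_bochner_integral lborel (\<lambda>t. indicator {s..} t * exp (- r * t)) (exp (- r * s) / r)"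
  proof (rule has_bochner_integral_nn_integral)
    show "(\<integral>\<^sup>+t. ennreal (indicator {s..} t * exp (- r * t)) \<partial>lborel) = ennreal (exp (- r * s) / r)"
      using nn_integral_has_integral_lebesgue[OF _ has_integral_exp_minus_to_infinity[OF assms], of s] by simp
  qed (use assms in auto)
  then show "set_integrable lborel {s..} (\<lambda>t. exp (- r * t))" "(LBINT t:{s..}. exp (- r * t)) = exp (- r * s) / r"
    by (auto simp: set_integrable_def set_lebesgue_integral_def has_bochner_integral_iff)
qed

lemma pcost_cong:
  assumes "0 \<le> s" "\<And>t. 0 \<le> t \<Longrightarrow> y t = y' t" "\<And>t. 0 \<le> t \<Longrightarrow> g t = g' t"
  shows "pcost lam \<Phi> c s y g = pcost lam \<Phi> c s y' g'"
proof -
  have "stieltjes_measure g = stieltjes_measure g'" by (rule stieltjes_cong[OF assms(3)])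
  then show ?thesis
    unfolding pcost_def \<open>stieltjes_measure g = stieltjes_measure g'\<close> using assms
    by (intro arg_cong2[where f="(+)"] set_lebesgue_integral_cong) auto
qed

context
  fixes lam c p F :: real and \<Phi> :: "real \<Rightarrow> real"
  assumes lam: "0 < lam" and Phi [measurable]: "\<Phi> \<in> borel_measurable borel"
    and c: "0 \<le> c" "c + p \<le> 1" and Phi_bound: "\<forall>z\<in>{0..1}. \<bar>\<Phi> z\<bar> \<le> F"
begin

lemma cpath_le_1: "cpath p g \<Longrightarrow> p \<le> 1" "cpath p g \<Longrightarrow> 0 \<le> p"
  using c cpath_range[of p g 0] by auto

lemma cpath_borel: "cpath p g \<Longrightarrow> g \<in> borel_measurable borel"
  by (rule borel_measurable_mono) (simp add: cpath_def)

lemma Phi_cpath: "cpath p g \<Longrightarrow> \<bar>\<Phi> (c + g t)\<bar> \<le> F"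
  using cpath_range[of p g t] c Phi_bound by auto

lemma F_nonneg: "cpath p g \<Longrightarrow> 0 \<le> F"
  using order_trans[OF abs_ge_zero Phi_cpath] .

lemma finite_stieltjes: "cpath p g \<Longrightarrow> finite_measure (stieltjes_measure g)"
  using subprob_stieltjes cpath_le_1 by (blast intro: subprob_space.axioms)

lemma dominator_nonneg:
  assumes D: "\<And>t. 0 \<le> t \<Longrightarrow> \<bar>y t\<bar> \<le> D * exp (lam / 2 * t)" shows "0 \<le> D"
proof -
  have "0 \<le> \<bar>y 0\<bar>" by simp
  also have "\<dots> \<le> D" using D[of 0] by simp
  finally show ?thesis .
qed

text \<open>Half of the discount rate pays for the growth of the process; the other half is left for
  integration over time.\<close>

lemma exp_half_bound:
  assumes "\<bar>x\<bar> \<le> D * exp (lam / 2 * t)"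
  shows "\<bar>exp (- lam * t) * x\<bar> \<le> D * exp (- (lam / 2) * t)"
proof -
  have "\<bar>exp (- lam * t) * x\<bar> \<le> exp (- lam * t) * (D * exp (lam / 2 * t))"
    unfolding abs_mult abs_exp_cancel by (intro mult_left_mono assms) auto
  also have "\<dots> = D * (exp (- lam * t) * exp (lam / 2 * t))" by simp
  also have "exp (- lam * t) * exp (lam / 2 * t) = exp (- (lam / 2) * t)"
    by (simp add: exp_add[symmetric])
  finally show ?thesis .
qed

context
  fixes D s :: real and y g :: "real \<Rightarrow> real"
  assumes g: "cpath p g" and y [measurable]: "y \<in> borel_measurable borel"
    and D: "\<And>t. 0 \<le> t \<Longrightarrow> \<bar>y t\<bar> \<le> D * exp (lam / 2 * t)" and s: "0 \<le> s"
begin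

lemmas D_nonneg = dominator_nonneg[OF D]

lemma jump_cost_bound:
  "\<bar>indicator {s..} t *\<^sub>R (exp (- lam * t) * y t)\<bar> \<le> D * exp (- (lam / 2) * s)"
proof (cases "s \<le> t")
  case True
  have "\<bar>exp (- lam * t) * y t\<bar> \<le> D * exp (- (lam / 2) * t)"
    using D[of t] True s by (intro exp_half_bound) auto
  also have "\<dots> \<le> D * exp (- (lam / 2) * s)" using True lam D_nonneg by (intro mult_left_mono) auto
  finally show ?thesis using True by simp
qed (use D_nonneg in auto)

lemma jump_cost_integrable: "set_integrable (stieltjes_measure g) {s..} (\<lambda>t. exp (- lam * t) * y t)"
  unfolding set_integrable_def
  by (rule finite_measure.integrable_const_bound[OF finite_stieltjes[OF g], of _ "D * exp (- (lam / 2) * s)"])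
     (simp only: real_norm_def jump_cost_bound AE_I2, measurable)

lemma run_cost_bound:
  "\<bar>indicator {s..} t *\<^sub>R (exp (- lam * t) * lam * y t * \<Phi> (c + g t))\<bar> \<le> lam * D * F * (indicator {s..} t *\<^sub>R exp (- (lam / 2) * t))"
proof (cases "s \<le> t")
  case True
  have "\<bar>exp (- lam * t) * y t\<bar> \<le> D * exp (- (lam / 2) * t)"
    using D[of t] True s by (intro exp_half_bound) auto
  then have "\<bar>exp (- lam * t) * y t\<bar> * \<bar>\<Phi> (c + g t)\<bar> * lam \<le> D * exp (- (lam / 2) * t) * F * lam"
    using lam D_nonneg by (intro mult_right_mono mult_mono Phi_cpath[OF g]) auto
  then show ?thesis using True lam by (simp add: abs_mult mult_ac)
qed auto

lemma run_cost_integrable: "set_integrable lborel {s..} (\<lambda>t. exp (- lam * t) * lam * y t * \<Phi> (c + g t))"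
  unfolding set_integrable_def
proof (rule Bochner_Integration.integrable_bound)
  note cpath_borel[OF g, measurable]
  show "integrable lborel (\<lambda>t. lam * D * F * (indicator {s..} t *\<^sub>R exp (- (lam / 2) * t)))"
    using exp_tail_integral(1)[of "lam / 2" s] lam unfolding set_integrable_def by (intro integrable_mult_right) auto
  show "(\<lambda>t. indicator {s..} t *\<^sub>R (exp (- lam * t) * lam * y t * \<Phi> (c + g t))) \<in> borel_measurable lborel"
    by measurable
  show "AE t in lborel. norm (indicator {s..} t *\<^sub>R (exp (- lam * t) * lam * y t * \<Phi> (c + g t)))
      \<le> norm (lam * D * F * (indicator {s..} t *\<^sub>R exp (- (lam / 2) * t)))"
    unfolding real_norm_def by (intro AE_I2 order_trans[OF run_cost_bound abs_ge_self])
qed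

text \<open>The jump part contributes the 1, because the total mass of the control is at most 1. The
  running part contributes 2F, as the integral of \<open>lam\<close> exp(-(lam/2)t) over the tail is
  2 exp(-(lam/2)s).\<close>

lemma pcost_bound: "\<bar>pcost lam \<Phi> c s y g\<bar> \<le> D * exp (- (lam / 2) * s) * (1 + 2 * F)"
proof -
  interpret finite_measure "stieltjes_measure g" by (rule finite_stieltjes[OF g])
  have "\<bar>LINT t:{s..}|stieltjes_measure g. exp (- lam * t) * y t\<bar> \<le> (LINT t|stieltjes_measure g. D * exp (- (lam / 2) * s))"
    using integral_norm_bound[of "stieltjes_measure g" "\<lambda>t. indicator {s..} t *\<^sub>R (exp (- lam * t) * y t)"] jump_cost_integrable
    unfolding set_lebesgue_integral_def set_integrable_def real_norm_def
    by (elim order_trans) (intro integral_mono integrable_abs jump_cost_bound integrable_const)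
  also have "\<dots> = measure (stieltjes_measure g) UNIV * (D * exp (- (lam / 2) * s))" by simp
  also have "\<dots> \<le> 1 * (D * exp (- (lam / 2) * s))"
    using subprob_space.subprob_measure_le_1[OF subprob_stieltjes[OF g cpath_le_1(1)[OF g]]] D_nonneg
    by (intro mult_right_mono) auto
  finally have 1: "\<bar>LINT t:{s..}|stieltjes_measure g. exp (- lam * t) * y t\<bar> \<le> D * exp (- (lam / 2) * s)" by simp
  have I: "integrable lborel (\<lambda>t. lam * D * F * (indicator {s..} t *\<^sub>R exp (- (lam / 2) * t)))"
    using exp_tail_integral(1)[of "lam / 2" s] lam unfolding set_integrable_def by (intro integrable_mult_right) auto
  have "\<bar>LBINT t:{s..}. exp (- lam * t) * lam * y t * \<Phi> (c + g t)\<bar> \<le>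
      (LINT t|lborel. lam * D * F * (indicator {s..} t *\<^sub>R exp (- (lam / 2) * t)))"
    using integral_norm_bound[of lborel "\<lambda>t. indicator {s..} t *\<^sub>R (exp (- lam * t) * lam * y t * \<Phi> (c + g t))"] run_cost_integrable
    unfolding set_lebesgue_integral_def set_integrable_def real_norm_def
    by (elim order_trans) (intro integral_mono integrable_abs run_cost_bound I)
  also have "\<dots> = lam * D * F * (LBINT t:{s..}. exp (- (lam / 2) * t))"
    unfolding set_lebesgue_integral_def by (rule integral_mult_right_zero)
  also have "\<dots> = D * exp (- (lam / 2) * s) * (2 * F)"
    using lam by (subst exp_tail_integral) auto
  finally show ?thesis using 1 unfolding pcost_def distrib_left by linarith
qed

end

text \<open>For a fixed control the cost is linear in the process, so the dependence on the initial
  value reduces to \<open>pcost_bound\<close> for a difference of processes.\<close>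

lemma pcost_diff:
  assumes g: "cpath p g" and [measurable]: "y \<in> borel_measurable borel" "y' \<in> borel_measurable borel"
    and D: "\<And>t. 0 \<le> t \<Longrightarrow> \<bar>y t\<bar> \<le> D * exp (lam / 2 * t)" "\<And>t. 0 \<le> t \<Longrightarrow> \<bar>y' t\<bar> \<le> D' * exp (lam / 2 * t)" and s: "0 \<le> s"
  shows "pcost lam \<Phi> c s y g - pcost lam \<Phi> c s y' g = pcost lam \<Phi> c s (\<lambda>t. y t - y' t) g"
proof -
  note j = jump_cost_integrable[OF g assms(2) D(1) s] jump_cost_integrable[OF g assms(3) D(2) s]
  note r = run_cost_integrable[OF g assms(2) D(1) s] run_cost_integrable[OF g assms(3) D(2) s]
  have "(LINT t:{s..}|stieltjes_measure g. exp (- lam * t) * y t) - (LINT t:{s..}|stieltjes_measure g. exp (- lam * t) * y' t)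
    = (LINT t:{s..}|stieltjes_measure g. exp (- lam * t) * (y t - y' t))"
    by (subst set_integral_diff(2)[symmetric, OF j]) ((assumption | rule set_lebesgue_integral_cong)+, auto simp: algebra_simps)
  moreover have "(LBINT t:{s..}. exp (- lam * t) * lam * y t * \<Phi> (c + g t)) - (LBINT t:{s..}. exp (- lam * t) * lam * y' t * \<Phi> (c + g t))
    = (LBINT t:{s..}. exp (- lam * t) * lam * (y t - y' t) * \<Phi> (c + g t))"
    by (subst set_integral_diff(2)[symmetric, OF r]) ((assumption | rule set_lebesgue_integral_cong)+, auto simp: algebra_simps)
  ultimately show ?thesis unfolding pcost_def by linarith
qed

lemma pcost_measurable:
  assumes [measurable]: "(\<lambda>(t, x). y t x) \<in> borel_measurable (borel \<Otimes>\<^sub>M N)"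
    and g: "\<And>t. g t \<in> borel_measurable N" "\<And>x. x \<in> space N \<Longrightarrow> cpath p (\<lambda>t. g t x)" and p: "p \<le> 1"
    and [measurable]: "s \<in> borel_measurable N"
  shows "(\<lambda>x. pcost lam \<Phi> c (s x) (\<lambda>t. y t x) (\<lambda>t. g t x)) \<in> borel_measurable N"
proof -
  have [measurable]: "(\<lambda>(t, x). g t x) \<in> borel_measurable (borel \<Otimes>\<^sub>M N)"
    by (rule measurable_left_cont[OF g(1)]) (use g(2) in \<open>auto simp: cpath_def\<close>)
  have [measurable]: "Measurable.pred (borel \<Otimes>\<^sub>M N) (\<lambda>(t, x). t \<in> {s x..})"
    "Measurable.pred (N \<Otimes>\<^sub>M borel) (\<lambda>(x, t). t \<in> {s x..})"
    unfolding atLeast_iff by measurable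
  have "(\<lambda>x. LINT t|stieltjes_measure (\<lambda>t. g t x). indicator {s x..} t *\<^sub>R (exp (- lam * t) * y t x)) \<in> borel_measurable N"
    by (rule measurable_stieltjes_integral[OF g p]) measurable
  moreover have "(\<lambda>x. LINT t|lborel. indicator {s x..} t *\<^sub>R (exp (- lam * t) * lam * y t x * \<Phi> (c + g t x))) \<in> borel_measurable N"
    by measurable
  ultimately show ?thesis
    unfolding pcost_def set_lebesgue_integral_def by (rule borel_measurable_add)
qed

text \<open>Substitution t = s + u in both integrals. Because \<open>g s = 0\<close>, the measure of
  the shifted path is a plain translate, and a jump at \<open>s\<close> becomes a jump at 0, still
  inside the range of integration.\<close>

lemma pcost_shift:
  assumes g: "cpath p g" and gs: "g s = 0" and s: "0 \<le> s" and [measurable]: "y \<in> borel_measurable borel"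
  shows "pcost lam \<Phi> c s y g = exp (- lam * s) * pcost lam \<Phi> c 0 (\<lambda>u. y (s + u)) (\<lambda>u. g (s + u))"
proof -
  note cpath_borel[OF g, measurable]
  have e: "exp (- lam * (s + x)) = exp (- lam * s) * exp (- lam * x)" for x
    by (simp add: exp_add[symmetric] algebra_simps)
  have "(LINT t:{0..}|stieltjes_measure (\<lambda>u. g (s + u)). exp (- lam * t) * y (s + t)) =
      (LINT t|stieltjes_measure g. indicator {0..} (t - s) *\<^sub>R (exp (- lam * (t - s)) * y (s + (t - s))))"
    unfolding stieltjes_shift[OF g gs] set_lebesgue_integral_def by (subst integral_distr) auto
  also have "exp (- lam * s) * \<dots> = (LINT t:{s..}|stieltjes_measure g. exp (- lam * t) * y t)"
    unfolding set_lebesgue_integral_def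
    by (subst integral_mult_right_zero[symmetric], intro Bochner_Integration.integral_cong refl)
       (auto simp: indicator_def exp_add[symmetric] algebra_simps)
  finally have 1: "exp (- lam * s) * (LINT t:{0..}|stieltjes_measure (\<lambda>u. g (s + u)). exp (- lam * t) * y (s + t)) =
      (LINT t:{s..}|stieltjes_measure g. exp (- lam * t) * y t)" by simp
  have "(LBINT t:{s..}. exp (- lam * t) * lam * y t * \<Phi> (c + g t)) =
    (LINT t|lborel. indicator {s..} (s + t) *\<^sub>R (exp (- lam * (s + t)) * lam * y (s + t) * \<Phi> (c + g (s + t))))"
    unfolding set_lebesgue_integral_def
    by (subst lborel_integral_real_affine[where c=1 and t=s]) auto
  also have "\<dots> = exp (- lam * s) * (LBINT t:{0..}. exp (- lam * t) * lam * y (s + t) * \<Phi> (c + g (s + t)))"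
    unfolding set_lebesgue_integral_def e
    by (subst integral_mult_right_zero[symmetric], intro Bochner_Integration.integral_cong refl)
       (auto simp: indicator_def)
  finally show ?thesis using 1 unfolding pcost_def distrib_left by simp
qed

text \<open>After \<open>stieltjes_delay\<close> the jump cost is an integral of a continuous
  function of \<open>max (r n) t\<close> against a fixed finite measure. In the running cost the
  delayed control equals \<open>g\<close> as soon as \<open>r n < t\<close>.\<close>

lemma pcost_delay_tendsto:
  assumes g: "cpath p g" and gs: "g s = 0" and s: "0 \<le> s" and y: "\<And>t. isCont y t"
    and D: "\<And>t. 0 \<le> t \<Longrightarrow> \<bar>y t\<bar> \<le> D * exp (lam / 2 * t)"
    and r: "\<And>n. s \<le> r n" "r \<longlonglongrightarrow> s"
  shows "(\<lambda>n. pcost lam \<Phi> c (r n) y (delay (r n) g)) \<longlonglongrightarrow> pcost lam \<Phi> c s y g"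
  unfolding pcost_def
proof (rule tendsto_add)
  have ym [measurable]: "y \<in> borel_measurable borel"
    by (intro borel_measurable_continuous_onI continuous_at_imp_continuous_on ballI y)
  note cpath_borel[OF g, measurable]
  have r0: "0 \<le> r n" for n using r(1)[of n] s by simp
  have rl: "(\<lambda>n. max (r n) t) \<longlonglongrightarrow> max s t" for t by (intro tendsto_intros r)
  let ?f = "\<lambda>t. exp (- lam * t) * y t"
  have a: "(LINT t:{r n..}|stieltjes_measure (delay (r n) g). ?f t) = (LINT t|stieltjes_measure g. ?f (max (r n) t))" for n
    unfolding stieltjes_delay[OF g r0] set_lebesgue_integral_def by (subst integral_distr) auto
  \<comment> \<open>Almost all mass lies at or after \<open>s\<close>, where
    \<open>max s t = t\<close>; so the limit takes the same form as its approximations.\<close>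
  have b: "(LINT t:{s..}|stieltjes_measure g. ?f t) = (LINT t|stieltjes_measure g. ?f (max s t))"
    unfolding set_lebesgue_integral_def using AE_stieltjes[OF g gs]
    by (intro integral_cong_AE) (auto elim!: eventually_mono)
  show "(\<lambda>n. LINT t:{r n..}|stieltjes_measure (delay (r n) g). ?f t) \<longlonglongrightarrow> (LINT t:{s..}|stieltjes_measure g. ?f t)"
    unfolding a b
  proof (rule integral_dominated_convergence[where w="\<lambda>_. D"])
    show "integrable (stieltjes_measure g) (\<lambda>_. D)"
      by (rule finite_measure.integrable_const[OF finite_stieltjes[OF g]])
    have "isCont ?f t" for t by (intro continuous_intros y)
    then show "AE t in stieltjes_measure g. (\<lambda>n. ?f (max (r n) t)) \<longlonglongrightarrow> ?f (max s t)"
      by (intro AE_I2 isCont_tendsto_compose[of _ ?f] rl)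
    show "AE t in stieltjes_measure g. norm (?f (max (r n) t)) \<le> D" for n
    proof (rule AE_I2)
      fix t
      have "0 \<le> max (r n) t" using r0[of n] by simp
      from jump_cost_bound[OF g ym D order_refl, of "max (r n) t"] this
      show "norm (?f (max (r n) t)) \<le> D" by simp
    qed
  qed simp_all
  show "(\<lambda>n. LBINT t:{r n..}. exp (- lam * t) * lam * y t * \<Phi> (c + delay (r n) g t)) \<longlonglongrightarrow>
      (LBINT t:{s..}. exp (- lam * t) * lam * y t * \<Phi> (c + g t))"
    unfolding set_lebesgue_integral_def
  proof (rule integral_dominated_convergence[where w="\<lambda>t. lam * D * F * (indicator {s..} t *\<^sub>R exp (- (lam / 2) * t))"])
    show "integrable lborel (\<lambda>t. lam * D * F * (indicator {s..} t *\<^sub>R exp (- (lam / 2) * t)))"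
      using exp_tail_integral(1)[of "lam / 2" s] lam unfolding set_integrable_def by (intro integrable_mult_right) auto
    \<comment> \<open>At \<open>t = s\<close> the approximations may all be 0 while the limit is
      not, so this point is left out.\<close>
    have "AE t in lborel. t \<noteq> s" by (rule AE_lborel_singleton)
    then show "AE t in lborel. (\<lambda>n. indicator {r n..} t *\<^sub>R (exp (- lam * t) * lam * y t * \<Phi> (c + delay (r n) g t))) \<longlonglongrightarrow>
        indicator {s..} t *\<^sub>R (exp (- lam * t) * lam * y t * \<Phi> (c + g t))"
    proof eventually_elim
      case (elim t)
      show ?case
      proof (cases "t < s")
        case True
        then have "indicator {r n..} t = (0::real)" for n using r(1)[of n] by (auto simp: indicator_def)
        then show ?thesis using True by simp
      next
        case False
        then have "\<forall>\<^sub>F n in sequentially. r n < t" using elim by (intro order_tendstoD(2)[OF r(2)]) auto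
        then have "\<forall>\<^sub>F n in sequentially. indicator {r n..} t *\<^sub>R (exp (- lam * t) * lam * y t * \<Phi> (c + delay (r n) g t))
           = indicator {s..} t *\<^sub>R (exp (- lam * t) * lam * y t * \<Phi> (c + g t))"
          by eventually_elim (use False in \<open>auto simp: delay_def\<close>)
        then show ?thesis by (rule tendsto_eventually)
      qed
    qed
    show "AE t in lborel. norm (indicator {r n..} t *\<^sub>R (exp (- lam * t) * lam * y t * \<Phi> (c + delay (r n) g t)))
      \<le> lam * D * F * (indicator {s..} t *\<^sub>R exp (- (lam / 2) * t))" for n
    proof (rule AE_I2)
      fix t
      have "norm (indicator {r n..} t *\<^sub>R (exp (- lam * t) * lam * y t * \<Phi> (c + delay (r n) g t)))
        \<le> lam * D * F * (indicator {r n..} t *\<^sub>R exp (- (lam / 2) * t))"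
        unfolding real_norm_def by (rule run_cost_bound[OF cpath_delay[OF g r0] ym D r0])
      also have "\<dots> \<le> lam * D * F * (indicator {s..} t *\<^sub>R exp (- (lam / 2) * t))"
        using r(1)[of n] lam dominator_nonneg[OF D] F_nonneg[OF g]
        by (intro mult_left_mono) (auto simp: indicator_def)
      finally show "norm (indicator {r n..} t *\<^sub>R (exp (- lam * t) * lam * y t * \<Phi> (c + delay (r n) g t)))
        \<le> lam * D * F * (indicator {s..} t *\<^sub>R exp (- (lam / 2) * t))" .
    qed
    show "(\<lambda>t. indicator {r n..} t *\<^sub>R (exp (- lam * t) * lam * y t * \<Phi> (c + delay (r n) g t))) \<in> borel_measurable lborel" for n
    proof -
      note cpath_borel[OF cpath_delay[OF g r0], measurable]
      show ?thesis by measurable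
    qed
  qed measurable
qed

end

section \<open>The Wiener measure\<close>

lemma dyadic_below:
  fixes t :: real assumes "0 \<le> t"
  shows "(\<lambda>n. real (nat \<lfloor>2 ^ n * t\<rfloor>) / 2 ^ n) \<longlonglongrightarrow> t"
proof (rule tendsto_sandwich[of "\<lambda>n. t - (1/2)^n" _ _ "\<lambda>_. t"])
  have *: "t - (1/2)^n \<le> real (nat \<lfloor>2 ^ n * t\<rfloor>) / 2 ^ n" "real (nat \<lfloor>2 ^ n * t\<rfloor>) / 2 ^ n \<le> t" for n
  proof -
    have r: "real (nat \<lfloor>2 ^ n * t\<rfloor>) = of_int \<lfloor>2 ^ n * t\<rfloor>" using assms by simp
    have "2 ^ n * t - 1 \<le> of_int \<lfloor>2 ^ n * t\<rfloor>" "of_int \<lfloor>2 ^ n * t\<rfloor> \<le> 2 ^ n * t" by linarith+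
    then show "t - (1/2)^n \<le> real (nat \<lfloor>2 ^ n * t\<rfloor>) / 2 ^ n" "real (nat \<lfloor>2 ^ n * t\<rfloor>) / 2 ^ n \<le> t"
      unfolding r
      using divide_right_mono[of "2 ^ n * t - 1" "of_int \<lfloor>2 ^ n * t\<rfloor>" "2 ^ n :: real"]
        divide_right_mono[of "of_int \<lfloor>2 ^ n * t\<rfloor>" "2 ^ n * t" "2 ^ n :: real"]
      by (simp_all add: diff_divide_distrib power_one_over)
  qed
  show "\<forall>\<^sub>F n in sequentially. t - (1/2)^n \<le> real (nat \<lfloor>2 ^ n * t\<rfloor>) / 2 ^ n"
       "\<forall>\<^sub>F n in sequentially. real (nat \<lfloor>2 ^ n * t\<rfloor>) / 2 ^ n \<le> t"
    using * by (auto intro!: always_eventually)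
  have "(\<lambda>n. t - (1/2)^n) \<longlonglongrightarrow> t - 0" by (intro tendsto_intros LIMSEQ_realpow_zero) auto
  then show "(\<lambda>n. t - (1/2)^n) \<longlonglongrightarrow> t" by simp
qed simp

definition dyadics :: "real set" where
  "dyadics = {real k / 2 ^ n | k n. True}"

text \<open>Only dyadic times, because finitely many of them lie on a common grid, where paths are
  described by independent increments. Continuity of the paths recovers all other times in
  \<open>sets_PP_cylinders\<close>.\<close>

definition cylinders :: "(real \<Rightarrow> real) set set" where
  "cylinders = {{b \<in> pathC. \<forall>q\<in>J. b q \<in> A q} | J A. finite J \<and> J \<subseteq> dyadics \<and> (\<forall>q. A q \<in> sets borel)}"

lemma Int_stable_cylinders: "Int_stable cylinders"
proof (rule Int_stableI)
  fix S T assume "S \<in> cylinders" "T \<in> cylinders"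
  then obtain J A J' A' where S: "S = {b \<in> pathC. \<forall>q\<in>J. b q \<in> A q}" "finite J" "J \<subseteq> dyadics" "\<forall>q. A q \<in> sets borel"
    and T: "T = {b \<in> pathC. \<forall>q\<in>J'. b q \<in> A' q}" "finite J'" "J' \<subseteq> dyadics" "\<forall>q. A' q \<in> sets borel"
    unfolding cylinders_def by blast
  let ?A = "\<lambda>q. (if q \<in> J then A q else UNIV) \<inter> (if q \<in> J' then A' q else UNIV)"
  have "S \<inter> T = {b \<in> pathC. \<forall>q\<in>J \<union> J'. b q \<in> ?A q}" unfolding S(1) T(1) by auto
  moreover have "\<forall>q. ?A q \<in> sets borel" using S T by auto
  ultimately show "S \<inter> T \<in> cylinders"
    unfolding cylinders_def using S T by (intro CollectI exI[of _ "J \<union> J'"] exI[of _ ?A]) auto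
qed

lemma cylinders_Pow: "cylinders \<subseteq> Pow pathC"
  by (auto simp: cylinders_def)

lemma sets_PP_cylinders: "sets PP = sigma_sets pathC cylinders"
proof
  let ?S = "sigma pathC cylinders"
  have sp: "space ?S = pathC" and st: "sets ?S = sigma_sets pathC cylinders"
    using cylinders_Pow by (auto intro: space_measure_of sets_measure_of)
  have dy: "(\<lambda>b. b q) \<in> borel_measurable ?S" if "q \<in> dyadics" for q
  proof (rule measurableI)
    fix A :: "real set" assume "A \<in> sets borel"
    then have "{b \<in> pathC. \<forall>q'\<in>{q}. b q' \<in> A} \<in> cylinders"
      unfolding cylinders_def using that by (intro CollectI exI[of _ "{q}"] exI[of _ "\<lambda>_. A"]) auto
    moreover have "(\<lambda>b. b q) -` A \<inter> space ?S = {b \<in> pathC. \<forall>q'\<in>{q}. b q' \<in> A}" using sp by auto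
    ultimately show "(\<lambda>b. b q) -` A \<inter> space ?S \<in> sets ?S" by (simp add: st)
  qed simp
  have all: "(\<lambda>b. b t) \<in> borel_measurable ?S" for t
  proof (cases "t \<le> 0")
    case True
    then have "b t = 0" if "b \<in> space ?S" for b using that by (simp add: sp pathC_neg)
    then show ?thesis by (subst measurable_cong[of _ _ "\<lambda>_. 0"]) auto
  next
    case False
    show ?thesis
    proof (rule borel_measurable_LIMSEQ_real)
      show "(\<lambda>n. b (real (nat \<lfloor>2 ^ n * t\<rfloor>) / 2 ^ n)) \<longlonglongrightarrow> b t" if "b \<in> space ?S" for b
        using that sp False by (intro isCont_tendsto_compose[OF pathC_cont dyadic_below]) auto
      show "(\<lambda>b. b (real (nat \<lfloor>2 ^ n * t\<rfloor>) / 2 ^ n)) \<in> borel_measurable ?S" for n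
        by (rule dy) (auto simp: dyadics_def)
    qed
  qed
  show "sets PP \<subseteq> sigma_sets pathC cylinders"
    unfolding sets_paths
  proof (rule sigma_sets_mono, rule subsetI)
    fix X assume "X \<in> {(\<lambda>b. b q) -` A \<inter> pathC | q A. q \<in> UNIV \<and> A \<in> sets borel}"
    then obtain q A where X: "X = (\<lambda>b. b q) -` A \<inter> pathC" "A \<in> sets borel" by auto
    have "(\<lambda>b. b q) -` A \<inter> space ?S \<in> sets ?S" by (rule measurable_sets[OF all X(2)])
    then show "X \<in> sigma_sets pathC cylinders" unfolding X(1) sp st .
  qed
  have "X \<in> sets PP" if "X \<in> cylinders" for X
  proof -
    from that obtain J A where X: "X = {b \<in> pathC. \<forall>q\<in>J. b q \<in> A q}" "finite J" "\<forall>q. A q \<in> sets borel"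
      unfolding cylinders_def by blast
    have "X = {b \<in> space PP. \<forall>q\<in>J. b q \<in> A q}" by (simp add: X(1))
    moreover have "{b \<in> space PP. \<forall>q\<in>J. b q \<in> A q} \<in> sets PP"
    proof (rule sets.sets_Collect_finite_All[OF _ X(2)])
      fix q
      have "(\<lambda>b. b q) -` A q \<inter> space PP \<in> sets PP" using X(3) by (intro measurable_sets[OF measurable_path_eval]) auto
      moreover have "(\<lambda>b. b q) -` A q \<inter> space PP = {b \<in> space PP. b q \<in> A q}" by auto
      ultimately show "{b \<in> space PP. b q \<in> A q} \<in> sets PP" by simp
    qed
    ultimately show ?thesis by simp
  qed
  then show "sigma_sets pathC cylinders \<subseteq> sets PP"
    using sets.sigma_sets_subset[of cylinders PP] by auto
qed

abbreviation inc :: "nat \<Rightarrow> (real \<Rightarrow> real) \<Rightarrow> nat \<Rightarrow> real" where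
  "inc n b i \<equiv> b (real (Suc i) / 2 ^ n) - b (real i / 2 ^ n)"

text \<open>The lower bound on \<open>n\<close> serves \<open>splice\<close>: the grid must be fine
  enough to contain the splicing time.\<close>

lemma dyadics_common:
  assumes "finite J" "J \<subseteq> dyadics"
  shows "\<exists>n\<ge>n0. \<forall>q\<in>J. \<exists>k. q = real k / 2 ^ n"
  using assms
proof induction
  case (insert q J)
  then obtain n where n: "n \<ge> n0" "\<forall>q\<in>J. \<exists>k. q = real k / 2 ^ n" by auto
  from insert obtain k m where q: "q = real k / 2 ^ m" by (auto simp: dyadics_def)
  have "\<exists>k'. real i / 2 ^ a = real k' / 2 ^ (a + b)" for i a b :: nat
    by (intro exI[of _ "i * 2 ^ b"]) (simp add: power_add)
  from this[of _ n m] this[of k m n] n q show ?case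
    by (intro exI[of _ "n + m"]) (auto simp: add.commute)
qed auto

text \<open>Paths start at 0, so their values on a grid are partial sums of increments, and cylinder
  events become events of the increments. The freedom in \<open>lo\<close> and \<open>N'\<close>
  allows comparison on those grids only that contain the splicing time and reach beyond it.\<close>

lemma path_law_eqI:
  assumes "prob_space P" and Z: "Z \<in> P \<rightarrow>\<^sub>M PP" and Y: "Y \<in> Q \<rightarrow>\<^sub>M PP"
    and inc: "\<And>n N. lo \<le> n \<Longrightarrow> \<exists>N'\<ge>N.
      distr P (PiM {..<N'} (\<lambda>_. borel)) (\<lambda>w. \<lambda>i\<in>{..<N'}. inc n (Z w) i) =
      distr Q (PiM {..<N'} (\<lambda>_. borel)) (\<lambda>w. \<lambda>i\<in>{..<N'}. inc n (Y w) i)"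
  shows "distr P PP Z = distr Q PP Y"
proof (rule measure_eqI_generator_eq[OF Int_stable_cylinders cylinders_Pow])
  show "sets (distr P PP Z) = sigma_sets pathC cylinders" "sets (distr Q PP Y) = sigma_sets pathC cylinders"
    using sets_PP_cylinders by simp_all
  have "{b \<in> pathC. \<forall>q\<in>{}. b q \<in> UNIV} \<in> cylinders"
    unfolding cylinders_def by (intro CollectI exI[of _ "{}"] exI[of _ "\<lambda>_. UNIV"]) auto
  then show "range (\<lambda>_::nat. pathC) \<subseteq> cylinders" by auto
  interpret P: prob_space P by fact
  show "emeasure (distr P PP Z) pathC \<noteq> \<infinity>"
    using P.prob_space_distr[OF Z] prob_space.emeasure_space_1[of "distr P PP Z"] by simp
  fix X assume "X \<in> cylinders"
  then obtain J A where X: "X = {b \<in> pathC. \<forall>q\<in>J. b q \<in> A q}" "finite J" "J \<subseteq> dyadics" "\<forall>q. A q \<in> sets borel"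
    unfolding cylinders_def by blast
  obtain n where n: "n \<ge> lo" "\<forall>q\<in>J. \<exists>k. q = real k / 2 ^ n" using dyadics_common[OF X(2,3), of lo] by blast
  then obtain k where k: "\<And>q. q \<in> J \<Longrightarrow> q = real (k q) / 2 ^ n" by metis
  define N where "N = Max (insert 0 (k ` J))"
  have kN: "k q \<le> N" if "q \<in> J" for q unfolding N_def using that X(2) by (intro Max_ge) auto
  obtain N' where N': "N' \<ge> N" and eq: "distr P (PiM {..<N'} (\<lambda>_. borel)) (\<lambda>w. \<lambda>i\<in>{..<N'}. inc n (Z w) i) =
      distr Q (PiM {..<N'} (\<lambda>_. borel)) (\<lambda>w. \<lambda>i\<in>{..<N'}. inc n (Y w) i)" using inc[OF n(1)] by blast
  let ?PM = "PiM {..<N'} (\<lambda>_. borel) :: (nat \<Rightarrow> real) measure"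
  define S where "S = {d \<in> space ?PM. \<forall>q\<in>J. (\<Sum>i<k q. d i) \<in> A q}"
  have S: "S \<in> sets ?PM" unfolding S_def
  proof (rule sets.sets_Collect_finite_All[OF _ X(2)])
    fix q assume "q \<in> J"
    have "(\<lambda>d. \<Sum>i<k q. d i) \<in> borel_measurable ?PM"
      using kN[OF \<open>q \<in> J\<close>] N' by (intro borel_measurable_sum measurable_component_singleton) auto
    then have "(\<lambda>d. \<Sum>i<k q. d i) -` A q \<inter> space ?PM \<in> sets ?PM" using X(4) by (intro measurable_sets) auto
    moreover have "(\<lambda>d. \<Sum>i<k q. d i) -` A q \<inter> space ?PM = {d \<in> space ?PM. (\<Sum>i<k q. d i) \<in> A q}" by auto
    ultimately show "{d \<in> space ?PM. (\<Sum>i<k q. d i) \<in> A q} \<in> sets ?PM" by simp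
  qed
  have key: "emeasure (distr R PP W) X = emeasure (distr R ?PM (\<lambda>w. \<lambda>i\<in>{..<N'}. inc n (W w) i)) S"
    if W: "W \<in> R \<rightarrow>\<^sub>M PP" for R :: "'z measure" and W
  proof -
    have m: "(\<lambda>w. \<lambda>i\<in>{..<N'}. inc n (W w) i) \<in> R \<rightarrow>\<^sub>M ?PM"
      by (intro measurable_restrict borel_measurable_diff measurable_compose[OF W measurable_path_eval]) auto
    have XP: "X \<in> sets PP" using \<open>X \<in> cylinders\<close> sets_PP_cylinders by auto
    have "W -` X \<inter> space R = (\<lambda>w. \<lambda>i\<in>{..<N'}. inc n (W w) i) -` S \<inter> space R"
    proof (intro set_eqI iffI)
      fix w
      have "W w q = (\<Sum>i<k q. (\<lambda>i\<in>{..<N'}. inc n (W w) i) i)" if "w \<in> space R" "q \<in> J" for q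
      proof -
        have "W w \<in> pathC" using measurable_space[OF W that(1)] by simp
        then have w0: "W w 0 = 0" by (rule pathC_neg) simp
        have "(\<Sum>i<k q. (\<lambda>i\<in>{..<N'}. inc n (W w) i) i) = (\<Sum>i<k q. inc n (W w) i)"
          using kN[OF that(2)] N' by (intro sum.cong) auto
        also have "\<dots> = W w (real (k q) / 2 ^ n) - W w (real 0 / 2 ^ n)" by (rule sum_lessThan_telescope)
        finally show ?thesis using k[OF that(2)] w0 by simp
      qed
      note * = this
      { assume "w \<in> W -` X \<inter> space R"
        then show "w \<in> (\<lambda>w. \<lambda>i\<in>{..<N'}. inc n (W w) i) -` S \<inter> space R"
          using * measurable_space[OF m] unfolding S_def X(1) by auto }
      { assume "w \<in> (\<lambda>w. \<lambda>i\<in>{..<N'}. inc n (W w) i) -` S \<inter> space R"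
        then show "w \<in> W -` X \<inter> space R"
          using * measurable_space[OF W] unfolding S_def X(1) by auto }
    qed
    then show ?thesis using W m XP S by (simp add: emeasure_distr)
  qed
  show "emeasure (distr P PP Z) X = emeasure (distr Q PP Y) X"
    unfolding key[OF Z] key[OF Y] eq ..
qed auto

text \<open>The cost of a control is compared with a measurable path functional almost everywhere;
  completeness supplies the measurability of the cost itself.\<close>

lemma (in complete_measure) borel_measurable_AE_eq:
  fixes f g :: "'a \<Rightarrow> 'b::topological_space"
  assumes f: "f \<in> borel_measurable M" and eq: "AE x in M. f x = g x"
  shows "g \<in> borel_measurable M"
proof (rule measurableI)
  fix A :: "'b set" assume A: "A \<in> sets borel"
  have N: "{x \<in> space M. f x \<noteq> g x} \<in> null_sets M" using eq by (simp add: AE_iff_null_sets)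
  let ?N = "{x \<in> space M. f x \<noteq> g x}"
  have "g -` A \<inter> space M = (f -` A \<inter> space M - ?N) \<union> (g -` A \<inter> ?N)" by auto
  moreover have "g -` A \<inter> ?N \<in> sets M" using complete[OF _ N, of "g -` A \<inter> ?N"] by auto
  ultimately show "g -` A \<inter> space M \<in> sets M" using measurable_sets[OF f A] N by auto
qed simp

text \<open>Paths that are discontinuous or do not start at 0 are replaced by the zero path, so that
  pathwise facts apply to every outcome; by \<open>AE_bpath\<close> only a null set is
  affected.\<close>

definition bpath :: "(real \<Rightarrow> 'a \<Rightarrow> real) \<Rightarrow> 'a \<Rightarrow> real \<Rightarrow> real" where
  "bpath B w t = (if continuous_on {0..} (\<lambda>t. B t w) \<and> B 0 w = 0 \<and> 0 \<le> t then B t w else 0)"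

lemma bpath_pathC: "bpath B w \<in> pathC"
proof (cases "continuous_on {0..} (\<lambda>t. B t w) \<and> B 0 w = 0")
  case True
  have "bpath B w = (\<lambda>t. B (max t 0) w)" using True by (auto simp: bpath_def max_def fun_eq_iff)
  moreover have "continuous_on UNIV (\<lambda>t. B (max t 0) w)"
    using True by (intro continuous_on_compose2[of "{0..}" "\<lambda>t. B t w" UNIV "\<lambda>t. max t 0"] continuous_intros) auto
  ultimately show ?thesis using True by (auto simp: pathC_def)
next
  case False
  then have "bpath B w = (\<lambda>_. 0)" by (auto simp: bpath_def fun_eq_iff)
  then show ?thesis by simp
qed

section \<open>Brownian increments and the splicing identity\<close>

locale bm = prob_space M + complete_measure M for M :: "'a measure" +
  fixes B :: "real \<Rightarrow> 'a \<Rightarrow> real"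
  assumes bm: "brownian_motion M B"
begin

abbreviation "\<beta> \<equiv> bpath B"

lemma AE_bpath: "AE w in M. \<forall>t\<ge>0. \<beta> w t = B t w"
proof -
  have "AE w in M. B 0 w = 0" "AE w in M. continuous_on {0..} (\<lambda>t. B t w)"
    using bm by (auto simp: brownian_motion_def)
  then show ?thesis by eventually_elim (auto simp: bpath_def)
qed

lemma B_indep_increments:
  fixes t :: "nat \<Rightarrow> real" assumes "0 \<le> t 0" "incseq t"
  shows "indep_vars (\<lambda>_. borel) (\<lambda>i w. B (t (Suc i)) w - B (t i) w) {..<n}"
  using bm assms unfolding brownian_motion_def by blast

lemma B_measurable: "0 \<le> t \<Longrightarrow> B t \<in> borel_measurable M"
  using bm by (auto simp: brownian_motion_def)

lemma bpath_eval_measurable: "(\<lambda>w. \<beta> w t) \<in> borel_measurable M"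
proof (cases "0 \<le> t")
  case True
  have "AE w in M. B t w = \<beta> w t" using AE_bpath by eventually_elim (use True in auto)
  then show ?thesis by (rule borel_measurable_AE_eq[OF B_measurable[OF True]])
next
  case False
  then have "(\<lambda>w. \<beta> w t) = (\<lambda>_. 0)" by (auto simp: bpath_def fun_eq_iff)
  then show ?thesis by simp
qed

lemma bpath_measurable [measurable]: "\<beta> \<in> M \<rightarrow>\<^sub>M PP"
  by (intro measurable_pathsI bpath_pathC bpath_eval_measurable)

abbreviation stepn :: "nat \<Rightarrow> real measure" where
  "stepn n \<equiv> density lborel (normal_density 0 (sqrt (1 / 2 ^ n)))"

lemma prob_space_stepn: "prob_space (stepn n)"
  by (rule prob_space_normal_density) simp

lemma inc_measurable: "(\<lambda>w. inc n (\<beta> w) i) \<in> borel_measurable M"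
  by (intro borel_measurable_diff bpath_eval_measurable)

lemma inc_law1: "distr M borel (\<lambda>w. inc n (\<beta> w) i) = stepn n"
proof -
  have "distributed M lborel (\<lambda>w. inc n (\<lambda>t. B t w) i) (normal_density 0 (sqrt (real (Suc i) / 2 ^ n - real i / 2 ^ n)))"
    using bm unfolding brownian_motion_def by (auto simp: divide_strict_right_mono)
  then have "distr M lborel (\<lambda>w. inc n (\<lambda>t. B t w) i) = stepn n"
    by (simp add: distributed_def flip: diff_divide_distrib)
  moreover have "distr M borel (\<lambda>w. inc n (\<beta> w) i) = distr M lborel (\<lambda>w. inc n (\<lambda>t. B t w) i)"
  proof (rule distr_cong_AE)
    show "AE w in M. inc n (\<beta> w) i = inc n (\<lambda>t. B t w) i" using AE_bpath by eventually_elim simp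
    show "(\<lambda>w. inc n (\<lambda>t. B t w) i) \<in> M \<rightarrow>\<^sub>M lborel"
      unfolding measurable_lborel1 by (intro borel_measurable_diff B_measurable) auto
  qed (rule refl sets_lborel[symmetric] inc_measurable)+
  ultimately show ?thesis by simp
qed

text \<open>Truncated subtraction: \<open>i - m = 0\<close> for \<open>i \<le> m\<close>, so the shifted times are still nondecreasing in \<open>i\<close>.\<close>
lemma inc_law:
  fixes J :: "nat set" and m :: nat
  assumes J: "finite J" "\<And>i. i \<in> J \<Longrightarrow> m \<le> i"
  shows "distr M (PiM J (\<lambda>_. borel)) (\<lambda>w. \<lambda>i\<in>J. inc n (\<beta> w) (i - m)) = PiM J (\<lambda>_. stepn n)"
proof (cases "J = {}")
  \<comment> \<open>\<open>indep_vars_iff_distr_eq_PiM'\<close> asks for a nonempty index set. The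
    empty one does occur: in \<open>splice\<close> the first block is empty when
    \<open>s = 0\<close>.\<close>
  case True
  interpret P: prob_space "distr M (PiM J (\<lambda>_. borel)) (\<lambda>w. \<lambda>i\<in>J. inc n (\<beta> w) (i - m))"
    by (intro prob_space_distr measurable_restrict inc_measurable)
  have "prob_space (PiM J (\<lambda>_. stepn n))" by (intro prob_space_PiM prob_space_stepn)
  then show ?thesis
    using P.emeasure_space_1 True
    by (intro measure_eqI) (auto simp: sets_PiM_empty space_PiM prob_space.emeasure_space_1)
next
  case False
  let ?X = "\<lambda>i w. B (real (Suc i - m) / 2 ^ n) w - B (real (i - m) / 2 ^ n) w"
  have "incseq (\<lambda>i. real (i - m) / 2 ^ n)" by (intro incseq_SucI divide_right_mono) auto
  then have "indep_vars (\<lambda>_. borel) ?X {..<Suc (Max J)}" by (intro B_indep_increments) auto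
  moreover have "J \<subseteq> {..<Suc (Max J)}" using J by (auto simp: less_Suc_eq_le)
  ultimately have ind: "indep_vars (\<lambda>_. borel) ?X J" by (rule indep_vars_subset)
  have Xm: "?X i \<in> borel_measurable M" for i by (intro borel_measurable_diff B_measurable) auto
  have AEX: "AE w in M. \<forall>i\<in>J. inc n (\<beta> w) (i - m) = ?X i w"
    using AE_bpath by eventually_elim (use J in \<open>auto simp: Suc_diff_le\<close>)
  have "distr M (PiM J (\<lambda>_. borel)) (\<lambda>w. \<lambda>i\<in>J. inc n (\<beta> w) (i - m)) =
      distr M (PiM J (\<lambda>_. borel)) (\<lambda>w. \<lambda>i\<in>J. ?X i w)"
  proof (rule distr_cong_AE)
    show "AE w in M. (\<lambda>i\<in>J. inc n (\<beta> w) (i - m)) = (\<lambda>i\<in>J. ?X i w)"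
      using AEX by eventually_elim (intro restrict_ext, blast)
  qed (intro measurable_restrict inc_measurable Xm refl)+
  also have "\<dots> = PiM J (\<lambda>i. distr M borel (?X i))"
    using ind by (subst (asm) indep_vars_iff_distr_eq_PiM'[OF False Xm])
  also have "\<dots> = PiM J (\<lambda>_. stepn n)"
  proof (rule PiM_cong[OF refl])
    fix i assume i: "i \<in> J"
    have "distr M borel (?X i) = distr M borel (\<lambda>w. inc n (\<beta> w) (i - m))"
      by (rule distr_cong_AE[OF refl refl _ Xm inc_measurable]) (use AEX i in \<open>auto elim!: eventually_mono\<close>)
    then show "distr M borel (?X i) = stepn n" by (simp only: inc_law1)
  qed
  finally show ?thesis .
qed

text \<open>On a grid that contains \<open>s\<close>, the increments of the spliced path before
  \<open>s\<close> come from \<open>w\<close> and those after \<open>s\<close> from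
  \<open>w'\<close>. Each block is a product of Gaussian steps, the blocks are independent in the
  product space, and merging them gives the law of the increments of a single Brownian path.\<close>

lemma splice:
  assumes s: "s = real m0 / 2 ^ n0"
  shows "distr (M \<Otimes>\<^sub>M M) PP (\<lambda>(w, w'). conc s (\<beta> w) (\<beta> w')) = distr M PP \<beta>"
proof (rule path_law_eqI[where lo=n0])
  interpret MM: pair_prob_space M M ..
  have s0: "0 \<le> s" using s by simp
  show "prob_space (M \<Otimes>\<^sub>M M)" by (rule MM.prob_space_axioms)
  have "(\<lambda>(w, w'). (\<beta> w, \<beta> w')) \<in> M \<Otimes>\<^sub>M M \<rightarrow>\<^sub>M PP \<Otimes>\<^sub>M PP" by measurable
  from measurable_compose[OF this measurable_conc[OF s0]]
  show "(\<lambda>(w, w'). conc s (\<beta> w) (\<beta> w')) \<in> M \<Otimes>\<^sub>M M \<rightarrow>\<^sub>M PP" by (simp add: case_prod_beta)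
  show "\<beta> \<in> M \<rightarrow>\<^sub>M PP" by measurable
  fix n N assume "n0 \<le> n"
  \<comment> \<open>The index of \<open>s\<close> on the finer grid of mesh 1 / 2^n.\<close>
  define m where "m = m0 * 2 ^ (n - n0)"
  have sm: "s = real m / 2 ^ n"
  proof -
    have "(2::real) ^ n = 2 ^ n0 * 2 ^ (n - n0)" using \<open>n0 \<le> n\<close> by (simp flip: power_add)
    then show ?thesis by (simp add: s m_def)
  qed
  define K where "K = m + N"
  define J where "J = {m..<K}"
  have IJ: "{..<m} \<union> J = {..<K}" "{..<m} \<inter> J = {}" by (auto simp: J_def K_def)
  interpret product_sigma_finite "\<lambda>_::nat. stepn n"
    by (rule product_sigma_finite.intro) (rule prob_space_imp_sigma_finite[OF prob_space_stepn])
  let ?PI = "\<lambda>I. PiM I (\<lambda>_. borel) :: (nat \<Rightarrow> real) measure"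
  let ?DI = "\<lambda>w. \<lambda>i\<in>{..<m}. inc n (\<beta> w) i" and ?DJ = "\<lambda>w. \<lambda>i\<in>J. inc n (\<beta> w) (i - m)"
  have lI: "distr M (?PI {..<m}) ?DI = PiM {..<m} (\<lambda>_. stepn n)"
    using inc_law[of "{..<m}" 0 n] by simp
  have lJ: "distr M (?PI J) ?DJ = PiM J (\<lambda>_. stepn n)"
    by (rule inc_law) (auto simp: J_def)
  have mI: "?DI \<in> M \<rightarrow>\<^sub>M ?PI {..<m}" and mJ: "?DJ \<in> M \<rightarrow>\<^sub>M ?PI J"
    by (intro measurable_restrict inc_measurable)+
  have mp: "(\<lambda>(w, w'). (?DI w, ?DJ w')) \<in> M \<Otimes>\<^sub>M M \<rightarrow>\<^sub>M ?PI {..<m} \<Otimes>\<^sub>M ?PI J"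
    unfolding case_prod_beta
    by (rule measurable_Pair[OF measurable_compose[OF measurable_fst mI] measurable_compose[OF measurable_snd mJ]])
  have mm: "merge {..<m} J \<in> ?PI {..<m} \<Otimes>\<^sub>M ?PI J \<rightarrow>\<^sub>M ?PI {..<K}"
    using measurable_merge[of "{..<m}" J "\<lambda>_. borel :: real measure"] unfolding IJ .
  have "PiM {..<K} (\<lambda>_. stepn n) = distr (PiM {..<m} (\<lambda>_. stepn n) \<Otimes>\<^sub>M PiM J (\<lambda>_. stepn n)) (PiM {..<K} (\<lambda>_. stepn n)) (merge {..<m} J)"
    using distr_merge[OF IJ(2)] unfolding IJ(1) by (simp add: J_def)
  also have "\<dots> = distr (distr M (?PI {..<m}) ?DI \<Otimes>\<^sub>M distr M (?PI J) ?DJ) (?PI {..<K}) (merge {..<m} J)"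
    unfolding lI lJ by (intro distr_cong refl) (simp cong: sets_PiM_cong)
  also have "distr M (?PI {..<m}) ?DI \<Otimes>\<^sub>M distr M (?PI J) ?DJ =
      distr (M \<Otimes>\<^sub>M M) (?PI {..<m} \<Otimes>\<^sub>M ?PI J) (\<lambda>(w, w'). (?DI w, ?DJ w'))"
    by (rule pair_measure_distr[OF mI mJ]) (intro prob_space_imp_sigma_finite prob_space_distr mJ)
  also have "distr \<dots> (?PI {..<K}) (merge {..<m} J) =
      distr (M \<Otimes>\<^sub>M M) (?PI {..<K}) (merge {..<m} J \<circ> (\<lambda>(w, w'). (?DI w, ?DJ w')))"
    by (rule distr_distr[OF mm mp])
  also have "merge {..<m} J \<circ> (\<lambda>(w, w'). (?DI w, ?DJ w')) =
      (\<lambda>z. \<lambda>i\<in>{..<K}. inc n (case z of (w, w') \<Rightarrow> conc s (\<beta> w) (\<beta> w')) i)"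
  proof (intro ext)
    fix z :: "'a \<times> 'a" and i :: nat
    obtain w w' where z: "z = (w, w')" by (cases z)
    have b0: "\<beta> w' 0 = 0" by (rule pathC_neg[OF bpath_pathC]) simp
    have le: "real j / 2 ^ n \<le> s \<longleftrightarrow> j \<le> m" for j unfolding sm by (simp add: divide_le_cancel)
    have c: "conc s (\<beta> w) (\<beta> w') (real j / 2 ^ n) =
       (if j \<le> m then \<beta> w (real j / 2 ^ n) else \<beta> w s + \<beta> w' (real (j - m) / 2 ^ n))" for j
      unfolding conc_def le by (auto simp: sm of_nat_diff diff_divide_distrib)
    \<comment> \<open>The formula for later points extends to j = m, because the second path starts
      at 0. The increment with index m needs it at both of its endpoints.\<close>
    have c': "conc s (\<beta> w) (\<beta> w') (real j / 2 ^ n) = \<beta> w s + \<beta> w' (real (j - m) / 2 ^ n)" if "m \<le> j" for j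
      using that b0 unfolding c by (cases "j = m") (auto simp: sm)
    show "(merge {..<m} J \<circ> (\<lambda>(w, w'). (?DI w, ?DJ w'))) z i =
      (\<lambda>i\<in>{..<K}. inc n (case z of (w, w') \<Rightarrow> conc s (\<beta> w) (\<beta> w')) i) i"
    proof (cases "i < m")
      case True
      then show ?thesis using c[of i] c[of "Suc i"] by (auto simp: z merge_def K_def)
    next
      case False
      then show ?thesis using c'[of i] c'[of "Suc i"] by (auto simp: z merge_def J_def Suc_diff_le)
    qed
  qed
  finally have L: "distr (M \<Otimes>\<^sub>M M) (?PI {..<K}) (\<lambda>z. \<lambda>i\<in>{..<K}. inc n (case z of (w, w') \<Rightarrow> conc s (\<beta> w) (\<beta> w')) i)
     = PiM {..<K} (\<lambda>_. stepn n)" by (rule sym)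
  have R: "distr M (?PI {..<K}) (\<lambda>w. \<lambda>i\<in>{..<K}. inc n (\<beta> w) i) = PiM {..<K} (\<lambda>_. stepn n)"
    using inc_law[of "{..<K}" 0 n] by simp
  show "\<exists>N'\<ge>N. distr (M \<Otimes>\<^sub>M M) (?PI {..<N'}) (\<lambda>z. \<lambda>i\<in>{..<N'}. inc n (case z of (w, w') \<Rightarrow> conc s (\<beta> w) (\<beta> w')) i)
     = distr M (?PI {..<N'}) (\<lambda>w. \<lambda>i\<in>{..<N'}. inc n (\<beta> w) i)"
    by (rule exI[of _ K], rule conjI) (simp add: K_def, simp only: L R)
qed

end

section \<open>Growth of Brownian paths\<close>

text \<open>The weights \<open>exp (r * _)\<close> make one bound valid on the whole half-line.\<close>
lemma dyadic_chain:
  assumes b: "b \<in> pathC" and r: "0 < r"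
    and g: "\<And>j. 0 \<le> g j" "\<And>j i. \<bar>inc j b i\<bar> \<le> g j * exp (r * (real i / 2 ^ j))"
    and S: "\<And>n. (\<Sum>j\<le>n. g j) \<le> S" and t: "0 \<le> t"
  shows "\<bar>b t\<bar> \<le> (1 / (exp r - 1) + 1) * S * exp (r * t)"
proof -
  \<comment> \<open>This constant sums the increments over unit steps: the sum of exp(r i) over i <
    k is at most c exp(r k). The relation c exp(r) = c + 1 carries the induction.\<close>
  define c where "c = 1 / (exp r - 1)"
  have e1: "exp r > 1" using r by simp
  have c: "c * exp r = c + 1" "0 < c" using e1 by (auto simp: c_def field_simps)
  have l0: "\<bar>b (real k)\<bar> \<le> c * g 0 * exp (r * real k)" for k
  proof (induction k)
    case 0
    then show ?case using pathC_neg[OF b, of 0] g(1)[of 0] c by simp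
  next
    case (Suc k)
    have "\<bar>b (real (Suc k))\<bar> \<le> \<bar>b (real k)\<bar> + \<bar>inc 0 b k\<bar>" by simp
    also have "\<dots> \<le> c * g 0 * exp (r * real k) + g 0 * exp (r * real k)"
      using Suc.IH g(2)[where j=0 and i=k] by simp
    also have "\<dots> = (c + 1) * g 0 * exp (r * real k)" by (simp add: algebra_simps)
    also have "\<dots> = c * g 0 * exp (r * real (Suc k))"
      unfolding c(1)[symmetric] by (simp add: algebra_simps exp_add)
    finally show ?case .
  qed
  have ln: "\<bar>b (real k / 2 ^ n)\<bar> \<le> (c * g 0 + (\<Sum>j<n. g (Suc j))) * exp (r * (real k / 2 ^ n))" for n k
  proof (induction n arbitrary: k)
    case 0
    then show ?case using l0[of k] by simp
  next
    case (Suc n)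
    let ?s = "c * g 0 + (\<Sum>j<n. g (Suc j))"
    \<comment> \<open>Even points belong to the coarser grid; an odd point lies one increment of the
      new level to the right of such a point.\<close>
    obtain k' where k': "k = 2 * k' \<or> k = Suc (2 * k')" by (metis even_two_times_div_two odd_two_times_div_two_succ Suc_eq_plus1)
    have eq: "real (2 * k') / 2 ^ Suc n = real k' / 2 ^ n" by simp
    have s0: "0 \<le> ?s" using c g by (intro add_nonneg_nonneg mult_nonneg_nonneg sum_nonneg) auto
    have "\<bar>b (real k / 2 ^ Suc n)\<bar> \<le> \<bar>b (real k' / 2 ^ n)\<bar> + (if k = 2 * k' then 0 else \<bar>inc (Suc n) b (2 * k')\<bar>)"
      using k' unfolding eq by auto
    also have "\<dots> \<le> ?s * exp (r * (real k' / 2 ^ n)) + g (Suc n) * exp (r * (real k' / 2 ^ n))"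
      using Suc.IH[of k'] g(1)[of "Suc n"] g(2)[where j="Suc n" and i="2 * k'"] unfolding eq by (intro add_mono) auto
    also have "\<dots> = (c * g 0 + (\<Sum>j<Suc n. g (Suc j))) * exp (r * (real k' / 2 ^ n))" by (simp add: algebra_simps)
    also have "\<dots> \<le> (c * g 0 + (\<Sum>j<Suc n. g (Suc j))) * exp (r * (real k / 2 ^ Suc n))"
    proof (intro mult_left_mono)
      have "real k' / 2 ^ n \<le> real k / 2 ^ Suc n"
        unfolding eq[symmetric] using k' by (intro divide_right_mono) auto
      then show "exp (r * (real k' / 2 ^ n)) \<le> exp (r * (real k / 2 ^ Suc n))"
        unfolding exp_le_cancel_iff using r by (intro mult_left_mono) auto
      show "0 \<le> c * g 0 + (\<Sum>j<Suc n. g (Suc j))" using s0 g(1)[of "Suc n"] by simp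
    qed
    finally show ?case .
  qed
  have S0: "0 \<le> S" using S[of 0] g(1)[of 0] by simp
  have "\<bar>b (real (nat \<lfloor>2 ^ n * t\<rfloor>) / 2 ^ n)\<bar> \<le> (c + 1) * S * exp (r * t)" for n
  proof -
    have "(\<Sum>j\<le>n. g j) = g 0 + (\<Sum>j<n. g (Suc j))"
      by (simp only: lessThan_Suc_atMost[symmetric] sum.lessThan_Suc_shift)
    moreover have "g 0 \<le> S" using S[of 0] by simp
    then have "c * g 0 \<le> c * S" using c by (intro mult_left_mono) auto
    ultimately have A: "c * g 0 + (\<Sum>j<n. g (Suc j)) \<le> (c + 1) * S" using S[of n] g(1)[of 0] by (simp add: algebra_simps)
    have "real (nat \<lfloor>2 ^ n * t\<rfloor>) / 2 ^ n \<le> t"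
    proof -
      have "real (nat \<lfloor>2 ^ n * t\<rfloor>) \<le> 2 ^ n * t" using t by simp
      then show ?thesis by (simp add: divide_le_eq mult.commute)
    qed
    then have "exp (r * (real (nat \<lfloor>2 ^ n * t\<rfloor>) / 2 ^ n)) \<le> exp (r * t)"
      unfolding exp_le_cancel_iff using r by (intro mult_left_mono) auto
    from mult_mono[OF A this] show ?thesis using S0 c
      by (intro order_trans[OF ln]) auto
  qed
  moreover have "(\<lambda>n. \<bar>b (real (nat \<lfloor>2 ^ n * t\<rfloor>) / 2 ^ n)\<bar>) \<longlonglongrightarrow> \<bar>b t\<bar>"
    by (intro tendsto_rabs isCont_tendsto_compose[OF pathC_cont[OF b] dyadic_below[OF t]])
  ultimately show ?thesis unfolding c_def[symmetric] by (intro LIMSEQ_le_const2) auto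
qed

text \<open>With x = r / 2^j the second bound gives at most (1 + 1/r) 2^j, the number of increments
  per unit of time up to a constant. It follows from 1 + x \<le> exp x.\<close>

lemma geometric_exp_sum:
  fixes x :: real assumes "0 < x"
  shows "(\<lambda>i. exp (- x * real i)) sums (1 / (1 - exp (- x)))" "1 / (1 - exp (- x)) \<le> 1 + 1 / x"
proof -
  have "(\<lambda>i. exp (- x) ^ i) sums (1 / (1 - exp (- x)))" using assms by (intro geometric_sums) auto
  then show "(\<lambda>i. exp (- x * real i)) sums (1 / (1 - exp (- x)))"
    by (simp add: exp_of_nat_mult[symmetric] mult.commute)
  have "(1 + x) * exp (- x) \<le> exp x * exp (- x)" using exp_ge_add_one_self[of x] by (intro mult_right_mono) auto
  then have "x \<le> (1 + x) * (1 - exp (- x))" by (simp add: exp_minus algebra_simps)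
  then show "1 / (1 - exp (- x)) \<le> 1 + 1 / x" using assms by (simp add: field_simps)
qed

context bm
begin

text \<open>Second moments would not do for the chaining: 2^j increments of variance 2^-j sum to 1
  on every level, whereas fourth moments sum to 3 / 2^j.\<close>

lemma increment_fourth_moment: "(\<integral>\<^sup>+w. ennreal (inc j (\<beta> w) i ^ 4) \<partial>M) = ennreal (3 / 4 ^ j)"
proof -
  have "(\<integral>\<^sup>+w. ennreal (inc j (\<beta> w) i ^ 4) \<partial>M) = (\<integral>\<^sup>+x. ennreal (x ^ 4) \<partial>distr M borel (\<lambda>w. inc j (\<beta> w) i))"
    using inc_measurable by (subst nn_integral_distr) auto
  also have "\<dots> = (\<integral>\<^sup>+x. ennreal (normal_density 0 (sqrt (1 / 2 ^ j)) x * x ^ 4) \<partial>lborel)"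
    unfolding inc_law1 by (subst nn_integral_density) (auto simp: ennreal_mult')
  also have "\<dots> = ennreal (3 / 4 ^ j)"
  proof -
    have "has_bochner_integral lborel (\<lambda>x. normal_density 0 (sqrt (1 / 2 ^ j)) x * (x - 0) ^ (2 * 2))
       (fact (2 * 2) / ((2 / (sqrt (1 / 2 ^ j))\<^sup>2) ^ 2 * fact 2))"
      by (rule normal_moment_even) simp
    moreover have "fact (2 * 2) / ((2 / (sqrt (1 / 2 ^ j))\<^sup>2) ^ 2 * fact 2) = (3 / 4 ^ j :: real)"
    proof -
      have "(4::real) ^ j = 2 ^ j * 2 ^ j" by (simp flip: power_mult_distrib)
      then show ?thesis by (simp add: fact_numeral power2_eq_square)
    qed
    ultimately have "has_bochner_integral lborel (\<lambda>x. normal_density 0 (sqrt (1 / 2 ^ j)) x * x ^ 4) (3 / 4 ^ j)" by simp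
    then show ?thesis
      by (subst nn_integral_eq_integral) (auto simp: has_bochner_integral_iff intro!: AE_I2 mult_nonneg_nonneg)
  qed
  finally show ?thesis .
qed

text \<open>Since \<open>\<bar>d\<bar> \<le> q\<^sup>j + d\<^sup>4 / q\<^bsup>3j\<^esup>\<close> for every \<open>q > 0\<close>, fourth moments \<open>3 / 4\<^sup>j\<close> of the \<open>2\<^sup>j\<close> increments per unit
  of time suffice as soon as \<open>q < 1 < 2 q\<^sup>3\<close>; here \<open>q = 9/10\<close>.\<close>
definition chain_weight :: "real \<Rightarrow> nat \<Rightarrow> 'a \<Rightarrow> ennreal" where
  "chain_weight r j w = ennreal ((9/10) ^ j) +
     (\<Sum>i. ennreal ((10/9) ^ (3 * j) * exp (- (r / 2 ^ j) * real i)) * ennreal (inc j (\<beta> w) i ^ 4))"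

lemma chain_weight_measurable [measurable]: "chain_weight r j \<in> borel_measurable M"
  unfolding chain_weight_def[abs_def]
  by (intro borel_measurable_add borel_measurable_const borel_measurable_suminf_order borel_measurable_times_ennreal
      measurable_compose[OF _ measurable_ennreal] borel_measurable_power inc_measurable)

lemma chain_weight_expectation:
  assumes r: "0 < r"
  shows "(\<integral>\<^sup>+w. chain_weight r j w \<partial>M) \<le> ennreal ((9/10) ^ j + 3 * (1 + 1 / r) * (500/729) ^ j)"
proof -
  let ?k = "\<lambda>i. (10/9) ^ (3 * j) * exp (- (r / 2 ^ j) * real i) :: real"
  have m: "(\<lambda>w. ennreal (inc j (\<beta> w) i ^ 4)) \<in> borel_measurable M" for i
    by (intro measurable_compose[OF _ measurable_ennreal] borel_measurable_power inc_measurable)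
  have "(\<integral>\<^sup>+w. chain_weight r j w \<partial>M) = ennreal ((9/10) ^ j) +
     (\<integral>\<^sup>+w. (\<Sum>i. ennreal (?k i) * ennreal (inc j (\<beta> w) i ^ 4)) \<partial>M)"
    unfolding chain_weight_def using m
    by (subst nn_integral_add) (auto simp: emeasure_space_1 intro!: borel_measurable_suminf_order)
  also have "(\<integral>\<^sup>+w. (\<Sum>i. ennreal (?k i) * ennreal (inc j (\<beta> w) i ^ 4)) \<partial>M) =
      (\<Sum>i. ennreal (?k i) * ennreal (3 / 4 ^ j))"
  proof -
    have "(\<integral>\<^sup>+w. ennreal (?k i) * ennreal (inc j (\<beta> w) i ^ 4) \<partial>M) = ennreal (?k i) * ennreal (3 / 4 ^ j)" for i
      by (subst nn_integral_cmult[OF m]) (simp only: increment_fourth_moment)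
    then show ?thesis
      by (subst nn_integral_suminf) (intro borel_measurable_times_ennreal borel_measurable_const m, simp only:)
  qed
  also have "\<dots> = (\<Sum>i. ennreal ((10/9) ^ (3 * j) * (3 / 4 ^ j) * exp (- (r / 2 ^ j) * real i)))"
    by (intro suminf_cong) (simp add: ennreal_mult'[symmetric] mult_ac)
  also have "\<dots> = ennreal ((10/9) ^ (3 * j) * (3 / 4 ^ j) * (1 / (1 - exp (- (r / 2 ^ j)))))"
    using r by (intro suminf_ennreal_eq sums_mult geometric_exp_sum) auto
  also have "ennreal ((9/10) ^ j) + \<dots> \<le> ennreal ((9/10) ^ j + 3 * (1 + 1 / r) * (500/729) ^ j)"
  proof -
    have "(10/9) ^ (3 * j) * (3 / 4 ^ j) * (1 / (1 - exp (- (r / 2 ^ j)))) \<le> (10/9) ^ (3 * j) * (3 / 4 ^ j) * (1 + 1 / (r / 2 ^ j))"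
      using r by (intro mult_left_mono geometric_exp_sum) auto
    also have "\<dots> \<le> (10/9) ^ (3 * j) * (3 / 4 ^ j) * ((1 + 1 / r) * 2 ^ j)"
      using r by (intro mult_left_mono) (auto simp: field_simps)
    \<comment> \<open>Per level: (10/9)^3 = 1000/729 from the weight, 2 from the number of
      increments, 1/4 from the fourth moment. The ratio 500/729 is below 1, so the levels can be
      summed.\<close>
    also have "\<dots> = 3 * (1 + 1 / r) * (500/729) ^ j"
    proof -
      have "((10/9) ^ (3 * j) :: real) = (1000/729) ^ j" by (simp add: power_mult power3_eq_cube)
      moreover have "(4::real) ^ j = 2 ^ j * 2 ^ j" by (simp flip: power_mult_distrib)
      moreover have "(500/729 :: real) ^ j = (1000/729) ^ j / 2 ^ j" by (simp flip: power_divide)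
      ultimately show ?thesis by simp
    qed
    finally have le: "(10/9) ^ (3 * j) * (3 / 4 ^ j) * (1 / (1 - exp (- (r / 2 ^ j)))) \<le> 3 * (1 + 1 / r) * (500/729) ^ j" .
    have "0 \<le> (10/9) ^ (3 * j) * (3 / 4 ^ j) * (1 / (1 - exp (- (r / 2 ^ j))))" using r by simp
    then have "ennreal ((9/10) ^ j) + ennreal ((10/9) ^ (3 * j) * (3 / 4 ^ j) * (1 / (1 - exp (- (r / 2 ^ j))))) =
       ennreal ((9/10) ^ j + (10/9) ^ (3 * j) * (3 / 4 ^ j) * (1 / (1 - exp (- (r / 2 ^ j)))))"
      by (intro ennreal_plus[symmetric]) auto
    also have "\<dots> \<le> ennreal ((9/10) ^ j + 3 * (1 + 1 / r) * (500/729) ^ j)" using le by (intro ennreal_leI) simp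
    finally show ?thesis .
  qed
  finally show ?thesis .
qed

text \<open>The expectations of the chain weights form a convergent series, so their sum is
  integrable; \<open>dyadic_chain\<close> turns it into a bound for all times. Any positive rate is
  possible, at the price of a larger \<open>R\<close>.\<close>

lemma path_growth:
  assumes r: "0 < r"
  shows "\<exists>R. integrable M R \<and> (\<forall>w. 0 \<le> R w) \<and> (AE w in M. \<forall>t\<ge>0. \<bar>\<beta> w t\<bar> \<le> R w * exp (r * t))"
proof -
  define G where "G w = (\<Sum>j. chain_weight r j w)" for w
  have Gm [measurable]: "G \<in> borel_measurable M" unfolding G_def[abs_def] by measurable
  have sm: "summable (\<lambda>j. (9/10) ^ j + 3 * (1 + 1 / r) * (500/729) ^ j :: real)"
    by (intro summable_add summable_mult summable_geometric) auto
  have "(\<integral>\<^sup>+w. G w \<partial>M) = (\<Sum>j. \<integral>\<^sup>+w. chain_weight r j w \<partial>M)"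
    unfolding G_def by (rule nn_integral_suminf) measurable
  also have "\<dots> \<le> (\<Sum>j. ennreal ((9/10) ^ j + 3 * (1 + 1 / r) * (500/729) ^ j))"
    by (intro suminf_le chain_weight_expectation r) auto
  also have "\<dots> = ennreal (\<Sum>j. (9/10) ^ j + 3 * (1 + 1 / r) * (500/729) ^ j)"
    using r by (intro suminf_ennreal2 sm) auto
  also have "\<dots> < \<infinity>" by simp
  finally have fin: "(\<integral>\<^sup>+w. G w \<partial>M) < \<infinity>" .
  have AEfin: "AE w in M. G w \<noteq> \<infinity>" using fin by (intro nn_integral_PInf_AE) auto
  define R where "R w = (1 / (exp r - 1) + 1) * enn2real (G w)" for w
  have int: "integrable M (\<lambda>w. enn2real (G w))"
  proof (rule integrableI_bounded)
    have "(\<integral>\<^sup>+w. ennreal (norm (enn2real (G w))) \<partial>M) \<le> (\<integral>\<^sup>+w. G w \<partial>M)"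
      by (intro nn_integral_mono) (simp add: ennreal_enn2real_if)
    then show "(\<integral>\<^sup>+w. ennreal (norm (enn2real (G w))) \<partial>M) < \<infinity>" using fin by (rule le_less_trans)
  qed measurable
  have "integrable M R" unfolding R_def[abs_def] by (intro integrable_mult_right int)
  moreover have "0 \<le> R w" for w using r by (simp add: R_def)
  moreover have "AE w in M. \<forall>t\<ge>0. \<bar>\<beta> w t\<bar> \<le> R w * exp (r * t)"
    using AEfin
  proof eventually_elim
    case (elim w)
    let ?w = "\<lambda>j. enn2real (chain_weight r j w)"
    have le: "(\<Sum>j\<le>n. chain_weight r j w) \<le> G w" for n
      unfolding G_def by (intro sum_le_suminf) auto
    have wfin: "chain_weight r j w \<noteq> \<infinity>" for j
    proof -
      have "chain_weight r j w \<le> (\<Sum>i\<le>j. chain_weight r i w)" by (rule member_le_sum) auto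
      then have "chain_weight r j w \<le> G w" using le[of j] by (rule order_trans)
      then show ?thesis using elim neq_top_trans by auto
    qed
    then have w: "chain_weight r j w = ennreal (?w j)" for j by (simp add: less_top[symmetric])
    have sum: "(\<Sum>j\<le>n. ?w j) \<le> enn2real (G w)" for n
    proof -
      have "ennreal (\<Sum>j\<le>n. ?w j) = (\<Sum>j\<le>n. ennreal (?w j))" by (rule sum_ennreal[symmetric]) auto
      also have "\<dots> = (\<Sum>j\<le>n. chain_weight r j w)" by (rule sum.cong[OF refl w[symmetric]])
      also have "\<dots> \<le> G w" by (rule le)
      also have "G w = ennreal (enn2real (G w))" using elim by (simp add: less_top[symmetric])
      finally show ?thesis by (simp add: ennreal_le_iff)
    qed
    have ineq: "\<bar>inc j (\<beta> w) i\<bar> \<le> ?w j * exp (r * (real i / 2 ^ j))" for j i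
    proof -
      define d where "d = \<bar>inc j (\<beta> w) i\<bar>"
      define E where "E = exp (r * (real i / 2 ^ j))"
      define q where "q = (9/10 :: real) ^ j"
      have E: "1 \<le> E" "exp (- (r / 2 ^ j) * real i) = 1 / E" using r by (auto simp: E_def exp_minus field_simps)
      have q: "0 < q" "(10/9 :: real) ^ (3 * j) = 1 / q ^ 3"
        by (auto simp: q_def power_mult[symmetric] mult.commute power_divide)
      have d4: "inc j (\<beta> w) i ^ 4 = d ^ 4" by (simp add: d_def)
      define T where "T = (\<lambda>i. ennreal ((10/9) ^ (3 * j) * exp (- (r / 2 ^ j) * real i)) * ennreal (inc j (\<beta> w) i ^ 4))"
      have T: "T i = ennreal (1 / q ^ 3 * (1 / E) * d ^ 4)"
      proof -
        have "T i = ennreal (1 / q ^ 3 * (1 / E)) * ennreal (d ^ 4)" by (simp only: T_def d4 q(2) E(2))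
        also have "\<dots> = ennreal (1 / q ^ 3 * (1 / E) * d ^ 4)"
        proof (rule ennreal_mult'[symmetric])
          have "0 \<le> q ^ 3" "0 \<le> E" using q(1) E(1) by auto
          then show "0 \<le> 1 / q ^ 3 * (1 / E)" by (intro mult_nonneg_nonneg divide_nonneg_nonneg) auto
        qed
        finally show ?thesis .
      qed
      have "ennreal (q + 1 / q ^ 3 * (1 / E) * d ^ 4) = ennreal q + T i"
        unfolding T
      proof (rule ennreal_plus)
        have "0 \<le> q ^ 3" "0 \<le> E" "0 \<le> d" using q(1) E(1) by (auto simp: d_def)
        then show "0 \<le> 1 / q ^ 3 * (1 / E) * d ^ 4" by (intro mult_nonneg_nonneg divide_nonneg_nonneg) auto
      qed (use q in simp)
      also have "ennreal q + T i \<le> chain_weight r j w"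
        unfolding chain_weight_def q_def T_def[symmetric]
        using sum_le_suminf[of T "{i}"] by (intro add_left_mono) simp
      also have "chain_weight r j w = ennreal (?w j)" by (rule w)
      finally have *: "q + 1 / q ^ 3 * (1 / E) * d ^ 4 \<le> ?w j" by (simp add: ennreal_le_iff)
      \<comment> \<open>Either the first summand suffices, or q < d and then d q^3 \<le> d^4.
        Afterwards the factor \<open>E \<ge> 1\<close> enlarges the first summand and cancels the
        exponential weight in the second.\<close>
      have "d \<le> q + d ^ 4 / q ^ 3"
      proof (cases "d \<le> q")
        case True
        have "0 \<le> d ^ 4 / q ^ 3" using q by simp
        then show ?thesis using True by linarith
      next
        case False
        then have "d * q ^ 3 \<le> d * d ^ 3" using q by (intro mult_left_mono power_mono) auto
        also have "\<dots> = d ^ 4" by (simp add: power_numeral_reduce)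
        finally have "d \<le> d ^ 4 / q ^ 3" using q by (simp add: le_divide_eq)
        then show ?thesis using q by linarith
      qed
      also have "\<dots> \<le> q * E + d ^ 4 / q ^ 3" using q E by simp
      also have "\<dots> = (q + 1 / q ^ 3 * (1 / E) * d ^ 4) * E" using E by (simp add: field_simps)
      also have "\<dots> \<le> ?w j * E" using * E by (intro mult_right_mono) auto
      finally show ?thesis unfolding d_def E_def .
    qed
    show "\<forall>t\<ge>0. \<bar>\<beta> w t\<bar> \<le> R w * exp (r * t)"
      unfolding R_def
      by (intro allI impI dyadic_chain[OF bpath_pathC r _ ineq sum]) auto
  qed
  ultimately show ?thesis by blast
qed

end

section \<open>Controls as path functionals\<close>

lemma (in complete_measure) integral_cong_AE_complete:
  fixes f g :: "'a \<Rightarrow> real"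
  assumes f: "f \<in> borel_measurable M" and eq: "AE x in M. f x = g x"
  shows "integral\<^sup>L M f = integral\<^sup>L M g"
  using f borel_measurable_AE_eq[OF f eq] eq by (rule integral_cong_AE)

lemma (in complete_measure) integrable_cong_AE_complete:
  fixes f g :: "'a \<Rightarrow> real"
  assumes f: "integrable M f" and eq: "AE x in M. f x = g x"
  shows "integrable M g"
proof -
  have m: "f \<in> borel_measurable M" using f by auto
  show ?thesis using integrable_cong_AE[OF m borel_measurable_AE_eq[OF m eq] eq] f by simp
qed

context bm
begin

abbreviation "\<F> \<equiv> brownian_filtration M B"

lemma filtration_gen: "{B s -` A \<inter> space M | s A. 0 \<le> s \<and> ennreal s \<le> t \<and> A \<in> sets borel} \<union> null_sets M \<subseteq> Pow (space M)"
  using sets.sets_into_space by fastforce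

lemma space_filtration [simp]: "space (\<F> t) = space M"
  unfolding brownian_filtration_def by (rule space_measure_of[OF filtration_gen])

lemma sets_filtration: "sets (\<F> t) = sigma_sets (space M)
   ({B s -` A \<inter> space M | s A. 0 \<le> s \<and> ennreal s \<le> t \<and> A \<in> sets borel} \<union> null_sets M)"
  unfolding brownian_filtration_def by (rule sets_measure_of[OF filtration_gen])

lemma null_sets_filtration: "N \<in> null_sets M \<Longrightarrow> N \<in> sets (\<F> t)"
  unfolding sets_filtration by (rule sigma_sets.Basic) simp

lemma filtration_le: "sets (\<F> t) \<subseteq> sets M"
  unfolding sets_filtration
proof (rule sets.sigma_sets_subset)
  show "{B s -` A \<inter> space M | s A. 0 \<le> s \<and> ennreal s \<le> t \<and> A \<in> sets borel} \<union> null_sets M \<subseteq> sets M"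
    using measurable_sets[OF B_measurable] by auto
qed

lemma filtration_mono: assumes "s \<le> t" shows "sets (\<F> s) \<subseteq> sets (\<F> t)"
  unfolding sets_filtration by (rule sigma_sets_mono') (use assms order_trans in blast)

lemma measurable_filtration_mono: "s \<le> t \<Longrightarrow> f \<in> \<F> s \<rightarrow>\<^sub>M N \<Longrightarrow> f \<in> \<F> t \<rightarrow>\<^sub>M N"
  using filtration_mono[of s t] by (auto simp: measurable_def)

lemma measurable_filtration_le: "f \<in> \<F> t \<rightarrow>\<^sub>M N \<Longrightarrow> f \<in> M \<rightarrow>\<^sub>M N"
  using filtration_le[of t] by (auto simp: measurable_def)

text \<open>The exceptional set and all its subsets are null sets, hence members of the augmented
  filtration at every time.\<close>

lemma filtration_AE_eq:
  fixes f g :: "'a \<Rightarrow> real"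
  assumes f: "f \<in> borel_measurable (\<F> t)" and eq: "AE x in M. f x = g x"
  shows "g \<in> borel_measurable (\<F> t)"
proof (rule measurableI)
  fix A :: "real set" assume A: "A \<in> sets borel"
  let ?N = "{x \<in> space M. f x \<noteq> g x}"
  have N: "?N \<in> null_sets M" using eq by (simp add: AE_iff_null_sets)
  have "g -` A \<inter> space M = (f -` A \<inter> space (\<F> t) - ?N) \<union> (g -` A \<inter> ?N)" by auto
  moreover have "g -` A \<inter> ?N \<in> null_sets M" using complete2[OF _ N, of "g -` A \<inter> ?N"] by auto
  ultimately show "g -` A \<inter> space (\<F> t) \<in> sets (\<F> t)"
    using measurable_sets[OF f A] null_sets_filtration N by auto
qed simp

lemma bpath_eval_adapted:
  assumes "q \<le> u" "0 \<le> u" shows "(\<lambda>w. \<beta> w q) \<in> borel_measurable (\<F> (ennreal u))"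
proof (cases "0 \<le> q")
  case True
  have "B q \<in> borel_measurable (\<F> (ennreal u))"
  proof (rule measurableI)
    fix A :: "real set" assume "A \<in> sets borel"
    then show "B q -` A \<inter> space (\<F> (ennreal u)) \<in> sets (\<F> (ennreal u))"
      unfolding sets_filtration space_filtration using True assms ennreal_leI[OF assms(1)]
      by (intro sigma_sets.Basic) blast
  qed simp
  moreover have "AE w in M. B q w = \<beta> w q" using AE_bpath by eventually_elim (use True in auto)
  ultimately show ?thesis by (rule filtration_AE_eq)
next
  case False
  then have "(\<lambda>w. \<beta> w q) = (\<lambda>_. 0)" by (auto simp: bpath_def fun_eq_iff)
  then show ?thesis by simp
qed

lemma bpath_adapted: "0 \<le> u \<Longrightarrow> \<beta> \<in> \<F> (ennreal u) \<rightarrow>\<^sub>M paths {..u}"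
  by (intro measurable_pathsI bpath_pathC bpath_eval_adapted) auto

text \<open>Generators correspond to coordinate events and null sets to the empty event; complements
  and countable unions preserve agreement up to null sets. So augmentation adds nothing beyond null
  sets to the raw past of the path.\<close>

lemma filtration_path_event:
  assumes "E \<in> sets (\<F> (ennreal u))" and u: "0 \<le> u"
  shows "\<exists>H\<in>sets (paths {..u}). AE w in M. w \<in> E \<longleftrightarrow> \<beta> w \<in> H"
proof -
  from assms(1) have "E \<in> sigma_sets (space M)
    ({B s -` A \<inter> space M | s A. 0 \<le> s \<and> ennreal s \<le> ennreal u \<and> A \<in> sets borel} \<union> null_sets M)"
    by (simp add: sets_filtration)
  then show ?thesis
  proof induction
    case (Basic a)
    then consider s A where "a = B s -` A \<inter> space M" "0 \<le> s" "ennreal s \<le> ennreal u" "A \<in> sets borel"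
      | "a \<in> null_sets M" by blast
    then show ?case
    proof cases
      case 1
      have "s \<in> {..u}" using 1 u by (simp add: ennreal_le_iff)
      then have "(\<lambda>b. b s) -` A \<inter> space (paths {..u}) \<in> sets (paths {..u})"
        using 1(4) by (intro measurable_sets[OF measurable_path_eval])
      moreover have "AE w in M. w \<in> a \<longleftrightarrow> \<beta> w \<in> (\<lambda>b. b s) -` A \<inter> space (paths {..u})"
        using AE_bpath AE_space by eventually_elim (use 1 bpath_pathC in auto)
      ultimately show ?thesis by blast
    next
      case 2
      then have "AE w in M. w \<in> a \<longleftrightarrow> \<beta> w \<in> {}" using AE_not_in by auto
      then show ?thesis by blast
    qed
  next
    case Empty
    then show ?case by (intro bexI[of _ "{}"]) auto
  next
    case (Compl a)
    then obtain H where H: "H \<in> sets (paths {..u})" "AE w in M. w \<in> a \<longleftrightarrow> \<beta> w \<in> H" by blast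
    have "AE w in M. w \<in> space M - a \<longleftrightarrow> \<beta> w \<in> space (paths {..u}) - H"
      using H(2) AE_space by eventually_elim (use bpath_pathC in auto)
    then show ?case using sets.compl_sets[OF H(1)] by blast
  next
    case (Union a)
    then have "\<forall>i. \<exists>H. H \<in> sets (paths {..u}) \<and> (AE w in M. w \<in> a i \<longleftrightarrow> \<beta> w \<in> H)" by blast
    from choice[OF this] obtain H where H: "\<And>i. H i \<in> sets (paths {..u})" "\<And>i. AE w in M. w \<in> a i \<longleftrightarrow> \<beta> w \<in> H i" by blast
    have "AE w in M. \<forall>i. w \<in> a i \<longleftrightarrow> \<beta> w \<in> H i" using H(2) by (simp add: AE_all_countable)
    then have "AE w in M. w \<in> (\<Union>i. a i) \<longleftrightarrow> \<beta> w \<in> (\<Union>i. H i)" by eventually_elim auto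
    moreover have "(\<Union>i. H i) \<in> sets (paths {..u})" using H(1) by auto
    ultimately show ?case by blast
  qed
qed

end

text \<open>Rebuilds a control from the path events \<open>H q r\<close> that represent \<open>{\<nu>\<^sub>q > r}\<close> for rational \<open>q\<close> and \<open>r\<close>. The
  result is nondecreasing and left-continuous on every path, not only on almost every one.\<close>
definition level_sup :: "real \<Rightarrow> (rat \<Rightarrow> rat \<Rightarrow> (real \<Rightarrow> real) set) \<Rightarrow> real \<Rightarrow> (real \<Rightarrow> real) \<Rightarrow> real" where
  "level_sup p H u b = (SUP (q, r) \<in> {(q, r). 0 \<le> q \<and> 0 \<le> r \<and> of_rat r \<le> p}.
      if of_rat q < u \<and> b \<in> H q r then of_rat r else 0)"

context
  fixes p :: real and H :: "rat \<Rightarrow> rat \<Rightarrow> (real \<Rightarrow> real) set"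
  assumes p: "0 \<le> p"
begin

private abbreviation (input) "I \<equiv> {(q, r). 0 \<le> q \<and> 0 \<le> r \<and> of_rat r \<le> p} :: (rat \<times> rat) set"
private abbreviation (input) "f u b \<equiv> \<lambda>(q, r). if of_rat q < u \<and> b \<in> H q r then of_rat r else (0::real)"

lemma level_bdd: "bdd_above (f u b ` I)"
  using p by (intro bdd_aboveI[of _ p]) auto

lemma level_nonempty: "I \<noteq> {}"
  using p by (auto intro!: exI[of _ 0])

lemma level_sup_ge: "0 \<le> q \<Longrightarrow> 0 \<le> r \<Longrightarrow> of_rat r \<le> p \<Longrightarrow> of_rat q < u \<Longrightarrow> b \<in> H q r \<Longrightarrow> of_rat r \<le> level_sup p H u b"
  unfolding level_sup_def using cSUP_upper[OF _ level_bdd, of "(q, r)" u b] by auto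

lemma level_sup_nonneg: "0 \<le> level_sup p H u b"
  unfolding level_sup_def using p by (intro cSUP_upper2[OF level_bdd, of "(0, 0)"]) auto

lemma level_sup_least:
  assumes "0 \<le> z" "\<And>q r. 0 \<le> q \<Longrightarrow> 0 \<le> r \<Longrightarrow> of_rat r \<le> p \<Longrightarrow> of_rat q < u \<Longrightarrow> b \<in> H q r \<Longrightarrow> of_rat r \<le> z"
  shows "level_sup p H u b \<le> z"
  unfolding level_sup_def using assms by (intro cSUP_least level_nonempty) auto

lemma level_sup_less:
  assumes "0 \<le> z" "z < level_sup p H u b"
  shows "\<exists>q r. 0 \<le> q \<and> 0 \<le> r \<and> of_rat r \<le> p \<and> of_rat q < u \<and> b \<in> H q r \<and> z < of_rat r"
  using level_sup_least[OF assms(1), of u b] assms(2) by force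

lemma cpath_level_sup: "cpath p (\<lambda>u. level_sup p H u b)"
  unfolding cpath_def
proof (intro conjI allI impI)
  have mono: "level_sup p H u b \<le> level_sup p H v b" if "u \<le> v" for u v
    using that by (intro level_sup_least level_sup_nonneg level_sup_ge) auto
  then show "mono (\<lambda>u. level_sup p H u b)" by (auto simp: mono_def)
  show "level_sup p H u b = 0" if "u \<le> 0" for u
  proof (intro antisym level_sup_nonneg level_sup_least)
    fix q r :: rat assume "0 \<le> q" "of_rat q < u"
    moreover from this have "0 \<le> (of_rat q :: real)" by simp
    ultimately show "of_rat r \<le> (0::real)" using that by linarith
  qed simp
  show "level_sup p H u b \<le> p" for u using p by (intro level_sup_least)
  show "continuous (at_left u) (\<lambda>u. level_sup p H u b)" for u
    unfolding continuous_within
  proof (rule order_tendstoI)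
    fix a assume a: "a < level_sup p H u b"
    show "\<forall>\<^sub>F v in at_left u. a < level_sup p H v b"
    proof (cases "a < 0")
      case True
      then have "a < level_sup p H v b" for v using level_sup_nonneg[of v b] by linarith
      then show ?thesis by simp
    next
      case False
      then obtain q r where qr: "0 \<le> q" "0 \<le> r" "of_rat r \<le> p" "of_rat q < u" "b \<in> H q r" "a < of_rat r"
        using level_sup_less[of a u b] a by auto
      \<comment> \<open>Here the strict inequality \<open>of_rat q < u\<close> in
        \<open>level_sup\<close> pays off: the same pair still contributes at every \<open>v\<close>
        between \<open>q\<close> and \<open>u\<close>.\<close>
      show ?thesis using eventually_at_left_real[OF qr(4)]
      proof eventually_elim
        case (elim v)
        then show ?case using level_sup_ge[of q r v b] qr by auto
      qed
    qed
  next
    fix a assume a: "level_sup p H u b < a"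
    show "\<forall>\<^sub>F v in at_left u. level_sup p H v b < a"
      unfolding eventually_at_left_field
    proof (intro exI[of _ "u - 1"] conjI allI impI)
      fix v assume "v < u"
      then show "level_sup p H v b < a" by (intro le_less_trans[OF mono a]) simp
    qed simp
  qed
qed

text \<open>At time \<open>u\<close> only events \<open>H q r\<close> with \<open>q < u\<close> are
  consulted, all of them known by then, and rational indices keep the supremum countable.\<close>

lemma adm_level_sup:
  assumes H: "\<And>q r. 0 \<le> q \<Longrightarrow> H q r \<in> sets (paths {..of_rat q})"
  shows "adm p (level_sup p H)"
  unfolding adm_def
proof (intro conjI allI ballI cpath_level_sup)
  fix u :: real
  show "level_sup p H u \<in> borel_measurable (paths {..u})"
    unfolding level_sup_def[abs_def]
  proof (rule borel_measurable_cSUP[OF _ _ level_bdd])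
    show "countable I" by (rule countableI_type)
    fix i assume "i \<in> I"
    then obtain q r where i: "i = (q, r)" "0 \<le> q" by auto
    show "(\<lambda>b. f u b i) \<in> borel_measurable (paths {..u})"
    proof (cases "of_rat q < u")
      case True
      then have "H q r \<in> sets (paths {..u})"
        using H[OF i(2)] sets_paths_mono[of "{..of_rat q}" "{..u}"] by auto
      then show ?thesis using True unfolding i by (simp add: measurable_If_set)
    qed (simp add: i)
  qed
qed

end

context bm
begin

text \<open>Events for rational times and levels suffice, so one null set serves all times at once.
  Where \<tau> is infinite a control may be positive at time 0, where a \<open>cpath\<close>
  vanishes; the cost is 0 there and nothing is claimed.\<close>

lemma control_representation:
  assumes nu: "\<nu> \<in> controls M B c \<tau>" and c: "0 \<le> c" "c \<le> 1"
  shows "\<exists>K. adm (1 - c) K \<and> (AE w in M. \<tau> w < \<infinity> \<longrightarrow> (\<forall>t\<ge>0. \<nu> t w = K t (\<beta> w)))"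
proof -
  let ?p = "1 - c"
  have p: "0 \<le> ?p" using c by simp
  define E where "E q r = {w \<in> space M. of_rat r < \<nu> (of_rat q) w}" for q r :: rat
  have "\<exists>H\<in>sets (paths {..of_rat q}). AE w in M. w \<in> E q r \<longleftrightarrow> \<beta> w \<in> H" if "0 \<le> q" for q r
  proof (rule filtration_path_event)
    have "\<nu> (of_rat q) \<in> borel_measurable (\<F> (ennreal (of_rat q)))"
      using nu that by (auto simp: controls_def adapted_def)
    then have "{w \<in> space (\<F> (ennreal (of_rat q))). of_rat r < \<nu> (of_rat q) w} \<in> sets (\<F> (ennreal (of_rat q)))"
      by measurable
    then show "E q r \<in> sets (\<F> (ennreal (of_rat q)))" by (simp add: E_def)
  qed (use that in simp)
  then have "\<forall>z. \<exists>H. 0 \<le> fst z \<longrightarrow> H \<in> sets (paths {..of_rat (fst z)}) \<and> (AE w in M. w \<in> E (fst z) (snd z) \<longleftrightarrow> \<beta> w \<in> H)"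
    by blast
  from choice[OF this] obtain G where
    G: "\<And>z. 0 \<le> fst z \<Longrightarrow> G z \<in> sets (paths {..of_rat (fst z)}) \<and> (AE w in M. w \<in> E (fst z) (snd z) \<longleftrightarrow> \<beta> w \<in> G z)"
    by blast
  define H where "H q r = G (q, r)" for q r
  have H: "H q r \<in> sets (paths {..of_rat q})" "AE w in M. w \<in> E q r \<longleftrightarrow> \<beta> w \<in> H q r" if "0 \<le> q" for q r
    using G[of "(q, r)"] that by (auto simp: H_def)
  have HE: "AE w in M. \<forall>q r. 0 \<le> q \<longrightarrow> (w \<in> E q r \<longleftrightarrow> \<beta> w \<in> H q r)"
    unfolding AE_all_countable using H(2) by auto
  have props: "AE w in M. mono_on {0..} (\<lambda>t. \<nu> t w) \<and>
            (\<forall>t>0. continuous (at_left t) (\<lambda>s. \<nu> s w)) \<and>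
            (\<forall>t\<ge>0. c + \<nu> t w \<le> 1) \<and>
            (\<tau> w < \<infinity> \<longrightarrow> \<nu> (enn2real (\<tau> w)) w = 0)"
    and pos: "\<And>w t. w \<in> space M \<Longrightarrow> 0 \<le> t \<Longrightarrow> 0 \<le> \<nu> t w"
    using nu by (auto simp: controls_def)
  have "AE w in M. \<tau> w < \<infinity> \<longrightarrow> (\<forall>t\<ge>0. \<nu> t w = level_sup ?p H t (\<beta> w))"
    using props HE AE_space
  proof eventually_elim
    case (elim w)
    have mono: "\<nu> s w \<le> \<nu> t w" if "0 \<le> s" "s \<le> t" for s t
      using elim(1) that by (auto simp: mono_on_def)
    show ?case
    proof (intro impI allI)
      fix t :: real assume tau: "\<tau> w < \<infinity>" and t: "0 \<le> t"
      show "\<nu> t w = level_sup ?p H t (\<beta> w)"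
      proof (cases "t = 0")
        case True
        \<comment> \<open>Monotonicity carries the zero at time \<tau> down to time 0, in accordance
          with \<open>cpath\<close>.\<close>
        have "\<nu> 0 w \<le> \<nu> (enn2real (\<tau> w)) w" by (intro mono) auto
        then have "\<nu> 0 w = 0" using elim(1) tau pos[OF elim(3), of 0] by auto
        then show ?thesis using cpath_level_sup[OF p, of H "\<beta> w"] True by (auto simp: cpath_def)
      next
        case False
        then have t: "0 < t" using t by simp
        show ?thesis
        proof (rule antisym)
          show "level_sup ?p H t (\<beta> w) \<le> \<nu> t w"
          proof (rule level_sup_least[OF p])
            fix q r :: rat assume q: "0 \<le> q" "of_rat q < t" "\<beta> w \<in> H q r"
            then have "w \<in> E q r" using elim(2) by auto
            then have "of_rat r < \<nu> (of_rat q) w" by (simp add: E_def)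
            also have "\<dots> \<le> \<nu> t w" using q by (intro mono) auto
            finally show "of_rat r \<le> \<nu> t w" by simp
          qed (use pos elim t in auto)
          show "\<nu> t w \<le> level_sup ?p H t (\<beta> w)"
          proof (rule ccontr)
            assume "\<not> ?thesis"
            \<comment> \<open>Left-continuity of \<nu> keeps it above the supremum at some rational
              q < t. A rational level squeezed in between is then a member of the family that
              exceeds its supremum.\<close>
            then have lt: "level_sup ?p H t (\<beta> w) < \<nu> t w" by simp
            have "((\<lambda>s. \<nu> s w) \<longlongrightarrow> \<nu> t w) (at_left t)" using elim(1) t by (auto simp: continuous_within)
            from order_tendstoD(1)[OF this lt] obtain a where a: "a < t" "\<And>s. a < s \<Longrightarrow> s < t \<Longrightarrow> level_sup ?p H t (\<beta> w) < \<nu> s w"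
              unfolding eventually_at_left_field by auto
            obtain q where q: "max a 0 < of_rat q" "of_rat q < t" using of_rat_dense[of "max a 0" t] a t by auto
            have q0: "0 \<le> q" using q by (simp add: less_imp_le)
            obtain r where r: "level_sup ?p H t (\<beta> w) < of_rat r" "of_rat r < \<nu> (of_rat q) w"
              using of_rat_dense[OF a(2)[of "of_rat q"]] q by auto
            have "0 < (of_rat r :: real)" using r(1) level_sup_nonneg[OF p, of H t "\<beta> w"] by linarith
            then have r0: "0 \<le> r" by simp
            have "w \<in> E q r" using r elim by (auto simp: E_def)
            then have "\<beta> w \<in> H q r" using elim(2) q0 by auto
            moreover have "c + \<nu> (of_rat q) w \<le> 1" using elim(1) q0 by auto
            ultimately have "of_rat r \<le> level_sup ?p H t (\<beta> w)"
              using r q q0 r0 by (intro level_sup_ge[OF p]) auto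
            then show False using r by simp
          qed
        qed
      qed
    qed
  qed
  moreover have "adm ?p (level_sup ?p H)" using adm_level_sup[OF p] H(1) by auto
  ultimately show ?thesis by blast
qed

lemma OU_strong_solution_ou:
  assumes "OU_strong_solution M B \<theta> \<mu> \<sigma> x Y"
  shows "AE w in M. \<forall>t\<ge>0. Y t w = ou \<theta> \<mu> \<sigma> x (\<beta> w) t"
proof -
  have "AE w in M. continuous_on {0..} (\<lambda>t. Y t w)"
    "AE w in M. \<forall>t\<ge>0. Y t w = x + (LBINT s:{0..t}. \<theta> * (\<mu> - Y s w)) + \<sigma> * (B t w - B 0 w)"
    using assms by (auto simp: OU_strong_solution_def)
  then show ?thesis using AE_bpath
  proof eventually_elim
    case (elim w)
    have "B 0 w = 0" using elim(3) pathC_neg[OF bpath_pathC, of 0 B w] by force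
    then have "Y t w = x + (LBINT s:{0..t}. \<theta> * (\<mu> - Y s w)) + \<sigma> * \<beta> w t" if "0 \<le> t" for t
      using elim(2,3) that by simp
    then show ?case
      by (intro allI impI ou_unique[OF bpath_pathC elim(1)])
  qed
qed

end

section \<open>The control problem on path space\<close>

locale ou_problem = bm M B for M :: "'a measure" and B :: "real \<Rightarrow> 'a \<Rightarrow> real" +
  fixes X :: "real \<Rightarrow> real \<Rightarrow> 'a \<Rightarrow> real" and \<Phi> :: "real \<Rightarrow> real" and \<theta> \<mu> \<sigma> lam F c :: real
  assumes \<theta>: "0 < \<theta>" and \<mu>: "0 < \<mu>" and \<sigma>: "0 < \<sigma>" and lam: "0 < lam"
    and X: "\<And>x. OU_strong_solution M B \<theta> \<mu> \<sigma> x (X x)"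
    and Phi: "\<Phi> \<in> borel_measurable borel"
    and Phi_bound: "\<forall>z\<in>{0..1}. \<bar>\<Phi> z\<bar> \<le> F"
    and c: "0 \<le> c" "c \<le> 1"
begin

abbreviation "pc \<equiv> pcost lam \<Phi> c"
abbreviation "p \<equiv> 1 - c"
abbreviation "oup \<equiv> ou \<theta> \<mu> \<sigma>"

lemma cp: "c + p \<le> 1" "0 \<le> p" "p \<le> 1" using c by auto

lemma F_ge_0: "0 \<le> F"
proof -
  have "\<bar>\<Phi> 0\<bar> \<le> F" using Phi_bound by auto
  then show ?thesis by linarith
qed

lemmas pc_bound = pcost_bound[OF lam Phi c(1) cp(1) Phi_bound]
lemmas pc_diff = pcost_diff[OF lam Phi c(1) cp(1) Phi_bound]
lemmas pc_measurable = pcost_measurable[OF lam Phi c(1) cp(1) Phi_bound]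
lemmas pc_shift = pcost_shift[OF lam Phi c(1) cp(1) Phi_bound]
lemmas pc_delay_tendsto = pcost_delay_tendsto[OF lam Phi c(1) cp(1) Phi_bound]

text \<open>The rate \<open>lam / 2\<close> is the growth that \<open>exp_half_bound\<close> can
  absorb.\<close>

definition R :: "'a \<Rightarrow> real" where
  "R = (SOME R. integrable M R \<and> (\<forall>w. 0 \<le> R w) \<and> (AE w in M. \<forall>t\<ge>0. \<bar>\<beta> w t\<bar> \<le> R w * exp (lam / 2 * t)))"

lemma R: "integrable M R" "0 \<le> R w" "AE w in M. \<forall>t\<ge>0. \<bar>\<beta> w t\<bar> \<le> R w * exp (lam / 2 * t)"
  using someI_ex[OF path_growth[of "lam / 2"]] lam unfolding R_def[symmetric] by auto

text \<open>The constant of \<open>ou_bound\<close>. It is affine in the modulus of the initial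
  value and integrable, and it majorizes costs and payoffs for all controls and entry times
  simultaneously.\<close>

definition D :: "real \<Rightarrow> 'a \<Rightarrow> real" where
  "D x w = \<bar>x\<bar> + \<mu> + 2 * \<sigma> * R w"

lemma D_integrable: "integrable M (D x)"
  unfolding D_def[abs_def] by (intro Bochner_Integration.integrable_add integrable_const integrable_mult_right R)

lemma D_ge_0: "0 \<le> D x w"
  using R(2)[of w] \<mu> \<sigma> by (simp add: D_def)

definition D0 :: real where
  "D0 = (\<integral>w. D 0 w \<partial>M)"

lemma D0_ge_0: "0 \<le> D0"
  unfolding D0_def by (intro integral_nonneg_AE AE_I2 D_ge_0)

lemma D_expectation: "(\<integral>w. D x w \<partial>M) = \<bar>x\<bar> + D0"
proof -
  have "(\<integral>w. D x w \<partial>M) = (\<integral>w. \<bar>x\<bar> + D 0 w \<partial>M)" by (simp add: D_def add.assoc)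
  also have "\<dots> = \<bar>x\<bar> + D0"
    using D_integrable by (subst Bochner_Integration.integral_add) (auto simp: prob_space D0_def)
  finally show ?thesis .
qed

lemma dominator_integrable: "integrable M (\<lambda>w. (1 + 2 * F) * (D x w + a))"
  by (intro integrable_mult_right Bochner_Integration.integrable_add D_integrable integrable_const)

lemma dominated:
  assumes f: "f \<in> borel_measurable M" and b: "AE w in M. \<bar>f w\<bar> \<le> (1 + 2 * F) * (D x w + a)"
  shows "integrable M f" "\<bar>integral\<^sup>L M f\<bar> \<le> (1 + 2 * F) * (\<bar>x\<bar> + D0 + a)"
proof -
  show i: "integrable M f"
  proof (rule Bochner_Integration.integrable_bound[OF dominator_integrable f])
    show "AE w in M. norm (f w) \<le> norm ((1 + 2 * F) * (D x w + a))"
      using b by eventually_elim (simp add: order_trans[OF _ abs_ge_self])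
  qed
  have "\<bar>integral\<^sup>L M f\<bar> \<le> (\<integral>w. \<bar>f w\<bar> \<partial>M)" by (rule integral_abs_bound)
  also have "\<dots> \<le> (\<integral>w. (1 + 2 * F) * (D x w + a) \<partial>M)"
    by (rule integral_mono_AE[OF integrable_abs[OF i] dominator_integrable b])
  also have "\<dots> = (1 + 2 * F) * (\<bar>x\<bar> + D0 + a)"
    using D_integrable[of x] D_expectation[of x] by (simp add: prob_space)
  finally show "\<bar>integral\<^sup>L M f\<bar> \<le> (1 + 2 * F) * (\<bar>x\<bar> + D0 + a)" .
qed

lemma ou_growth: "AE w in M. \<forall>x. \<forall>t\<ge>0. \<bar>oup x (\<beta> w) t\<bar> \<le> D x w * exp (lam / 2 * t)"
  using R(3)
proof eventually_elim
  case (elim w)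
  show ?case unfolding D_def
    using elim R(2) lam by (intro allI impI ou_bound[OF bpath_pathC _ _ _ \<theta> \<mu> \<sigma>]) auto
qed

lemma X_eq: "AE w in M. \<forall>t\<ge>0. X x t w = oup x (\<beta> w) t"
  using X by (rule OU_strong_solution_ou)

lemma ou_borel: "b \<in> pathC \<Longrightarrow> oup x b \<in> borel_measurable borel"
  by (intro borel_measurable_continuous_onI continuous_at_imp_continuous_on ballI isCont_ou)

lemma measurable_oup_bpath [measurable]: "(\<lambda>(t, w). oup x (\<beta> w) t) \<in> borel_measurable (borel \<Otimes>\<^sub>M M)"
proof -
  have "(\<lambda>z. (fst z, \<beta> (snd z))) \<in> borel \<Otimes>\<^sub>M M \<rightarrow>\<^sub>M borel \<Otimes>\<^sub>M PP" by measurable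
  from measurable_compose[OF this measurable_ou_joint] show ?thesis by (simp add: case_prod_beta)
qed

lemma measurable_oup_time:
  assumes [measurable]: "T \<in> borel_measurable M" shows "(\<lambda>w. oup x (\<beta> w) (T w)) \<in> borel_measurable M"
proof -
  have "(\<lambda>w. (T w, w)) \<in> M \<rightarrow>\<^sub>M borel \<Otimes>\<^sub>M M" by measurable
  from measurable_compose[OF this measurable_oup_bpath] show ?thesis by simp
qed

lemma cost_measurable:
  assumes g: "\<And>t. g t \<in> borel_measurable M" "\<And>w. cpath p (\<lambda>t. g t w)" and T: "T \<in> borel_measurable M"
  shows "(\<lambda>w. pc (T w) (oup x (\<beta> w)) (\<lambda>t. g t w)) \<in> borel_measurable M"
  by (rule pc_measurable[OF measurable_oup_bpath g cp(3) T])

lemma cost_AE_bound: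
  assumes g: "\<And>w. cpath p (\<lambda>t. g t w)" and T: "\<And>w. 0 \<le> T w"
  shows "AE w in M. \<bar>pc (T w) (oup x (\<beta> w)) (\<lambda>t. g t w)\<bar> \<le> (1 + 2 * F) * (D x w + 0)"
  using ou_growth
proof eventually_elim
  case (elim w)
  have "\<bar>pc (T w) (oup x (\<beta> w)) (\<lambda>t. g t w)\<bar> \<le> D x w * exp (- (lam / 2) * T w) * (1 + 2 * F)"
    using elim by (intro pc_bound g ou_borel bpath_pathC T) auto
  also have "\<dots> \<le> D x w * 1 * (1 + 2 * F)"
    using D_ge_0 F_ge_0 T[of w] lam by (intro mult_right_mono mult_left_mono) auto
  finally show ?case by (simp add: mult.commute)
qed

lemma cost_integrable:
  assumes g: "\<And>t. g t \<in> borel_measurable M" "\<And>w. cpath p (\<lambda>t. g t w)"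
    and T: "T \<in> borel_measurable M" "\<And>w. 0 \<le> T w"
  shows "integrable M (\<lambda>w. pc (T w) (oup x (\<beta> w)) (\<lambda>t. g t w))"
  by (rule dominated(1)[OF cost_measurable[OF g T(1)] cost_AE_bound[of g T x, OF g(2) T(2)]])

text \<open>The functional is an argument of its own, so that \<open>J\<close> can be evaluated at a
  continuation that depends on a frozen past.\<close>

definition J :: "real \<Rightarrow> (real \<Rightarrow> (real \<Rightarrow> real) \<Rightarrow> real) \<Rightarrow> real" where
  "J y K = (\<integral>w. pc 0 (oup y (\<beta> w)) (\<lambda>u. K u (\<beta> w)) \<partial>M)"

lemma adm_bpath:
  assumes "adm p K" shows "(\<lambda>w. K u (\<beta> w)) \<in> borel_measurable M" "cpath p (\<lambda>u. K u (\<beta> w))"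
  using measurable_compose[OF bpath_measurable adm_measurable[OF assms]] adm_cpath[OF assms bpath_pathC] by auto

lemma J_bound: assumes K: "adm p K" shows "\<bar>J y K\<bar> \<le> (1 + 2 * F) * (\<bar>y\<bar> + D0)"
proof -
  note K' = adm_bpath[OF K]
  have "(\<lambda>w. pc 0 (oup y (\<beta> w)) (\<lambda>u. K u (\<beta> w))) \<in> borel_measurable M"
    by (rule cost_measurable[OF K']) simp
  from dominated(2)[OF this cost_AE_bound[of "\<lambda>u w. K u (\<beta> w)" "\<lambda>_. 0" y, OF K'(2)]]
  show ?thesis unfolding J_def by simp
qed

text \<open>Two processes driven by the same path differ by the deterministic function
  exp(-\<theta>t)(y - z). The constant does not depend on the control, so the bound passes to the
  infimum \<open>W\<close>.\<close>

lemma J_Lipschitz: assumes K: "adm p K" shows "\<bar>J y K - J z K\<bar> \<le> (1 + 2 * F) * \<bar>y - z\<bar>"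
proof -
  note K' = adm_bpath[OF K]
  let ?f = "\<lambda>y w. pc 0 (oup y (\<beta> w)) (\<lambda>u. K u (\<beta> w))"
  have i: "integrable M (?f y)" for y using K' by (intro cost_integrable) auto
  have "AE w in M. \<bar>?f y w - ?f z w\<bar> \<le> (1 + 2 * F) * \<bar>y - z\<bar>"
    using ou_growth
  proof eventually_elim
    case (elim w)
    have "?f y w - ?f z w = pc 0 (\<lambda>t. oup y (\<beta> w) t - oup z (\<beta> w) t) (\<lambda>u. K u (\<beta> w))"
      using elim by (intro pc_diff[OF K'(2) ou_borel[OF bpath_pathC] ou_borel[OF bpath_pathC], where D="D y w" and D'="D z w"]) auto
    also have "\<bar>\<dots>\<bar> \<le> \<bar>y - z\<bar> * exp (- (lam / 2) * 0) * (1 + 2 * F)"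
    proof (rule pc_bound[OF K'(2)])
      show "(\<lambda>t. oup y (\<beta> w) t - oup z (\<beta> w) t) \<in> borel_measurable borel"
        by (intro borel_measurable_diff ou_borel bpath_pathC)
      fix t :: real assume t: "0 \<le> t"
      have "oup y (\<beta> w) t - oup z (\<beta> w) t = exp (- \<theta> * t) * (y - z)"
        using ou_affine[of \<theta> \<mu> \<sigma> y "\<beta> w" t] ou_affine[of \<theta> \<mu> \<sigma> z "\<beta> w" t] by (simp add: algebra_simps)
      then have "\<bar>oup y (\<beta> w) t - oup z (\<beta> w) t\<bar> = exp (- \<theta> * t) * \<bar>y - z\<bar>" by (simp add: abs_mult)
      also have "\<dots> \<le> exp (lam / 2 * t) * \<bar>y - z\<bar>"
      proof (intro mult_right_mono)
        have "- \<theta> * t \<le> 0" "0 \<le> lam / 2 * t" using t \<theta> lam by auto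
        then show "exp (- \<theta> * t) \<le> exp (lam / 2 * t)" unfolding exp_le_cancel_iff by linarith
      qed simp
      finally show "\<bar>oup y (\<beta> w) t - oup z (\<beta> w) t\<bar> \<le> \<bar>y - z\<bar> * exp (lam / 2 * t)" by (simp add: mult.commute)
    qed auto
    finally show ?case by (simp add: mult.commute)
  qed
  then have AEn: "AE w in M. norm (?f y w - ?f z w) \<le> (1 + 2 * F) * \<bar>y - z\<bar>" by simp
  have "norm (\<integral>w. ?f y w - ?f z w \<partial>M) \<le> (\<integral>w. (1 + 2 * F) * \<bar>y - z\<bar> \<partial>M)"
    by (rule order_trans[OF integral_norm_bound integral_mono_AE[OF _ _ AEn]])
       (intro integrable_norm Bochner_Integration.integrable_diff i, rule integrable_const)
  then show ?thesis unfolding J_def by (simp add: i prob_space)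
qed

definition W :: "real \<Rightarrow> real" where
  "W y = (INF K \<in> {K. adm p K}. J y K)"

lemma adm_zero: "adm p (\<lambda>_ _. 0)"
  using cp by (auto simp: adm_def cpath_def mono_def)

lemma J_bdd_below: "bdd_below ((\<lambda>K. J y K) ` {K. adm p K})"
proof (rule bdd_belowI2)
  fix K assume "K \<in> {K. adm p K}"
  then show "- ((1 + 2 * F) * (\<bar>y\<bar> + D0)) \<le> J y K" using J_bound[of K y] by (simp add: abs_le_iff)
qed

lemma W_le: "adm p K \<Longrightarrow> W y \<le> J y K"
  unfolding W_def by (intro cINF_lower J_bdd_below) auto

lemma W_approx: "0 < e \<Longrightarrow> \<exists>K. adm p K \<and> J y K < W y + e"
  using cINF_less_iff[OF _ J_bdd_below, of y "W y + e"] adm_zero unfolding W_def by auto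

lemma W_Lipschitz: "\<bar>W y - W z\<bar> \<le> (1 + 2 * F) * \<bar>y - z\<bar>"
proof -
  have "W y \<le> W z + (1 + 2 * F) * \<bar>y - z\<bar>" for y z
  proof (rule field_le_epsilon)
    fix e :: real assume "0 < e"
    then obtain K where K: "adm p K" "J z K < W z + e" using W_approx by blast
    then show "W y \<le> W z + (1 + 2 * F) * \<bar>y - z\<bar> + e"
      using W_le[OF K(1), of y] J_Lipschitz[OF K(1), of y z] by (simp add: abs_le_iff)
  qed
  from this[of y z] this[of z y] show ?thesis by (simp add: abs_le_iff abs_minus_commute)
qed

lemma W_bound: "\<bar>W y\<bar> \<le> (1 + 2 * F) * (\<bar>y\<bar> + D0)"
proof -
  have "W y \<le> (1 + 2 * F) * (\<bar>y\<bar> + D0)"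
    using W_le[OF adm_zero, of y] J_bound[OF adm_zero, of y] by (simp add: abs_le_iff)
  moreover have "- ((1 + 2 * F) * (\<bar>y\<bar> + D0)) \<le> W y"
    unfolding W_def using adm_zero J_bound by (intro cINF_greatest) (auto simp: abs_le_iff minus_le_iff)
  ultimately show ?thesis by (simp add: abs_le_iff)
qed

lemma W_continuous: "isCont W y"
proof -
  have "(1 + 2 * F)-lipschitz_on UNIV W"
    using W_Lipschitz F_ge_0 by (auto intro!: lipschitz_onI simp: dist_real_def)
  then have "continuous_on UNIV W" by (rule lipschitz_on_continuous_on)
  then show ?thesis by (simp add: continuous_on_eq_continuous_at)
qed

lemma cpath_control:
  assumes g: "\<And>w. cpath p (\<lambda>t. g t w)" and m: "\<And>t. 0 \<le> t \<Longrightarrow> g t \<in> borel_measurable (\<F> (ennreal t))"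
    and z: "\<And>w. \<tau> w < \<infinity> \<Longrightarrow> g (enn2real (\<tau> w)) w = 0"
  shows "g \<in> controls M B c \<tau>"
proof -
  have "0 \<le> g t w" "g t w \<le> p" for t w using cpath_range[OF g] by auto
  moreover have "mono_on {0..} (\<lambda>t. g t w)" "\<forall>t. continuous (at_left t) (\<lambda>s. g s w)" for w
    using g[of w] by (auto simp: cpath_def mono_on_def dest: monoD)
  ultimately show ?thesis using m z unfolding controls_def adapted_def by (auto simp: le_diff_eq add.commute)
qed

lemma adm_control: assumes K: "adm p K" shows "(\<lambda>t w. K t (\<beta> w)) \<in> controls M B c (\<lambda>_. 0)"
proof (rule cpath_control[OF adm_bpath(2)[OF K]])
  show "(\<lambda>w. K t (\<beta> w)) \<in> borel_measurable (\<F> (ennreal t))" if "0 \<le> t" for t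
    by (rule measurable_compose[OF bpath_adapted[OF that] adm_adapted[OF K]])
  show "K (enn2real 0) (\<beta> w) = 0" for w using adm_bpath(2)[OF K, of w] by (simp add: cpath_def)
qed

lemma control_cost_AE:
  assumes "AE w in M. \<tau> w < \<infinity> \<longrightarrow> (\<forall>t\<ge>0. \<nu> t w = g t w)"
  shows "AE w in M. control_cost lam \<Phi> (X x) c \<tau> \<nu> w =
    (if \<tau> w = \<infinity> then 0 else pc (enn2real (\<tau> w)) (oup x (\<beta> w)) (\<lambda>t. g t w))"
  using assms X_eq[of x]
proof eventually_elim
  case (elim w)
  show ?case
  proof (cases "\<tau> w = \<infinity>")
    case False
    then have "\<tau> w < \<infinity>" by (simp add: less_top)
    with False elim show ?thesis by (simp add: control_cost_pcost) (intro pcost_cong, auto)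
  qed (simp add: control_cost_def)
qed

text \<open>Both infima range over the same set of numbers: \<open>control_representation\<close>
  gives one inclusion and \<open>adm_control\<close> the other.\<close>

lemma U_value_W: "U_value M B lam \<Phi> X y c = W y"
proof -
  have AE: "(\<integral>w. control_cost lam \<Phi> (X y) c (\<lambda>_. 0) \<nu> w \<partial>M) = J y K"
    if K: "adm p K" and nu: "AE w in M. \<forall>t\<ge>0. \<nu> t w = K t (\<beta> w)" for K \<nu>
  proof -
    have "AE w in M. pc 0 (oup y (\<beta> w)) (\<lambda>u. K u (\<beta> w)) = control_cost lam \<Phi> (X y) c (\<lambda>_. 0) \<nu> w"
      using control_cost_AE[of "\<lambda>_. 0" \<nu> "\<lambda>t w. K t (\<beta> w)" y] nu by (auto elim!: eventually_mono)
    moreover have "(\<lambda>w. pc 0 (oup y (\<beta> w)) (\<lambda>u. K u (\<beta> w))) \<in> borel_measurable M"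
      using adm_bpath[OF K] by (intro cost_measurable) auto
    ultimately show ?thesis unfolding J_def by (intro integral_cong_AE_complete[symmetric])
  qed
  have "(\<lambda>\<nu>. \<integral>w. control_cost lam \<Phi> (X y) c (\<lambda>_. 0) \<nu> w \<partial>M) ` controls M B c (\<lambda>_. 0) = (\<lambda>K. J y K) ` {K. adm p K}"
  proof (intro set_eqI iffI)
    fix v assume "v \<in> (\<lambda>\<nu>. \<integral>w. control_cost lam \<Phi> (X y) c (\<lambda>_. 0) \<nu> w \<partial>M) ` controls M B c (\<lambda>_. 0)"
    then obtain \<nu> where nu: "\<nu> \<in> controls M B c (\<lambda>_. 0)" and v: "v = (\<integral>w. control_cost lam \<Phi> (X y) c (\<lambda>_. 0) \<nu> w \<partial>M)" by blast
    obtain K where K: "adm p K" "AE w in M. \<forall>t\<ge>0. \<nu> t w = K t (\<beta> w)"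
      using control_representation[OF nu c] by auto
    then show "v \<in> (\<lambda>K. J y K) ` {K. adm p K}" using AE v by auto
  next
    fix v assume "v \<in> (\<lambda>K. J y K) ` {K. adm p K}"
    then obtain K where K: "adm p K" and v: "v = J y K" by blast
    show "v \<in> (\<lambda>\<nu>. \<integral>w. control_cost lam \<Phi> (X y) c (\<lambda>_. 0) \<nu> w \<partial>M) ` controls M B c (\<lambda>_. 0)"
      using AE[OF K, of "\<lambda>t w. K t (\<beta> w)"] v by (intro image_eqI[OF _ adm_control[OF K]]) auto
  qed
  then show ?thesis unfolding U_value_def W_def by simp
qed

text \<open>The Markov property in the form used for dynamic programming. Splicing at
  \<open>s\<close> preserves the law; under Fubini the first path is fixed, and it alone decides
  \<open>H\<close> and the value \<open>K s\<close>, so the inner integral is the discounted cost of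
  the continuation. The event \<open>H\<close> localizes the identity to outcomes that enter at time
  \<open>s\<close>.\<close>

lemma splice_identity:
  fixes x s :: real and H :: "(real \<Rightarrow> real) set" and K :: "real \<Rightarrow> (real \<Rightarrow> real) \<Rightarrow> real"
  assumes s: "s = real m / 2 ^ n" and H: "H \<in> sets (paths {..s})"
    and K: "adm p K" and Ks: "\<And>b. b \<in> H \<Longrightarrow> K s b = 0"
  defines "f \<equiv> \<lambda>w. indicator H (\<beta> w) * pc s (oup x (\<beta> w)) (\<lambda>u. K u (\<beta> w))"
    and "I \<equiv> \<lambda>w. indicator H (\<beta> w) * (exp (- lam * s) * J (oup x (\<beta> w) s) (\<lambda>u b. K (s + u) (conc s (\<beta> w) b)))"
  shows "integrable M f" "integrable M I" "integral\<^sup>L M f = integral\<^sup>L M I"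
proof -
  interpret MM: pair_prob_space M M ..
  have s0: "0 \<le> s" using s by simp
  note K' = adm_bpath[OF K]
  have [measurable]: "H \<in> sets PP" using H sets_paths_mono[of "{..s}" UNIV] by auto
  define g where "g b = indicator H b * pc s (oup x b) (\<lambda>u. K u b)" for b
  have "(\<lambda>b. pc s (oup x b) (\<lambda>u. K u b)) \<in> borel_measurable PP"
    using adm_cpath[OF K] by (intro pc_measurable[OF measurable_ou_joint adm_measurable[OF K] _ cp(3)]) auto
  then have gm [measurable]: "g \<in> borel_measurable PP"
    unfolding g_def[abs_def] by (intro borel_measurable_times borel_measurable_indicator) auto
  have fg: "f = (\<lambda>w. g (\<beta> w))" by (simp add: f_def g_def)
  have "integrable M (\<lambda>w. pc s (oup x (\<beta> w)) (\<lambda>u. K u (\<beta> w)))"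
    using K' s0 by (intro cost_integrable) auto
  then show int: "integrable M f"
  proof (rule Bochner_Integration.integrable_bound)
    show "f \<in> borel_measurable M" unfolding fg by measurable
  qed (auto simp: f_def indicator_def)
  let ?C = "\<lambda>(w, w'). conc s (\<beta> w) (\<beta> w')"
  have "(\<lambda>(w, w'). (\<beta> w, \<beta> w')) \<in> M \<Otimes>\<^sub>M M \<rightarrow>\<^sub>M PP \<Otimes>\<^sub>M PP" by measurable
  from measurable_compose[OF this measurable_conc[OF s0]]
  have C: "?C \<in> M \<Otimes>\<^sub>M M \<rightarrow>\<^sub>M PP" by (simp add: case_prod_beta)
  have law: "distr (M \<Otimes>\<^sub>M M) PP ?C = distr M PP \<beta>" by (rule splice[OF s])
  have "integrable (distr M PP \<beta>) g" using int unfolding fg by (subst integrable_distr_eq) auto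
  then have int2: "integrable (M \<Otimes>\<^sub>M M) (\<lambda>z. g (?C z))"
    unfolding law[symmetric] by (subst (asm) integrable_distr_eq[OF C]) auto
  have inner: "(\<integral>w'. g (?C (w, w')) \<partial>M) = I w" for w
  proof -
    let ?a = "\<beta> w"
    have g: "g (conc s ?a b) = indicator H ?a * (exp (- lam * s) * pc 0 (oup (oup x ?a s) b) (\<lambda>u. K (s + u) (conc s ?a b)))"
      if b: "b \<in> pathC" for b
    proof -
      let ?c = "conc s ?a b"
      have cC: "?c \<in> pathC" by (rule conc_pathC[OF bpath_pathC b s0])
      \<comment> \<open>\<open>H\<close> belongs to the past of \<open>s\<close>, which the spliced
        path shares with its first piece.\<close>
      have H': "?c \<in> H \<longleftrightarrow> ?a \<in> H"
        by (rule paths_set_agree[OF H cC bpath_pathC]) (simp add: conc_def)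
      show ?thesis
      proof (cases "?a \<in> H")
        case True
        then have "K s ?c = 0" using Ks H' by blast
        then have "pc s (oup x ?c) (\<lambda>u. K u ?c) = exp (- lam * s) * pc 0 (\<lambda>u. oup x ?c (s + u)) (\<lambda>u. K (s + u) ?c)"
          by (intro pc_shift[OF adm_cpath[OF K cC] _ s0 ou_borel[OF cC]]) auto
        also have "pc 0 (\<lambda>u. oup x ?c (s + u)) (\<lambda>u. K (s + u) ?c) = pc 0 (oup (oup x ?a s) b) (\<lambda>u. K (s + u) ?c)"
          using \<theta> by (intro pcost_cong ou_conc_ge[OF bpath_pathC b s0]) auto
        finally show ?thesis using True H' by (simp add: g_def)
      qed (simp add: g_def H')
    qed
    have "(\<integral>w'. g (?C (w, w')) \<partial>M) = (\<integral>w'. indicator H ?a * (exp (- lam * s) * pc 0 (oup (oup x ?a s) (\<beta> w')) (\<lambda>u. K (s + u) (conc s ?a (\<beta> w')))) \<partial>M)"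
      by (simp add: g[OF bpath_pathC])
    then show ?thesis unfolding I_def J_def by simp
  qed
  \<comment> \<open>The continuation in \<open>I\<close> depends on the whole frozen past; its
    measurability in \<open>w\<close> comes out of Fubini.\<close>
  show "integrable M I" using MM.integrable_fst'[OF int2] unfolding inner .
  have "integral\<^sup>L M f = integral\<^sup>L (distr M PP \<beta>) g" unfolding fg by (subst integral_distr) auto
  also have "\<dots> = (\<integral>z. g (?C z) \<partial>(M \<Otimes>\<^sub>M M))" unfolding law[symmetric] by (subst integral_distr[OF C]) auto
  also have "\<dots> = (\<integral>w. \<integral>w'. g (?C (w, w')) \<partial>M \<partial>M)" by (rule MM.integral_fst'[OF int2, symmetric])
  finally show "integral\<^sup>L M f = integral\<^sup>L M I" unfolding inner .
qed

end

section \<open>Dyadic entry times\<close>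

text \<open>Rounding goes upwards because rounding down would anticipate \<tau>; times already on
  the grid stay fixed.\<close>

definition ceil_time :: "nat \<Rightarrow> ('a \<Rightarrow> ennreal) \<Rightarrow> 'a \<Rightarrow> ennreal" where
  "ceil_time n \<tau> w = (if \<tau> w = \<infinity> then \<infinity> else ennreal (real (nat \<lceil>2 ^ n * enn2real (\<tau> w)\<rceil>) / 2 ^ n))"

lemma ceil_dyadic_bounds:
  fixes v :: real assumes "0 \<le> v"
  shows "v \<le> real (nat \<lceil>2 ^ n * v\<rceil>) / 2 ^ n" "real (nat \<lceil>2 ^ n * v\<rceil>) / 2 ^ n \<le> v + (1/2) ^ n"
proof -
  have r: "real (nat \<lceil>2 ^ n * v\<rceil>) = of_int \<lceil>2 ^ n * v\<rceil>" using assms by simp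
  have "2 ^ n * v \<le> of_int \<lceil>2 ^ n * v\<rceil>" "of_int \<lceil>2 ^ n * v\<rceil> \<le> 2 ^ n * v + 1" by linarith+
  then have "2 ^ n * v / 2 ^ n \<le> of_int \<lceil>2 ^ n * v\<rceil> / 2 ^ n" "of_int \<lceil>2 ^ n * v\<rceil> / 2 ^ n \<le> (2 ^ n * v + 1) / 2 ^ n"
    by (intro divide_right_mono; simp)+
  then show "v \<le> real (nat \<lceil>2 ^ n * v\<rceil>) / 2 ^ n" "real (nat \<lceil>2 ^ n * v\<rceil>) / 2 ^ n \<le> v + (1/2) ^ n"
    unfolding r by (simp_all add: add_divide_distrib power_one_over)
qed

lemma ceil_dyadic_tendsto:
  fixes v :: real assumes "0 \<le> v"
  shows "(\<lambda>n. real (nat \<lceil>2 ^ n * v\<rceil>) / 2 ^ n) \<longlonglongrightarrow> v"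
proof (rule tendsto_sandwich[of "\<lambda>_. v" _ _ "\<lambda>n. v + (1/2) ^ n"])
  have "(\<lambda>n. v + (1/2) ^ n) \<longlonglongrightarrow> v + 0" by (intro tendsto_intros LIMSEQ_realpow_zero) auto
  then show "(\<lambda>n. v + (1/2) ^ n) \<longlonglongrightarrow> v" by simp
qed (use ceil_dyadic_bounds[OF assms] in \<open>auto intro!: always_eventually\<close>)

section \<open>Stopping times with values in a dyadic grid\<close>

context bm
begin

lemma stopping_time_measurable: "stopping_time \<F> \<tau> \<Longrightarrow> \<tau> \<in> borel_measurable M"
  by (rule measurable_stopping_time[OF _ filtration_le]) auto

text \<open>The rounded time is at most \<open>u\<close> exactly when \<tau> is at most the last
  grid point before or at \<open>u\<close>, and that point is the \<open>v\<close> of the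
  proof.\<close>

lemma stopping_time_ceil:
  assumes tau: "stopping_time \<F> \<tau>" shows "stopping_time \<F> (ceil_time n \<tau>)"
proof (rule stopping_timeI)
  fix t :: ennreal
  show "Measurable.pred (\<F> t) (\<lambda>w. ceil_time n \<tau> w \<le> t)"
  proof (cases t)
    case (real u)
    define v where "v = real (nat \<lfloor>2 ^ n * u\<rfloor>) / 2 ^ n"
    have fl: "real (nat \<lfloor>2 ^ n * u\<rfloor>) = of_int \<lfloor>2 ^ n * u\<rfloor>" using real by simp
    have "real (nat \<lfloor>2 ^ n * u\<rfloor>) \<le> 2 ^ n * u" unfolding fl by simp
    then have vu: "v \<le> u" by (simp add: v_def divide_le_eq mult.commute)
    have v0: "0 \<le> v" by (simp add: v_def)
    have "(ceil_time n \<tau> w \<le> t) = (\<tau> w \<le> ennreal v)" for w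
    proof (cases "\<tau> w")
      case (real y)
      have "(ceil_time n \<tau> w \<le> t) = (real (nat \<lceil>2 ^ n * y\<rceil>) / 2 ^ n \<le> u)"
        using real \<open>0 \<le> u\<close> unfolding ceil_time_def \<open>t = ennreal u\<close> by (simp add: ennreal_le_iff)
      also have "\<dots> = (real (nat \<lceil>2 ^ n * y\<rceil>) \<le> 2 ^ n * u)" by (simp add: divide_le_eq mult.commute)
      also have "real (nat \<lceil>2 ^ n * y\<rceil>) = of_int \<lceil>2 ^ n * y\<rceil>" using real by simp
      also have "(of_int \<lceil>2 ^ n * y\<rceil> \<le> 2 ^ n * u) = (\<lceil>2 ^ n * y\<rceil> \<le> \<lfloor>2 ^ n * u\<rfloor>)" by (simp only: le_floor_iff)
      also have "\<dots> = (2 ^ n * y \<le> of_int \<lfloor>2 ^ n * u\<rfloor>)" by (simp only: ceiling_le_iff)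
      also have "\<dots> = (y \<le> v)" unfolding v_def fl by (simp add: le_divide_eq mult.commute)
      also have "\<dots> = (\<tau> w \<le> ennreal v)" using real v0 by (simp add: ennreal_le_iff)
      finally show ?thesis .
    qed (simp add: ceil_time_def real top_unique)
    then have "(\<lambda>w. ceil_time n \<tau> w \<le> t) = (\<lambda>w. \<tau> w \<le> ennreal v)" by simp
    moreover have "Measurable.pred (\<F> t) (\<lambda>w. \<tau> w \<le> ennreal v)"
      using stopping_timeD[OF tau, of "ennreal v"] unfolding real(2)
      by (rule measurable_filtration_mono[OF ennreal_leI[OF vu]])
    ultimately show ?thesis by simp
  qed simp
qed

definition dyadic_time :: "nat \<Rightarrow> ('a \<Rightarrow> ennreal) \<Rightarrow> bool" where
  "dyadic_time n S \<longleftrightarrow> stopping_time \<F> S \<and> (\<forall>w. S w = \<infinity> \<or> (\<exists>k. S w = ennreal (real k / 2 ^ n)))"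

lemma dyadic_ceil_time: "stopping_time \<F> \<tau> \<Longrightarrow> dyadic_time n (ceil_time n \<tau>)"
  unfolding dyadic_time_def
proof (intro conjI allI stopping_time_ceil)
  fix w
  show "ceil_time n \<tau> w = \<infinity> \<or> (\<exists>k. ceil_time n \<tau> w = ennreal (real k / 2 ^ n))"
    unfolding ceil_time_def by (cases "\<tau> w = \<infinity>") (simp_all only: if_True if_False simp_thms, blast)
qed

definition at_dyadic :: "nat \<Rightarrow> ('a \<Rightarrow> ennreal) \<Rightarrow> nat \<Rightarrow> 'a set" where
  "at_dyadic n S k = {w \<in> space M. S w = ennreal (real k / 2 ^ n)}"

lemma ennreal_dyadic_inject: "ennreal (real k / 2 ^ n) = ennreal (real j / 2 ^ n) \<longleftrightarrow> k = j"
  by (subst ennreal_inj) auto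

lemma at_dyadic_filtration:
  assumes S: "dyadic_time n S" shows "at_dyadic n S k \<in> sets (\<F> (ennreal (real k / 2 ^ n)))"
proof -
  let ?t = "\<lambda>k. ennreal (real k / 2 ^ n)"
  have P: "{w \<in> space M. S w \<le> ?t j} \<in> sets (\<F> (?t k))" if "j \<le> k" for j
  proof -
    have "Measurable.pred (\<F> (?t j)) (\<lambda>w. S w \<le> ?t j)"
      using S by (auto simp: dyadic_time_def intro: stopping_timeD)
    then have "{w \<in> space (\<F> (?t j)). S w \<le> ?t j} \<in> sets (\<F> (?t j))" by (simp only: pred_def)
    moreover have "?t j \<le> ?t k" using that by (intro ennreal_leI divide_right_mono) auto
    ultimately show ?thesis using subsetD[OF filtration_mono] by (simp only: space_filtration)
  qed
  have le: "?t i \<le> ?t j \<longleftrightarrow> i \<le> j" for i j by (subst ennreal_le_iff) (auto simp: divide_le_cancel)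
  have "at_dyadic n S k = {w \<in> space M. S w \<le> ?t k} - (\<Union>j<k. {w \<in> space M. S w \<le> ?t j})"
  proof (intro set_eqI iffI)
    fix w assume "w \<in> at_dyadic n S k"
    then show "w \<in> {w \<in> space M. S w \<le> ?t k} - (\<Union>j<k. {w \<in> space M. S w \<le> ?t j})"
      by (auto simp: at_dyadic_def le)
  next
    fix w assume w: "w \<in> {w \<in> space M. S w \<le> ?t k} - (\<Union>j<k. {w \<in> space M. S w \<le> ?t j})"
    then have "S w \<noteq> \<infinity>" by (auto simp: top_unique)
    then obtain i where i: "S w = ?t i" using S by (auto simp: dyadic_time_def)
    have "i \<le> k" using w i le[of i k] by simp
    moreover have "\<not> i < k" using w i by auto
    ultimately show "w \<in> at_dyadic n S k" using w i by (simp add: at_dyadic_def)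
  qed
  moreover have "{w \<in> space M. S w \<le> ?t k} - (\<Union>j<k. {w \<in> space M. S w \<le> ?t j}) \<in> sets (\<F> (?t k))"
    by (intro sets.Diff sets.finite_UN P) auto
  ultimately show ?thesis by simp
qed

lemma at_dyadic_sets: "dyadic_time n S \<Longrightarrow> at_dyadic n S k \<in> sets M"
  using at_dyadic_filtration filtration_le by blast

text \<open>On the pieces only integrated inequalities are available, from the Markov property at
  the entry time; where \<open>S\<close> is infinite there is no such time and a pointwise
  inequality is asked for. The pieces are added one by one and exhausted by dominated
  convergence.\<close>

lemma integral_le_dyadic_pieces:
  fixes f h :: "'a \<Rightarrow> real"
  assumes S: "dyadic_time n S" and f: "integrable M f" and h: "integrable M h"
    and inf: "\<And>w. S w = \<infinity> \<Longrightarrow> f w \<le> h w"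
    and pieces: "\<And>k. (\<integral>w. indicator (at_dyadic n S k) w * f w \<partial>M) \<le> (\<integral>w. indicator (at_dyadic n S k) w * h w \<partial>M)"
  shows "integral\<^sup>L M f \<le> integral\<^sup>L M h"
proof -
  let ?E = "at_dyadic n S"
  let ?d = "\<lambda>w. h w - f w"
  define Inf where "Inf = {w \<in> space M. S w = \<infinity>}"
  have Sm [measurable]: "S \<in> borel_measurable M" using S stopping_time_measurable by (auto simp: dyadic_time_def)
  have Inf_sets: "Inf \<in> sets M" unfolding Inf_def by measurable
  have d: "integrable M ?d" using f h by simp
  have id: "integrable M (\<lambda>w. indicator A w * ?d w)" if "A \<in> sets M" for A
    using integrable_mult_indicator[OF that d] by simp
  have nn: "0 \<le> (\<integral>w. indicator (Inf \<union> (\<Union>k<N. ?E k)) w * ?d w \<partial>M)" for N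
  proof (induction N)
    case 0
    show ?case
      by (intro integral_nonneg_AE AE_I2) (auto simp: Inf_def indicator_def intro: inf)
  next
    case (Suc N)
    have e: "indicator (Inf \<union> (\<Union>k<Suc N. ?E k)) w * ?d w =
      indicator (Inf \<union> (\<Union>k<N. ?E k)) w * ?d w + (indicator (?E N) w * h w - indicator (?E N) w * f w)" for w
    proof (cases "w \<in> ?E N")
      case True
      then have "w \<notin> Inf \<union> (\<Union>k<N. ?E k)"
        by (auto simp: Inf_def at_dyadic_def ennreal_dyadic_inject)
      then show ?thesis using True by (simp add: lessThan_Suc)
    qed (auto simp: indicator_def less_Suc_eq)
    have ii: "integrable M (\<lambda>w. indicator (?E N) w * h w)" "integrable M (\<lambda>w. indicator (?E N) w * f w)"
      using integrable_mult_indicator[OF at_dyadic_sets[OF S] h] integrable_mult_indicator[OF at_dyadic_sets[OF S] f] by simp_all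
    have "Inf \<union> (\<Union>k<N. ?E k) \<in> sets M" using Inf_sets at_dyadic_sets[OF S] by auto
    from id[OF this] ii have "(\<integral>w. indicator (Inf \<union> (\<Union>k<Suc N. ?E k)) w * ?d w \<partial>M) =
       (\<integral>w. indicator (Inf \<union> (\<Union>k<N. ?E k)) w * ?d w \<partial>M)
        + ((\<integral>w. indicator (?E N) w * h w \<partial>M) - (\<integral>w. indicator (?E N) w * f w \<partial>M))"
      unfolding e by (subst Bochner_Integration.integral_add; (intro Bochner_Integration.integrable_diff)?; simp)
    then show ?case using Suc pieces[of N] by linarith
  qed
  have "(\<lambda>N. \<integral>w. indicator (Inf \<union> (\<Union>k<N. ?E k)) w * ?d w \<partial>M) \<longlonglongrightarrow> (\<integral>w. ?d w \<partial>M)"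
  proof (rule integral_dominated_convergence[where w="\<lambda>w. \<bar>?d w\<bar>"])
    show "(\<lambda>w. indicator (Inf \<union> (\<Union>k<N. ?E k)) w * ?d w) \<in> borel_measurable M" for N
      using Inf_sets at_dyadic_sets[OF S] d by (intro borel_measurable_times borel_measurable_indicator) auto
    show "AE w in M. (\<lambda>N. indicator (Inf \<union> (\<Union>k<N. ?E k)) w * ?d w) \<longlonglongrightarrow> ?d w"
    proof (rule AE_I2)
      fix w assume w: "w \<in> space M"
      have "\<exists>N0. \<forall>N\<ge>N0. w \<in> Inf \<union> (\<Union>k<N. ?E k)"
      proof (cases "S w = \<infinity>")
        case False
        then obtain k where "S w = ennreal (real k / 2 ^ n)" using S by (auto simp: dyadic_time_def)
        then have "w \<in> ?E k" using w by (simp add: at_dyadic_def)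
        then show ?thesis by (intro exI[of _ "Suc k"]) auto
      qed (use w in \<open>auto simp: Inf_def\<close>)
      then obtain N0 where "\<forall>N\<ge>N0. w \<in> Inf \<union> (\<Union>k<N. ?E k)" by blast
      then have "\<forall>\<^sub>F N in sequentially. indicator (Inf \<union> (\<Union>k<N. ?E k)) w * ?d w = ?d w"
        by (intro eventually_sequentiallyI[of N0]) (simp add: indicator_def)
      then show "(\<lambda>N. indicator (Inf \<union> (\<Union>k<N. ?E k)) w * ?d w) \<longlonglongrightarrow> ?d w" by (rule tendsto_eventually)
    qed
    show "AE w in M. norm (indicator (Inf \<union> (\<Union>k<N. ?E k)) w * ?d w) \<le> \<bar>?d w\<bar>" for N
      by (intro AE_I2) (auto simp: indicator_def)
    show "integrable M (\<lambda>w. \<bar>?d w\<bar>)" using d by (rule integrable_abs)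
  qed (use d in auto)
  then have "0 \<le> (\<integral>w. ?d w \<partial>M)" using nn by (intro LIMSEQ_le_const) auto
  then show ?thesis using f h by simp
qed

end

section \<open>Dynamic programming at dyadic times\<close>

context ou_problem
begin

definition Cost :: "real \<Rightarrow> ('a \<Rightarrow> ennreal) \<Rightarrow> (real \<Rightarrow> 'a \<Rightarrow> real) \<Rightarrow> 'a \<Rightarrow> real" where
  "Cost x \<tau> g w = (if \<tau> w = \<infinity> then 0 else pc (enn2real (\<tau> w)) (oup x (\<beta> w)) (\<lambda>t. g t w))"

text \<open>The entry reward \<open>P0\<close> is split off since it is the same on both sides of
  the identity. The value 0 at infinity agrees with the liminf convention almost surely, by
  \<open>payoff_at_infinity_zero\<close>.\<close>

definition Pay :: "real \<Rightarrow> ('a \<Rightarrow> ennreal) \<Rightarrow> 'a \<Rightarrow> real" where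
  "Pay x \<tau> w = (if \<tau> w = \<infinity> then 0 else exp (- lam * enn2real (\<tau> w)) * W (oup x (\<beta> w) (enn2real (\<tau> w))))"

lemma Cost_measurable:
  assumes g: "\<And>t. g t \<in> borel_measurable M" "\<And>w. cpath p (\<lambda>t. g t w)" and [measurable]: "\<tau> \<in> borel_measurable M"
  shows "Cost x \<tau> g \<in> borel_measurable M"
proof -
  have [measurable]: "(\<lambda>w. pc (enn2real (\<tau> w)) (oup x (\<beta> w)) (\<lambda>t. g t w)) \<in> borel_measurable M"
    by (rule cost_measurable[OF g]) measurable
  show ?thesis unfolding Cost_def[abs_def] by measurable
qed

lemma Cost_AE_bound:
  assumes g: "\<And>w. cpath p (\<lambda>t. g t w)"
  shows "AE w in M. \<bar>Cost x \<tau> g w\<bar> \<le> (1 + 2 * F) * (D x w + 0)"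
  using cost_AE_bound[of g "\<lambda>w. enn2real (\<tau> w)" x, OF g] D_ge_0 F_ge_0
  by (auto simp: Cost_def elim!: eventually_mono)

lemma Cost_integrable:
  assumes g: "\<And>t. g t \<in> borel_measurable M" "\<And>w. cpath p (\<lambda>t. g t w)" and tau: "\<tau> \<in> borel_measurable M"
  shows "integrable M (Cost x \<tau> g)"
  by (rule dominated(1)[OF Cost_measurable[OF assms] Cost_AE_bound[of g x \<tau>, OF g(2)]])

lemma Pay_measurable:
  assumes [measurable]: "\<tau> \<in> borel_measurable M" shows "Pay x \<tau> \<in> borel_measurable M"
proof -
  have [measurable]: "W \<in> borel_measurable borel"
    by (intro borel_measurable_continuous_onI continuous_at_imp_continuous_on ballI W_continuous)
  have [measurable]: "(\<lambda>w. oup x (\<beta> w) (enn2real (\<tau> w))) \<in> borel_measurable M"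
    by (rule measurable_oup_time) measurable
  show ?thesis unfolding Pay_def[abs_def] by measurable
qed

text \<open>\<open>W\<close> grows at most linearly, so growth of the path at rate
  \<open>lam / 2\<close> leaves decay at that rate. This provides both the majorant for all entry
  times and the limit 0 at infinity.\<close>

lemma discounted_W_bound:
  assumes "\<And>t. 0 \<le> t \<Longrightarrow> \<bar>y t\<bar> \<le> A * exp (lam / 2 * t)" and t: "0 \<le> t"
  shows "\<bar>exp (- lam * t) * W (y t)\<bar> \<le> (1 + 2 * F) * (A + D0) * exp (- (lam / 2) * t)"
proof -
  note d0 = D0_ge_0
  have E: "1 \<le> exp (lam / 2 * t)" using t lam by simp
  have "\<bar>exp (- lam * t) * W (y t)\<bar> = exp (- lam * t) * \<bar>W (y t)\<bar>" by (simp add: abs_mult)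
  also have "\<dots> \<le> exp (- lam * t) * ((1 + 2 * F) * ((A + D0) * exp (lam / 2 * t)))"
  proof (intro mult_left_mono order_trans[OF W_bound])
    have "\<bar>y t\<bar> + D0 \<le> A * exp (lam / 2 * t) + D0 * exp (lam / 2 * t)"
      using assms(1)[OF t] mult_left_mono[OF E d0] by simp
    then show "\<bar>y t\<bar> + D0 \<le> (A + D0) * exp (lam / 2 * t)" by (simp add: distrib_right)
  qed (use F_ge_0 in auto)
  also have "\<dots> = (1 + 2 * F) * (A + D0) * (exp (- lam * t) * exp (lam / 2 * t))" by simp
  also have "exp (- lam * t) * exp (lam / 2 * t) = exp (- (lam / 2) * t)" by (simp add: exp_add[symmetric])
  finally show ?thesis .
qed

lemma Pay_AE_bound: "AE w in M. \<bar>Pay x \<tau> w\<bar> \<le> (1 + 2 * F) * (D x w + D0)"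
  using ou_growth
proof eventually_elim
  case (elim w)
  let ?T = "enn2real (\<tau> w)"
  note d0 = D0_ge_0
  have "\<bar>exp (- lam * ?T) * W (oup x (\<beta> w) ?T)\<bar> \<le> (1 + 2 * F) * (D x w + D0) * exp (- (lam / 2) * ?T)"
    using elim by (intro discounted_W_bound) auto
  also have "\<dots> \<le> (1 + 2 * F) * (D x w + D0) * 1"
    using D_ge_0[of x w] F_ge_0 d0 lam by (intro mult_left_mono) auto
  finally show ?case using D_ge_0[of x w] F_ge_0 d0 by (auto simp: Pay_def)
qed

lemma Pay_integrable: "\<tau> \<in> borel_measurable M \<Longrightarrow> integrable M (Pay x \<tau>)"
  by (rule dominated(1)[OF Pay_measurable Pay_AE_bound])

text \<open>The entry events belong to the augmented filtration; replacing them by path events up to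
  null sets makes \<open>splice_identity\<close> applicable.\<close>

lemma dyadic_piece:
  fixes x :: real and K :: "real \<Rightarrow> (real \<Rightarrow> real) \<Rightarrow> real" and S :: "'a \<Rightarrow> ennreal" and n k :: nat
  assumes S: "dyadic_time n S" and K: "adm p K" "\<And>b. b \<in> pathC \<Longrightarrow> K (real k / 2 ^ n) b = 0"
  defines "s \<equiv> real k / 2 ^ n" and "E \<equiv> at_dyadic n S k"
  defines "f \<equiv> \<lambda>w. indicator E w * pc s (oup x (\<beta> w)) (\<lambda>u. K u (\<beta> w))"
    and "j \<equiv> \<lambda>w. indicator E w * (exp (- lam * s) * J (oup x (\<beta> w) s) (\<lambda>u b. K (s + u) (conc s (\<beta> w) b)))"
  shows "integrable M j" "integral\<^sup>L M f = integral\<^sup>L M j"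
proof -
  have s0: "0 \<le> s" by (simp add: s_def)
  obtain H where H: "H \<in> sets (paths {..s})" "AE w in M. w \<in> E \<longleftrightarrow> \<beta> w \<in> H"
    using filtration_path_event[OF at_dyadic_filtration[OF S, of k, folded s_def] s0] unfolding E_def by blast
  have Ks: "K s b = 0" if "b \<in> H" for b
    using K(2)[of b] sets.sets_into_space[OF H(1)] that by (auto simp: s_def)
  note si = splice_identity[OF s_def[THEN meta_eq_to_obj_eq] H(1) K(1) Ks, where x=x]
  have AEj: "AE w in M. indicator H (\<beta> w) * (exp (- lam * s) * J (oup x (\<beta> w) s) (\<lambda>u b. K (s + u) (conc s (\<beta> w) b))) = j w"
    using H(2) by eventually_elim (auto simp: j_def indicator_def)
  have AEf: "AE w in M. indicator H (\<beta> w) * pc s (oup x (\<beta> w)) (\<lambda>u. K u (\<beta> w)) = f w"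
    using H(2) by eventually_elim (auto simp: f_def indicator_def)
  show "integrable M j" using integrable_cong_AE_complete[OF si(2) AEj] .
  show "integral\<^sup>L M f = integral\<^sup>L M j"
    using integral_cong_AE_complete[OF borel_measurable_integrable[OF si(2)] AEj]
      integral_cong_AE_complete[OF borel_measurable_integrable[OF si(1)] AEf] si(3) by simp
qed

context
  fixes n :: nat and S :: "'a \<Rightarrow> ennreal" and K :: "nat \<Rightarrow> real \<Rightarrow> (real \<Rightarrow> real) \<Rightarrow> real" and g :: "real \<Rightarrow> 'a \<Rightarrow> real"
  assumes S: "dyadic_time n S"
    and K: "\<And>k. adm p (K k)" "\<And>k b. b \<in> pathC \<Longrightarrow> K k (real k / 2 ^ n) b = 0"
    and gK: "\<And>k w t. w \<in> at_dyadic n S k \<Longrightarrow> g t w = K k t (\<beta> w)"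
    and g: "\<And>t. g t \<in> borel_measurable M" "\<And>w. cpath p (\<lambda>t. g t w)"
begin

text \<open>The control with entry time zero that remains after entry at \<open>k / 2 ^ n\<close>,
  the past being frozen to \<open>a\<close>. On each piece the process \<open>g\<close> is given by
  its own functional \<open>K k\<close>.\<close>

abbreviation (input) contin :: "nat \<Rightarrow> (real \<Rightarrow> real) \<Rightarrow> real \<Rightarrow> (real \<Rightarrow> real) \<Rightarrow> real" where
  "contin k a \<equiv> \<lambda>u b. K k (real k / 2 ^ n + u) (conc (real k / 2 ^ n) a b)"

lemma S_measurable: "S \<in> borel_measurable M"
  using S stopping_time_measurable by (auto simp: dyadic_time_def)

lemma adm_cont: "adm p (contin k (\<beta> w))"
  using K by (intro adm_conc[OF K(1) bpath_pathC]) (auto intro: bpath_pathC)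

lemma dyadic_piece_contin:
  "integrable M (\<lambda>w. indicator (at_dyadic n S k) w *
     (exp (- lam * (real k / 2 ^ n)) * J (oup x (\<beta> w) (real k / 2 ^ n)) (contin k (\<beta> w))))" (is ?int)
  "(\<integral>w. indicator (at_dyadic n S k) w * pc (real k / 2 ^ n) (oup x (\<beta> w)) (\<lambda>u. K k u (\<beta> w)) \<partial>M) =
   (\<integral>w. indicator (at_dyadic n S k) w *
     (exp (- lam * (real k / 2 ^ n)) * J (oup x (\<beta> w) (real k / 2 ^ n)) (contin k (\<beta> w))) \<partial>M)" (is ?eq)
proof -
  show ?int by (rule dyadic_piece(1)[OF S K(1)]) (rule K(2))
  show ?eq by (rule dyadic_piece(2)[OF S K(1)]) (rule K(2))
qed

lemma Cost_piece: "indicator (at_dyadic n S k) w * Cost x S g w =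
    indicator (at_dyadic n S k) w * pc (real k / 2 ^ n) (oup x (\<beta> w)) (\<lambda>u. K k u (\<beta> w))"
proof (cases "w \<in> at_dyadic n S k")
  case True
  then have "S w = ennreal (real k / 2 ^ n)" by (simp add: at_dyadic_def)
  moreover have "(\<lambda>t. g t w) = (\<lambda>u. K k u (\<beta> w))" using gK[OF True] by auto
  ultimately show ?thesis by (simp add: Cost_def)
qed simp

lemma Pay_piece: "indicator (at_dyadic n S k) w * Pay x S w =
    indicator (at_dyadic n S k) w * (exp (- lam * (real k / 2 ^ n)) * W (oup x (\<beta> w) (real k / 2 ^ n)))"
  by (auto simp: Pay_def at_dyadic_def indicator_def)

lemma Pay_piece_integrable: "integrable M (\<lambda>w. indicator (at_dyadic n S k) w * Pay x S w)"
  using integrable_mult_indicator[OF at_dyadic_sets[OF S] Pay_integrable[OF S_measurable]] by simp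

text \<open>On every piece, and for every frozen past, the continuation competes in the infimum that
  defines \<open>W\<close>.\<close>

lemma Pay_le_Cost: "expectation (Pay x S) \<le> expectation (Cost x S g)"
proof (rule integral_le_dyadic_pieces[OF S Pay_integrable[OF S_measurable] Cost_integrable[OF g S_measurable]])
  show "Pay x S w \<le> Cost x S g w" if "S w = \<infinity>" for w using that by (simp add: Pay_def Cost_def)
  fix k
  show "(\<integral>w. indicator (at_dyadic n S k) w * Pay x S w \<partial>M) \<le> (\<integral>w. indicator (at_dyadic n S k) w * Cost x S g w \<partial>M)"
    unfolding Cost_piece dyadic_piece_contin(2)
  proof (rule integral_mono[OF Pay_piece_integrable dyadic_piece_contin(1)])
    fix w
    show "indicator (at_dyadic n S k) w * Pay x S w \<le> indicator (at_dyadic n S k) w *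
        (exp (- lam * (real k / 2 ^ n)) * J (oup x (\<beta> w) (real k / 2 ^ n)) (contin k (\<beta> w)))"
      unfolding Pay_piece by (intro mult_left_mono W_le adm_cont) auto
  qed
qed

text \<open>The error on a piece is multiplied by a discount factor of at most 1, and the pieces are
  disjoint, so the total error stays below \<open>e\<close> however many pieces there are.\<close>

lemma Cost_le_Pay:
  assumes e: "0 \<le> e" and Je: "\<And>k w. J (oup x (\<beta> w) (real k / 2 ^ n)) (contin k (\<beta> w)) \<le> W (oup x (\<beta> w) (real k / 2 ^ n)) + e"
  shows "expectation (Cost x S g) \<le> expectation (Pay x S) + e"
proof -
  have int: "integrable M (\<lambda>w. Pay x S w + e)"
    by (intro Bochner_Integration.integrable_add Pay_integrable S_measurable integrable_const)
  have "expectation (Cost x S g) \<le> (\<integral>w. Pay x S w + e \<partial>M)"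
  proof (rule integral_le_dyadic_pieces[OF S Cost_integrable[OF g S_measurable] int])
    show "Cost x S g w \<le> Pay x S w + e" if "S w = \<infinity>" for w using that e by (simp add: Pay_def Cost_def)
    fix k
    have ie: "integrable M (\<lambda>w. indicator (at_dyadic n S k) w * (Pay x S w + e))"
      using integrable_mult_indicator[OF at_dyadic_sets[OF S] int] by simp
    show "(\<integral>w. indicator (at_dyadic n S k) w * Cost x S g w \<partial>M) \<le> (\<integral>w. indicator (at_dyadic n S k) w * (Pay x S w + e) \<partial>M)"
      unfolding Cost_piece dyadic_piece_contin(2)
    proof (rule integral_mono[OF dyadic_piece_contin(1) ie])
      fix w
      let ?s = "real k / 2 ^ n" and ?i = "indicator (at_dyadic n S k) w :: real"
      have "exp (- lam * ?s) * J (oup x (\<beta> w) ?s) (contin k (\<beta> w)) \<le> exp (- lam * ?s) * (W (oup x (\<beta> w) ?s) + e)"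
        by (intro mult_left_mono Je) auto
      also have "\<dots> \<le> exp (- lam * ?s) * W (oup x (\<beta> w) ?s) + e"
      proof -
        have "exp (- lam * ?s) * e \<le> 1 * e" using e lam by (intro mult_right_mono) auto
        then show ?thesis by (simp add: distrib_left)
      qed
      finally have "?i * (exp (- lam * ?s) * J (oup x (\<beta> w) ?s) (contin k (\<beta> w))) \<le> ?i * (exp (- lam * ?s) * W (oup x (\<beta> w) ?s) + e)"
        by (intro mult_left_mono) auto
      then show "?i * (exp (- lam * ?s) * J (oup x (\<beta> w) ?s) (contin k (\<beta> w))) \<le> ?i * (Pay x S w + e)"
        unfolding distrib_left Pay_piece .
    qed
  qed
  then show ?thesis by (simp add: Pay_integrable S_measurable prob_space)
qed

end

end

section \<open>The value identity\<close>

lemma cpath_unshift: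
  assumes g: "cpath p g" and s: "0 \<le> s" shows "cpath p (\<lambda>u. g (u - s))"
  unfolding cpath_def
proof (intro conjI allI impI)
  show "mono (\<lambda>u. g (u - s))" using cpath_mono[OF g] by (auto simp: mono_def)
  show "g (u - s) = 0" if "u \<le> 0" for u using that s g by (auto simp: cpath_def)
  show "g (u - s) \<le> p" for u using cpath_range[OF g] by auto
  show "continuous (at_left u) (\<lambda>u. g (u - s))" for u
  proof -
    have "(g \<longlongrightarrow> g (u - s)) (at_left (u - s))" using g by (auto simp: cpath_def continuous_within)
    moreover have "filterlim (\<lambda>u. u - s) (at_left (u - s)) (at_left u)"
      unfolding filterlim_at by (auto intro!: tendsto_eq_intros simp: eventually_at_filter)
    ultimately show ?thesis unfolding continuous_within by (rule filterlim_compose)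
  qed
qed

lemma cpath_zero_at: "cpath p g \<Longrightarrow> u \<le> 0 \<Longrightarrow> g u = 0"
  by (auto simp: cpath_def)

lemma adm_delay:
  assumes K: "adm p K" and s: "0 \<le> s" shows "adm p (\<lambda>u b. delay s (\<lambda>u. K u b) u)"
  unfolding adm_def
proof (intro conjI allI ballI)
  fix u
  show "(\<lambda>b. delay s (\<lambda>u. K u b) u) \<in> borel_measurable (paths {..u})"
    unfolding delay_def using adm_adapted[OF K, of u] by (cases "s < u") (simp_all only: if_True if_False borel_measurable_const)
qed (rule cpath_delay[OF adm_cpath[OF K] s])

context ou_problem
begin

text \<open>Constancy of the selected control on grid cells is what keeps the restarted control measurable.\<close>
lemma near_optimal_selector:
  assumes e: "0 < e"
  shows "\<exists>(\<delta> :: real) Ki. 0 < \<delta> \<and> (\<forall>i :: int. adm p (Ki i)) \<and> (\<forall>z. J z (Ki \<lfloor>z / \<delta>\<rfloor>) \<le> W z + e)"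
proof -
  define L where "L = 1 + 2 * F"
  have L: "0 < L" using F_ge_0 by (simp add: L_def)
  \<comment> \<open>The budget is e/2 for the choice of controls at grid points and e/4 each for
    moving \<open>J\<close> and \<open>W\<close> from the initial value to its grid point.\<close>
  define \<delta> where "\<delta> = e / (4 * L)"
  have d: "0 < \<delta>" "L * \<delta> = e / 4" using e L by (auto simp: \<delta>_def)
  have "\<forall>i::int. \<exists>K. adm p K \<and> J (\<delta> * of_int i) K < W (\<delta> * of_int i) + e / 2"
    using W_approx[of "e / 2"] e by auto
  from choice[OF this] obtain Ki where Ki: "\<And>i. adm p (Ki i)" "\<And>i. J (\<delta> * of_int i) (Ki i) < W (\<delta> * of_int i) + e / 2" by blast
  have "J z (Ki \<lfloor>z / \<delta>\<rfloor>) \<le> W z + e" for z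
  proof -
    let ?i = "\<lfloor>z / \<delta>\<rfloor>"
    let ?z = "\<delta> * of_int ?i"
    have "of_int ?i \<le> z / \<delta>" "z / \<delta> \<le> of_int ?i + 1" by linarith+
    then have "?z \<le> \<delta> * (z / \<delta>)" "\<delta> * (z / \<delta>) \<le> \<delta> * (of_int ?i + 1)"
      using d(1) by (intro mult_left_mono; simp)+
    then have "?z \<le> z" "z \<le> ?z + \<delta>" using d(1) by (simp_all add: distrib_left)
    then have "\<bar>z - ?z\<bar> \<le> \<delta>" by linarith
    then have "L * \<bar>z - ?z\<bar> \<le> e / 4" unfolding d(2)[symmetric] using L by (intro mult_left_mono) auto
    then show ?thesis
      using J_Lipschitz[OF Ki(1), of z ?i ?z] W_Lipschitz[of ?z z] Ki(2)[of ?i]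
      unfolding L_def[symmetric] by (simp add: abs_le_iff abs_minus_commute)
  qed
  then show ?thesis using d Ki by blast
qed

lemma J_cong: "(\<And>u b. b \<in> pathC \<Longrightarrow> K u b = K' u b) \<Longrightarrow> J z K = J z K'"
  unfolding J_def by (simp add: bpath_pathC)

context
  fixes \<delta> :: real and Ki :: "int \<Rightarrow> real \<Rightarrow> (real \<Rightarrow> real) \<Rightarrow> real" and x :: real
  assumes Ki: "\<And>i. adm p (Ki i)"
begin

text \<open>The value of the process at \<open>s\<close> selects a control, which is then driven by
  the path increments after \<open>s\<close>.\<close>

definition restart :: "real \<Rightarrow> real \<Rightarrow> (real \<Rightarrow> real) \<Rightarrow> real" where
  "restart s t b = Ki \<lfloor>oup x b s / \<delta>\<rfloor> (t - s) (shift s b)"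

lemma cpath_restart: "0 \<le> s \<Longrightarrow> b \<in> pathC \<Longrightarrow> cpath p (\<lambda>t. restart s t b)"
  unfolding restart_def
  by (rule cpath_unshift[of p "\<lambda>t. Ki \<lfloor>oup x b s / \<delta>\<rfloor> t (shift s b)"]) (auto intro: adm_cpath[OF Ki] shift_pathC)

lemma restart_zero: "b \<in> pathC \<Longrightarrow> t \<le> s \<Longrightarrow> restart s t b = 0"
  unfolding restart_def
  by (rule cpath_zero_at[of p "\<lambda>t. Ki \<lfloor>oup x b s / \<delta>\<rfloor> t (shift s b)"]) (auto intro: adm_cpath[OF Ki] shift_pathC)

text \<open>Before \<open>s\<close> the selecting index is not yet known, but the control vanishes
  there for every index. After \<open>s\<close> the index is known and takes countably many values,
  and the shifted path up to \<open>t - s\<close> is read off from the path up to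
  \<open>t\<close>.\<close>

lemma adm_restart:
  assumes s: "0 \<le> s" shows "adm p (restart s)"
  unfolding adm_def
proof (intro conjI allI ballI cpath_restart s)
  fix t
  show "restart s t \<in> borel_measurable (paths {..t})"
  proof (cases "t \<le> s")
    case True
    then show ?thesis
      by (subst measurable_cong[of _ _ "\<lambda>_. 0"]) (auto simp: restart_zero)
  next
    case False
    show ?thesis
      unfolding restart_def[abs_def]
    proof (rule measurable_compose_countable[where f="\<lambda>i b. Ki i (t - s) (shift s b)" and g="\<lambda>b. \<lfloor>oup x b s / \<delta>\<rfloor>"])
      have "shift s \<in> paths {..t} \<rightarrow>\<^sub>M paths {..t - s}" using measurable_shift_adapted[of "t - s" s] False by simp
      from measurable_compose[OF this adm_adapted[OF Ki]]
      show "(\<lambda>b. Ki i (t - s) (shift s b)) \<in> borel_measurable (paths {..t})" for i .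
      have [measurable]: "(\<lambda>b. oup x b s) \<in> borel_measurable (paths {..t})"
        using False by (intro measurable_paths_mono[OF _ measurable_ou_adapted]) auto
      show "(\<lambda>b. \<lfloor>oup x b s / \<delta>\<rfloor>) \<in> paths {..t} \<rightarrow>\<^sub>M count_space UNIV" by measurable
    qed
  qed
qed

lemma restart_conc:
  "a \<in> pathC \<Longrightarrow> b \<in> pathC \<Longrightarrow> restart s (s + u) (conc s a b) = Ki \<lfloor>oup x a s / \<delta>\<rfloor> u b"
  unfolding restart_def by (simp add: ou_conc_le shift_conc)

definition restart_at :: "('a \<Rightarrow> ennreal) \<Rightarrow> real \<Rightarrow> 'a \<Rightarrow> real" where
  "restart_at S t w = (if S w = \<infinity> then 0 else restart (enn2real (S w)) t (\<beta> w))"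

lemma cpath_zero: "cpath p (\<lambda>_. 0)"
  using cp by (auto simp: cpath_def mono_def)

lemma cpath_restart_at: "cpath p (\<lambda>t. restart_at S t w)"
  unfolding restart_at_def
  by (cases "S w = \<infinity>") (simp_all only: simp_thms if_True if_False cpath_zero cpath_restart[OF enn2real_nonneg bpath_pathC])

lemma restart_at_dyadic: "w \<in> at_dyadic n S k \<Longrightarrow> restart_at S t w = restart (real k / 2 ^ n) t (\<beta> w)"
  by (auto simp: restart_at_def at_dyadic_def)

text \<open>Pieces that enter after \<open>t\<close> still have control 0 at \<open>t\<close>. So a
  finite sum over grid times up to \<open>t\<close> remains, and the events in it are known by
  then.\<close>

lemma restart_at_adapted:
  assumes S: "dyadic_time n S" and t: "0 \<le> t"
  shows "restart_at S t \<in> borel_measurable (\<F> (ennreal t))"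
proof -
  let ?E = "at_dyadic n S" and ?d = "\<lambda>k. real k / 2 ^ n"
  let ?I = "{k. ?d k \<le> t}"
  have "?I \<subseteq> {..nat \<lfloor>2 ^ n * t\<rfloor>}"
  proof
    fix k assume "k \<in> ?I"
    then have "of_nat k \<le> 2 ^ n * t" by (simp add: divide_le_eq mult.commute)
    then show "k \<in> {..nat \<lfloor>2 ^ n * t\<rfloor>}" using le_nat_floor by simp
  qed
  then have fin: "finite ?I" by (rule finite_subset) simp
  have eq: "restart_at S t w = (\<Sum>k\<in>?I. indicator (?E k) w * restart (?d k) t (\<beta> w))" if w: "w \<in> space M" for w
  proof (cases "S w = \<infinity>")
    case True
    then show ?thesis by (auto simp: restart_at_def at_dyadic_def indicator_def intro!: sum.neutral[symmetric])
  next
    case False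
    then obtain j where j: "S w = ennreal (?d j)" using S by (auto simp: dyadic_time_def)
    have ind: "indicator (?E k) w = (if k = j then 1 else 0 :: real)" for k
      using w j ennreal_dyadic_inject[of j n k] by (auto simp: at_dyadic_def indicator_def)
    have "(\<Sum>k\<in>?I. indicator (?E k) w * restart (?d k) t (\<beta> w)) = (\<Sum>k\<in>?I. if k = j then restart (?d j) t (\<beta> w) else 0)"
      by (intro sum.cong) (auto simp: ind)
    also have "\<dots> = (if j \<in> ?I then restart (?d j) t (\<beta> w) else 0)" by (rule sum.delta[OF fin])
    also have "\<dots> = restart_at S t w"
      using j restart_zero[OF bpath_pathC, of t "?d j"] by (auto simp: restart_at_def)
    finally show ?thesis by simp
  qed
  have "(\<lambda>w. \<Sum>k\<in>?I. indicator (?E k) w * restart (?d k) t (\<beta> w)) \<in> borel_measurable (\<F> (ennreal t))"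
  proof (intro borel_measurable_sum borel_measurable_times borel_measurable_indicator)
    fix k assume "k \<in> ?I"
    then have "ennreal (?d k) \<le> ennreal t" by (auto intro: ennreal_leI)
    then show "?E k \<in> sets (\<F> (ennreal t))" by (rule subsetD[OF filtration_mono at_dyadic_filtration[OF S]])
    show "(\<lambda>w. restart (?d k) t (\<beta> w)) \<in> borel_measurable (\<F> (ennreal t))"
      by (rule measurable_compose[OF bpath_adapted[OF t] adm_adapted[OF adm_restart]]) simp
  qed
  then show ?thesis by (subst measurable_cong[OF eq]) auto
qed

lemma restart_at_control: "dyadic_time n S \<Longrightarrow> restart_at S \<in> controls M B c S"
  by (rule cpath_control[OF cpath_restart_at restart_at_adapted])
     (auto simp: restart_at_def intro: restart_zero[OF bpath_pathC])

lemma restart_at_measurable: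
  assumes S: "dyadic_time n S" shows "restart_at S t \<in> borel_measurable M"
proof (cases "0 \<le> t")
  case True
  then show ?thesis using measurable_filtration_le[OF restart_at_adapted[OF S True]] by simp
next
  case False
  then have "restart_at S t w = 0" for w using cpath_zero_at[OF cpath_restart_at, of t] by simp
  then show ?thesis by (simp add: measurable_cong[of M "restart_at S t" "\<lambda>_. 0"])
qed

lemma restart_at_cost:
  assumes S: "dyadic_time n S" and e: "0 \<le> e" and opt: "\<And>z. J z (Ki \<lfloor>z / \<delta>\<rfloor>) \<le> W z + e"
  shows "expectation (Cost x S (restart_at S)) \<le> expectation (Pay x S) + e"
proof (rule Cost_le_Pay[OF S, where K="\<lambda>k. restart (real k / 2 ^ n)"])
  show "adm p (restart (real k / 2 ^ n))" for k by (rule adm_restart) simp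
  show "restart (real k / 2 ^ n) (real k / 2 ^ n) b = 0" if "b \<in> pathC" for k b
    by (rule restart_zero[OF that]) simp
  show "restart_at S t w = restart (real k / 2 ^ n) t (\<beta> w)" if "w \<in> at_dyadic n S k" for k w t
    by (rule restart_at_dyadic[OF that])
  show "J (oup x (\<beta> w) (real k / 2 ^ n)) (\<lambda>u b. restart (real k / 2 ^ n) (real k / 2 ^ n + u) (conc (real k / 2 ^ n) (\<beta> w) b))
      \<le> W (oup x (\<beta> w) (real k / 2 ^ n)) + e" for k w
    by (subst J_cong[of _ "Ki \<lfloor>oup x (\<beta> w) (real k / 2 ^ n) / \<delta>\<rfloor>"]) (simp_all add: restart_conc bpath_pathC opt)
qed (use restart_at_measurable[OF S] cpath_restart_at e in auto)

end

section \<open>Passage from dyadic to general entry times\<close>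

lemma discount_measurable:
  assumes [measurable]: "\<tau> \<in> borel_measurable M" shows "(\<lambda>w. discount lam (\<tau> w)) \<in> borel_measurable M"
  unfolding discount_def by measurable

lemma discount_range: "0 \<le> discount lam t" "discount lam t \<le> 1"
  using lam by (auto simp: discount_def)

lemma discount_integrable: "\<tau> \<in> borel_measurable M \<Longrightarrow> integrable M (\<lambda>w. discount lam (\<tau> w))"
  using discount_range by (intro integrable_const_bound[of _ 1] discount_measurable) auto

lemma control_value:
  assumes nu: "AE w in M. \<tau> w < \<infinity> \<longrightarrow> (\<forall>t\<ge>0. \<nu> t w = g t w)"
    and g: "\<And>t. g t \<in> borel_measurable M" "\<And>w. cpath p (\<lambda>t. g t w)" and tau: "\<tau> \<in> borel_measurable M"
  shows "(\<integral>w. control_cost lam \<Phi> (X x) c \<tau> \<nu> w - discount lam (\<tau> w) * P0 \<partial>M) =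
    expectation (Cost x \<tau> g) - (\<integral>w. discount lam (\<tau> w) \<partial>M) * P0"
proof -
  note i = Cost_integrable[OF g tau] discount_integrable[OF tau]
  have "AE w in M. Cost x \<tau> g w - discount lam (\<tau> w) * P0 = control_cost lam \<Phi> (X x) c \<tau> \<nu> w - discount lam (\<tau> w) * P0"
    using control_cost_AE[OF nu, of x] by eventually_elim (simp add: Cost_def)
  then have "(\<integral>w. Cost x \<tau> g w - discount lam (\<tau> w) * P0 \<partial>M) =
     (\<integral>w. control_cost lam \<Phi> (X x) c \<tau> \<nu> w - discount lam (\<tau> w) * P0 \<partial>M)"
    using i by (intro integral_cong_AE_complete borel_measurable_integrable Bochner_Integration.integrable_diff integrable_mult_left)
  then show ?thesis using i by simp
qed

text \<open>The discounted value decays at rate \<open>lam / 2\<close> along almost every path by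
  \<open>discounted_W_bound\<close>, so the liminf is in fact a limit.\<close>

lemma payoff_at_infinity_zero:
  "AE w in M. payoff_at_infinity lam P0 (\<lambda>y. U_value M B lam \<Phi> X y c) (X x) w = 0"
  using ou_growth X_eq[of x]
proof eventually_elim
  case (elim w)
  let ?d = "(1 + 2 * F) * (D x w + D0)"
  have tend0: "((\<lambda>t. exp (- r * t)) \<longlongrightarrow> 0) at_top" if "0 < r" for r :: real
  proof -
    have "LIM t at_top. - r * t :> at_bot"
      using that by (simp add: filterlim_uminus_at_bot filterlim_tendsto_pos_mult_at_top[OF tendsto_const _ filterlim_ident])
    then show ?thesis by (rule filterlim_compose[OF exp_at_bot])
  qed
  have "((\<lambda>t. exp (- lam * t) * (W (X x t w) - P0)) \<longlongrightarrow> 0) at_top"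
  proof (rule Lim_null_comparison)
    show "((\<lambda>t. ?d * exp (- (lam / 2) * t) + exp (- lam * t) * \<bar>P0\<bar>) \<longlongrightarrow> 0) at_top"
      using lam by (intro tendsto_add_zero tendsto_mult_right_zero tendsto_mult_left_zero tend0) auto
    show "\<forall>\<^sub>F t in at_top. norm (exp (- lam * t) * (W (X x t w) - P0)) \<le> ?d * exp (- (lam / 2) * t) + exp (- lam * t) * \<bar>P0\<bar>"
      using eventually_ge_at_top[of 0]
    proof eventually_elim
      case (elim t)
      have "\<bar>exp (- lam * t) * W (oup x (\<beta> w) t)\<bar> \<le> ?d * exp (- (lam / 2) * t)"
        using \<open>\<forall>x. \<forall>t\<ge>0. \<bar>oup x (\<beta> w) t\<bar> \<le> D x w * exp (lam / 2 * t)\<close> elim by (intro discounted_W_bound) auto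
      moreover have X: "X x t w = oup x (\<beta> w) t" using \<open>\<forall>t\<ge>0. X x t w = oup x (\<beta> w) t\<close> elim by simp
      moreover have "\<bar>exp (- lam * t) * P0\<bar> = exp (- lam * t) * \<bar>P0\<bar>" by (simp add: abs_mult)
      ultimately show ?case unfolding right_diff_distrib real_norm_def X by linarith
    qed
  qed
  then have "((\<lambda>t. ereal (exp (- lam * t) * (W (X x t w) - P0))) \<longlongrightarrow> ereal 0) at_top" by simp
  from lim_imp_Liminf[OF trivial_limit_at_top_linorder this]
  show ?case unfolding payoff_at_infinity_def U_value_W by (simp add: zero_ereal_def)
qed

lemma payoff_value:
  assumes tau: "\<tau> \<in> borel_measurable M"
  shows "(\<integral>w. stopped_payoff lam P0 (\<lambda>y. U_value M B lam \<Phi> X y c) (X x) \<tau> w \<partial>M) =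
    expectation (Pay x \<tau>) - (\<integral>w. discount lam (\<tau> w) \<partial>M) * P0"
proof -
  note i = Pay_integrable[OF tau, of x] discount_integrable[OF tau]
  have "AE w in M. Pay x \<tau> w - discount lam (\<tau> w) * P0 = stopped_payoff lam P0 (\<lambda>y. U_value M B lam \<Phi> X y c) (X x) \<tau> w"
    using payoff_at_infinity_zero[of P0 x] X_eq[of x]
    by eventually_elim (simp add: stopped_payoff_def U_value_W Pay_def discount_def right_diff_distrib)
  then have "(\<integral>w. Pay x \<tau> w - discount lam (\<tau> w) * P0 \<partial>M) =
     (\<integral>w. stopped_payoff lam P0 (\<lambda>y. U_value M B lam \<Phi> X y c) (X x) \<tau> w \<partial>M)"
    using i by (intro integral_cong_AE_complete borel_measurable_integrable Bochner_Integration.integrable_diff integrable_mult_left)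
  then show ?thesis using i by simp
qed

lemma ceil_time_real:
  assumes "\<tau> w \<noteq> \<infinity>" shows "enn2real (ceil_time n \<tau> w) = real (nat \<lceil>2 ^ n * enn2real (\<tau> w)\<rceil>) / 2 ^ n"
  unfolding ceil_time_def if_not_P[OF assms] by (rule enn2real_ennreal, rule divide_nonneg_nonneg, rule of_nat_0_le_iff, simp)

lemma ceil_time_infinity: "ceil_time n \<tau> w = \<infinity> \<longleftrightarrow> \<tau> w = \<infinity>"
  by (simp add: ceil_time_def)

lemma ceil_time_tendsto:
  assumes "\<tau> w \<noteq> \<infinity>" shows "(\<lambda>n. enn2real (ceil_time n \<tau> w)) \<longlonglongrightarrow> enn2real (\<tau> w)"
  unfolding ceil_time_real[of \<tau> w, OF assms] by (rule ceil_dyadic_tendsto) simp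

lemma discount_ceil_tendsto:
  assumes tau: "stopping_time \<F> \<tau>"
  shows "(\<lambda>n. \<integral>w. discount lam (ceil_time n \<tau> w) \<partial>M) \<longlonglongrightarrow> (\<integral>w. discount lam (\<tau> w) \<partial>M)"
proof (rule integral_dominated_convergence[where w="\<lambda>_. 1"])
  show "AE w in M. (\<lambda>n. discount lam (ceil_time n \<tau> w)) \<longlonglongrightarrow> discount lam (\<tau> w)"
  proof (rule AE_I2)
    fix w
    show "(\<lambda>n. discount lam (ceil_time n \<tau> w)) \<longlonglongrightarrow> discount lam (\<tau> w)"
    proof (cases "\<tau> w = \<infinity>")
      case False
      then show ?thesis unfolding discount_def ceil_time_infinity
        by (simp only: if_False) (intro tendsto_intros ceil_time_tendsto)
    next
      case True
      then show ?thesis unfolding discount_def ceil_time_infinity by simp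
    qed
  qed
  show "AE w in M. norm (discount lam (ceil_time n \<tau> w)) \<le> 1" for n
    using discount_range by (intro AE_I2) auto
qed (use stopping_time_measurable[OF tau] stopping_time_measurable[OF stopping_time_ceil[OF tau]] in
    \<open>auto intro: discount_measurable\<close>)

lemma Pay_ceil_tendsto:
  assumes tau: "stopping_time \<F> \<tau>"
  shows "(\<lambda>n. \<integral>w. Pay x (ceil_time n \<tau>) w \<partial>M) \<longlonglongrightarrow> expectation (Pay x \<tau>)"
proof (rule integral_dominated_convergence[where w="\<lambda>w. (1 + 2 * F) * (D x w + D0)"])
  show "AE w in M. (\<lambda>n. Pay x (ceil_time n \<tau>) w) \<longlonglongrightarrow> Pay x \<tau> w"
  proof (rule AE_I2)
    fix w
    show "(\<lambda>n. Pay x (ceil_time n \<tau>) w) \<longlonglongrightarrow> Pay x \<tau> w"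
    proof (cases "\<tau> w = \<infinity>")
      case False
      then show ?thesis unfolding Pay_def ceil_time_infinity
        by (simp only: if_False)
           (intro tendsto_intros ceil_time_tendsto isCont_tendsto_compose[OF W_continuous]
              isCont_tendsto_compose[OF isCont_ou[OF bpath_pathC]])
    next
      case True
      then show ?thesis unfolding Pay_def ceil_time_infinity by simp
    qed
  qed
  show "integrable M (\<lambda>w. (1 + 2 * F) * (D x w + D0))" by (rule dominator_integrable)
  show "AE w in M. norm (Pay x (ceil_time n \<tau>) w) \<le> (1 + 2 * F) * (D x w + D0)" for n
    using Pay_AE_bound[of x "ceil_time n \<tau>"] by simp
qed (use stopping_time_measurable[OF tau] stopping_time_measurable[OF stopping_time_ceil[OF tau]] in
    \<open>auto intro: Pay_measurable\<close>)

text \<open>\<open>K\<close> vanishes at \<tau> but perhaps no longer at the later rounded time;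
  only the delayed control is a legitimate competitor there. Both times are infinite on the same
  outcomes, elsewhere the cost converges path by path, and the majorant does not depend on the
  grid.\<close>

lemma Cost_delay_tendsto:
  assumes tau: "stopping_time \<F> \<tau>" and K: "adm p K"
    and zero: "AE w in M. \<tau> w < \<infinity> \<longrightarrow> K (enn2real (\<tau> w)) (\<beta> w) = 0"
  shows "(\<lambda>n. \<integral>w. Cost x (ceil_time n \<tau>) (\<lambda>t w. delay (enn2real (ceil_time n \<tau> w)) (\<lambda>u. K u (\<beta> w)) t) w \<partial>M)
    \<longlonglongrightarrow> expectation (Cost x \<tau> (\<lambda>t w. K t (\<beta> w)))"
proof (rule integral_dominated_convergence[where w="\<lambda>w. (1 + 2 * F) * (D x w + 0)"])
  let ?g = "\<lambda>n t w. delay (enn2real (ceil_time n \<tau> w)) (\<lambda>u. K u (\<beta> w)) t"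
  note K' = adm_bpath[OF K]
  have tm [measurable]: "ceil_time n \<tau> \<in> borel_measurable M" for n
    by (rule stopping_time_measurable[OF stopping_time_ceil[OF tau]])
  have [measurable]: "?g n t \<in> borel_measurable M" for n t
  proof -
    note K'(1)[measurable]
    show ?thesis unfolding delay_def by measurable
  qed
  have gc: "cpath p (\<lambda>t. ?g n t w)" for n w by (intro cpath_delay K') simp
  show "Cost x (ceil_time n \<tau>) (?g n) \<in> borel_measurable M" for n
    by (rule Cost_measurable[OF _ gc tm]) measurable
  show "Cost x \<tau> (\<lambda>t w. K t (\<beta> w)) \<in> borel_measurable M"
    by (rule Cost_measurable[OF K' stopping_time_measurable[OF tau]])
  show "integrable M (\<lambda>w. (1 + 2 * F) * (D x w + 0))" by (rule dominator_integrable)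
  show "AE w in M. norm (Cost x (ceil_time n \<tau>) (?g n) w) \<le> (1 + 2 * F) * (D x w + 0)" for n
    using Cost_AE_bound[of "?g n" x "ceil_time n \<tau>", OF gc] by (simp only: real_norm_def)
  show "AE w in M. (\<lambda>n. Cost x (ceil_time n \<tau>) (?g n) w) \<longlonglongrightarrow> Cost x \<tau> (\<lambda>t w. K t (\<beta> w)) w"
    using zero ou_growth
  proof eventually_elim
    case (elim w)
    show ?case
    proof (cases "\<tau> w = \<infinity>")
      case False
      then have "K (enn2real (\<tau> w)) (\<beta> w) = 0" using elim(1) by (simp add: less_top)
      moreover have "enn2real (\<tau> w) \<le> enn2real (ceil_time n \<tau> w)" for n
        unfolding ceil_time_real[of \<tau> w, OF False] by (rule ceil_dyadic_bounds) simp
      ultimately show ?thesis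
        using False elim(2) unfolding Cost_def ceil_time_infinity
        by (simp only: if_False)
           (intro pc_delay_tendsto[OF K'(2) _ _ isCont_ou[OF bpath_pathC]] ceil_time_tendsto, auto)
    next
      case True
      then show ?thesis unfolding Cost_def ceil_time_infinity by simp
    qed
  qed
qed

lemma discount_bound:
  assumes tau: "\<tau> \<in> borel_measurable M" shows "\<bar>(\<integral>w. discount lam (\<tau> w) \<partial>M) * P0\<bar> \<le> \<bar>P0\<bar>"
proof -
  have "0 \<le> (\<integral>w. discount lam (\<tau> w) \<partial>M)" by (intro integral_nonneg_AE AE_I2 discount_range)
  moreover have "(\<integral>w. discount lam (\<tau> w) \<partial>M) \<le> (\<integral>w. 1 \<partial>M)"
    by (intro integral_mono discount_integrable[OF tau] integrable_const discount_range)
  ultimately show ?thesis by (simp add: abs_mult prob_space mult_left_le_one_le)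
qed

lemma value_identity:
  "V_value M B lam P0 \<Phi> X x c = (INF \<tau> \<in> {\<tau>. stopping_time \<F> \<tau>}.
     \<integral>w. stopped_payoff lam P0 (\<lambda>y. U_value M B lam \<Phi> X y c) (X x) \<tau> w \<partial>M)"
proof (rule antisym)
  let ?u = "\<lambda>y. U_value M B lam \<Phi> X y c"
  let ?A = "{(\<tau>, \<nu>). stopping_time \<F> \<tau> \<and> \<nu> \<in> controls M B c \<tau>}"
  let ?v = "\<lambda>(\<tau>, \<nu>). \<integral>w. control_cost lam \<Phi> (X x) c \<tau> \<nu> w - discount lam (\<tau> w) * P0 \<partial>M"
  let ?q = "\<lambda>\<tau>. \<integral>w. stopped_payoff lam P0 ?u (X x) \<tau> w \<partial>M"
  note stm = stopping_time_measurable
  have V: "V_value M B lam P0 \<Phi> X x c = Inf (?v ` ?A)" by (simp add: V_value_def)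
  have rep: "\<exists>K. adm p K \<and> ?v (\<tau>, \<nu>) = expectation (Cost x \<tau> (\<lambda>t w. K t (\<beta> w))) - (\<integral>w. discount lam (\<tau> w) \<partial>M) * P0
      \<and> (AE w in M. \<tau> w < \<infinity> \<longrightarrow> K (enn2real (\<tau> w)) (\<beta> w) = 0)"
    if A: "(\<tau>, \<nu>) \<in> ?A" for \<tau> \<nu>
  proof -
    have tau: "stopping_time \<F> \<tau>" and nu: "\<nu> \<in> controls M B c \<tau>" using A by auto
    obtain K where K: "adm p K" "AE w in M. \<tau> w < \<infinity> \<longrightarrow> (\<forall>t\<ge>0. \<nu> t w = K t (\<beta> w))"
      using control_representation[OF nu c] by blast
    have "AE w in M. \<tau> w < \<infinity> \<longrightarrow> \<nu> (enn2real (\<tau> w)) w = 0"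
      using nu by (auto simp: controls_def elim!: eventually_mono)
    then have "AE w in M. \<tau> w < \<infinity> \<longrightarrow> K (enn2real (\<tau> w)) (\<beta> w) = 0"
      using K(2) by eventually_elim simp
    moreover have "?v (\<tau>, \<nu>) = expectation (Cost x \<tau> (\<lambda>t w. K t (\<beta> w))) - (\<integral>w. discount lam (\<tau> w) \<partial>M) * P0"
      unfolding case_prod_conv by (rule control_value[OF K(2) adm_bpath[OF K(1)] stm[OF tau]])
    ultimately show ?thesis using K(1) by blast
  qed
  \<comment> \<open>For infima of reals \<open>cINF_lower\<close> asks for a lower bound. The
    expected majorant together with the modulus of \<open>P0\<close> gives one that is uniform in
    \<tau> and \<nu>.\<close>
  have bddV: "bdd_below (?v ` ?A)"
  proof (rule bdd_belowI2[where m="- ((1 + 2 * F) * (\<bar>x\<bar> + D0 + 0)) - \<bar>P0\<bar>"])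
    fix z assume z: "z \<in> ?A"
    then obtain \<tau> \<nu> where zz: "z = (\<tau>, \<nu>)" "stopping_time \<F> \<tau>" by auto
    obtain K where K: "adm p K" and v: "?v (\<tau>, \<nu>) = expectation (Cost x \<tau> (\<lambda>t w. K t (\<beta> w))) - (\<integral>w. discount lam (\<tau> w) \<partial>M) * P0"
      using rep[of \<tau> \<nu>] z zz(1) by blast
    show "- ((1 + 2 * F) * (\<bar>x\<bar> + D0 + 0)) - \<bar>P0\<bar> \<le> ?v z"
      unfolding zz(1) v
      using dominated(2)[OF Cost_measurable[OF adm_bpath[OF K] stm[OF zz(2)]] Cost_AE_bound[OF adm_bpath(2)[OF K]], of x]
        discount_bound[OF stm[OF zz(2)], of P0] by linarith
  qed
  have bddQ: "bdd_below (?q ` {\<tau>. stopping_time \<F> \<tau>})"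
  proof (rule bdd_belowI2[where m="- ((1 + 2 * F) * (\<bar>x\<bar> + D0 + D0)) - \<bar>P0\<bar>"])
    fix \<tau> assume "\<tau> \<in> {\<tau>. stopping_time \<F> \<tau>}"
    then have tau: "\<tau> \<in> borel_measurable M" using stm by auto
    show "- ((1 + 2 * F) * (\<bar>x\<bar> + D0 + D0)) - \<bar>P0\<bar> \<le> ?q \<tau>"
      unfolding payoff_value[OF tau]
      using dominated(2)[OF Pay_measurable[OF tau] Pay_AE_bound, of x] discount_bound[OF tau, of P0] by linarith
  qed
  have ne: "stopping_time \<F> (\<lambda>_. 0)" by (rule stopping_time_const)
  have neA: "?A \<noteq> {}" using ne adm_control[OF adm_zero] by auto
  show "V_value M B lam P0 \<Phi> X x c \<le> (INF \<tau> \<in> {\<tau>. stopping_time \<F> \<tau>}. ?q \<tau>)"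
  proof (rule cINF_greatest)
    show "{\<tau>. stopping_time \<F> \<tau>} \<noteq> {}" using ne by blast
    fix \<tau> assume "\<tau> \<in> {\<tau>. stopping_time \<F> \<tau>}"
    then have tau: "stopping_time \<F> \<tau>" by simp
    \<comment> \<open>The selected controls depend on \<open>e\<close>, so the error is removed for
      each grid separately, before the grid is refined.\<close>
    have le: "V_value M B lam P0 \<Phi> X x c \<le> expectation (Pay x (ceil_time n \<tau>)) - (\<integral>w. discount lam (ceil_time n \<tau> w) \<partial>M) * P0" for n
    proof (rule field_le_epsilon)
      fix e :: real assume e: "0 < e"
      let ?S = "ceil_time n \<tau>"
      have S: "dyadic_time n ?S" by (rule dyadic_ceil_time[OF tau])
      obtain \<delta> Ki where Ki: "\<And>i :: int. adm p (Ki i)" "\<And>z. J z (Ki \<lfloor>z / \<delta>\<rfloor>) \<le> W z + e"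
        using near_optimal_selector[OF e] by blast
      let ?nu = "restart_at \<delta> Ki x ?S"
      have "V_value M B lam P0 \<Phi> X x c \<le> ?v (?S, ?nu)"
        unfolding V by (rule cINF_lower[OF bddV]) (use stopping_time_ceil[OF tau] restart_at_control[OF Ki(1) S] in auto)
      also have "\<dots> = expectation (Cost x ?S ?nu) - (\<integral>w. discount lam (?S w) \<partial>M) * P0"
        unfolding case_prod_conv
        by (rule control_value[OF _ restart_at_measurable[OF Ki(1) S] cpath_restart_at[OF Ki(1)] stm[OF stopping_time_ceil[OF tau]]]) simp
      also have "expectation (Cost x ?S ?nu) \<le> expectation (Pay x ?S) + e"
        using e by (intro restart_at_cost[OF Ki(1) S _ Ki(2)]) auto
      finally show "V_value M B lam P0 \<Phi> X x c \<le> expectation (Pay x ?S) - (\<integral>w. discount lam (?S w) \<partial>M) * P0 + e" by simp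
    qed
    have "(\<lambda>n. expectation (Pay x (ceil_time n \<tau>)) - (\<integral>w. discount lam (ceil_time n \<tau> w) \<partial>M) * P0) \<longlonglongrightarrow> ?q \<tau>"
      unfolding payoff_value[OF stm[OF tau]]
      by (intro tendsto_intros Pay_ceil_tendsto discount_ceil_tendsto tau)
    then show "V_value M B lam P0 \<Phi> X x c \<le> ?q \<tau>" using le by (intro LIMSEQ_le_const) auto
  qed
  show "(INF \<tau> \<in> {\<tau>. stopping_time \<F> \<tau>}. ?q \<tau>) \<le> V_value M B lam P0 \<Phi> X x c"
    unfolding V
  proof (rule cINF_greatest[OF neA])
    fix z assume z: "z \<in> ?A"
    then obtain \<tau> \<nu> where zz: "z = (\<tau>, \<nu>)" and tau: "stopping_time \<F> \<tau>" by auto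
    obtain K where K: "adm p K" and v: "?v z = expectation (Cost x \<tau> (\<lambda>t w. K t (\<beta> w))) - (\<integral>w. discount lam (\<tau> w) \<partial>M) * P0"
      and zero: "AE w in M. \<tau> w < \<infinity> \<longrightarrow> K (enn2real (\<tau> w)) (\<beta> w) = 0"
      using rep[of \<tau> \<nu>] z zz by blast
    note K' = adm_bpath[OF K]
    let ?S = "\<lambda>n. ceil_time n \<tau>"
    let ?g = "\<lambda>n t w. delay (enn2real (?S n w)) (\<lambda>u. K u (\<beta> w)) t"
    have le: "(INF \<tau> \<in> {\<tau>. stopping_time \<F> \<tau>}. ?q \<tau>) \<le>
       expectation (Cost x (?S n) (?g n)) - (\<integral>w. discount lam (?S n w) \<partial>M) * P0" for n
    proof -
      have S: "dyadic_time n (?S n)" by (rule dyadic_ceil_time[OF tau])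
      note Sm = stm[OF stopping_time_ceil[OF tau]]
      have "(INF \<tau> \<in> {\<tau>. stopping_time \<F> \<tau>}. ?q \<tau>) \<le> ?q (?S n)"
        by (rule cINF_lower[OF bddQ]) (use stopping_time_ceil[OF tau] in simp)
      also have "\<dots> = expectation (Pay x (?S n)) - (\<integral>w. discount lam (?S n w) \<partial>M) * P0"
        by (rule payoff_value[OF Sm])
      \<comment> \<open>On a piece the random delay time is the number \<open>k / 2 ^ n\<close>.
        There the delayed control coincides with a deterministic delay of \<open>K\<close>, which is
        admissible by \<open>adm_delay\<close>.\<close>
      also have "expectation (Pay x (?S n)) \<le> expectation (Cost x (?S n) (?g n))"
      proof (rule Pay_le_Cost[OF S, where K="\<lambda>k u b. delay (real k / 2 ^ n) (\<lambda>u. K u b) u"])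
        show "adm p (\<lambda>u b. delay (real k / 2 ^ n) (\<lambda>u. K u b) u)" for k by (rule adm_delay[OF K]) simp
        show "?g n t \<in> borel_measurable M" for t
        proof -
          note K'(1)[measurable] Sm[measurable]
          show ?thesis unfolding delay_def by measurable
        qed
        show "cpath p (\<lambda>t. ?g n t w)" for w by (intro cpath_delay K') simp
      qed (auto simp: delay_def at_dyadic_def)
      finally show ?thesis by simp
    qed
    have "(\<lambda>n. expectation (Cost x (?S n) (?g n)) - (\<integral>w. discount lam (?S n w) \<partial>M) * P0) \<longlonglongrightarrow> ?v z"
      unfolding v by (intro tendsto_intros Cost_delay_tendsto discount_ceil_tendsto tau K zero)
    then show "(INF \<tau> \<in> {\<tau>. stopping_time \<F> \<tau>}. ?q \<tau>) \<le> ?v z" using le by (intro LIMSEQ_le_const) auto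
  qed
qed

end

theorem proposition3p2:
  fixes M :: "'a measure"
    and B :: "real \<Rightarrow> 'a \<Rightarrow> real"
    and X :: "real \<Rightarrow> real \<Rightarrow> 'a \<Rightarrow> real"
    and \<Phi> :: "real \<Rightarrow> real"
    and \<theta> \<mu> \<sigma> lam P0 :: real
  assumes "prob_space M" and "complete_measure M"
    and "brownian_motion M B"
    and "\<theta> > 0" and "\<mu> > 0" and "\<sigma> > 0" and "lam > 0" and "P0 > 0"
    and "\<And>x. OU_strong_solution M B \<theta> \<mu> \<sigma> x (X x)"
    and "C2 \<Phi>"
    and "antimono_on {0..1} \<Phi>"
    and "strictly_convex_on {0..1} \<Phi>"
    and "\<Phi> 1 = 0"
    and "(\<forall>c\<in>{0..1}. lam + \<theta> + lam * deriv \<Phi> c > 0) \<or>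
         (\<forall>c\<in>{0..1}. lam + \<theta> + lam * deriv \<Phi> c < 0)"
  shows "\<forall>x. \<forall>c\<in>{0..1}.
      V_value M B lam P0 \<Phi> X x c =
        (INF \<tau> \<in> {\<tau>. stopping_time (brownian_filtration M B) \<tau>}.
           \<integral>\<omega>. stopped_payoff lam P0 (\<lambda>y. U_value M B lam \<Phi> X y c) (X x) \<tau> \<omega> \<partial>M)
      \<and> (AE \<omega> in M. payoff_at_infinity lam P0 (\<lambda>y. U_value M B lam \<Phi> X y c) (X x) \<omega> = 0)"
proof (intro allI ballI)
  fix x c :: real assume c: "c \<in> {0..1}"
  have "isCont \<Phi> z" for z
    using assms(10) unfolding C2_def by (blast intro: field_differentiable_imp_continuous_at)
  then have "\<Phi> \<in> borel_measurable borel"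
    by (intro borel_measurable_continuous_onI continuous_at_imp_continuous_on ballI)
  \<comment> \<open>On [0,1] the decreasing function lies between its values \<Phi>(1) = 0 and
    \<Phi>(0), which makes \<Phi>(0) the bound \<open>F\<close> of the locale.\<close>
  moreover have "\<forall>z\<in>{0..1}. \<bar>\<Phi> z\<bar> \<le> \<Phi> 0"
  proof
    fix z :: real assume z: "z \<in> {0..1}"
    then have "\<Phi> z \<le> \<Phi> 0" "\<Phi> 1 \<le> \<Phi> z"
      using monotone_onD[OF assms(11), of 0 z] monotone_onD[OF assms(11), of z 1] by auto
    then show "\<bar>\<Phi> z\<bar> \<le> \<Phi> 0" using assms(13) by simp
  qed
  moreover have "bm M B"
    using assms(1-3) by (simp add: bm_def bm_axioms_def)
  ultimately interpret ou_problem M B X \<Phi> \<theta> \<mu> \<sigma> lam "\<Phi> 0" c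
    using assms c by (simp add: ou_problem_def ou_problem_axioms_def)
  show "V_value M B lam P0 \<Phi> X x c =
        (INF \<tau> \<in> {\<tau>. stopping_time (brownian_filtration M B) \<tau>}.
           \<integral>\<omega>. stopped_payoff lam P0 (\<lambda>y. U_value M B lam \<Phi> X y c) (X x) \<tau> \<omega> \<partial>M)
      \<and> (AE \<omega> in M. payoff_at_infinity lam P0 (\<lambda>y. U_value M B lam \<Phi> X y c) (X x) \<omega> = 0)"
    using value_identity payoff_at_infinity_zero by blast
qed

end
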